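(* Let $\Bbbk$ be a field of characteristic zero. For $n\ge2$, in $\Lambda_\Bbbk[t,q]$ one has $$\frac{\partial\mathcal{S}_n}{\partial p_1}=\mathcal{S}_{n-1}+tq\,p_1\Bigl(1+q\,p_1\frac{\partial}{\partial p_1}\Bigr)\mathcal{S}_{n-2},$$ where $\mathcal{S}_m=\mathcal{S}_m(t,q)$.
   Context: $\Lambda_\Bbbk=\Bbbk[p_1,p_2,\dots]$ is the ring of symmetric functions written in power sums. The Frobenius characteristic of a $\Bbbk S_m$-module $V$ is $\mathrm{ch}(V)=\frac{1}{m!}\sum_{\sigma\in S_m}\mathrm{tr}(\sigma|_V)p_{\lambda(\sigma)}$, where $p_{\lambda(\sigma)}=\prod_ip_i^{m_i(\sigma)}$ and $m_i(\sigma)$ is the number of $i$-cycles of $\sigma$. For $m\ge1$: $Y_m=\{(x_1,\dots,x_m)\in(\mathbb{R}^3)^m:x_i\ne0,\ x_i\ne\pm x_j\ (i<j)\}$ with the signed permutation group $B_m$ acting by permuting and negating points, $\mathbb{Z}_2^m$ the sign-change subgroup, $B_m/\mathbb{Z}_2^m\cong S_m$. $\mathcal{Y}_m=H^*(Y_m;\Bbbk)\cong\Bbbk[u_i,u^+_{ij},u^-_{ij}]/\mathcal{J}$ (type $B_m$ graded Varchenko–Gelfand presentation: $\mathcal{J}$ generated, for $i<j<k$, by squares of all variables and $u_iu^+_{ij}-u_iu^-_{ij}-u^+_{ij}u^-_{ij}$, $u_iu^+_{ij}-u_iu_j-u^+_{ij}u_j$, $u_iu_j-u_iu^-_{ij}-u_ju^-_{ij}$,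 $u^+_{ij}u^+_{jk}-u^+_{ij}u^+_{ik}-u^+_{ik}u^+_{jk}$, $u^-_{ij}u^+_{jk}-u^-_{ij}u^-_{ik}-u^-_{ik}u^+_{jk}$, $-u^-_{ij}u^-_{jk}+u^-_{ij}u^+_{ik}-u^+_{ik}u^-_{jk}$, $-u^+_{ij}u^-_{jk}+u^+_{ij}u^-_{ik}-u^-_{ik}u^-_{jk}$; $\sigma(u_\alpha)=\pm u_\beta$ when $\sigma(\alpha)=\pm\beta$ for the linear forms $x_i,x_j-x_i,x_j+x_i$). With $v_{ij}=u^+_{ij}+u^-_{ij}$, $w_{ij}=u^+_{ij}-u^-_{ij}$ and $\mathfrak{u}$ the ideal generated by the $u_i$, $\mathrm{gr}(\mathcal{Y}_m)=\bigoplus\mathfrak{u}^i/\mathfrak{u}^{i+1}$, whose component $\mathrm{gr}(\mathcal{Y}_m)_{k,\ell}$ is spanned by classes of monomials of total degree $k$ and degree $\ell$ in the $v_{ij},w_{ij}$; $S_m$ acts on the $\mathbb{Z}_2^m$-fixed part. Define $\mathcal{S}_m(t,q)=\sum_{k,\ell}t^kq^\ell\,\mathrm{ch}\bigl(\mathrm{gr}(\mathcal{Y}_m)^{\mathbb{Z}_2^m}_{2k,\ell}\bigr)$, and $\mathcal{S}_0:=1$. *)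

theory Defs
  imports
    "HOL-Library.Poly_Mapping"
    "HOL-Computational_Algebra.Polynomial"
    "HOL-Combinatorics.Orbits"
    "HOL-Algebra.Module"
    "HOL-Algebra.QuotRing"
    "HOL-Algebra.Ideal_Product"
begin

section \<open>Multivariate polynomials\<close>

type_synonym ('x, 'k) mpol = "('x \<Rightarrow>\<^sub>0 nat) \<Rightarrow>\<^sub>0 'k"

definition mconst :: "'k \<Rightarrow> ('x, 'k::comm_ring_1) mpol" where
  "mconst c = Poly_Mapping.single 0 c"

definition mvar :: "'x \<Rightarrow> ('x, 'k::comm_ring_1) mpol" where
  "mvar x = Poly_Mapping.single (Poly_Mapping.single x 1) 1"

definition msubst :: "('x \<Rightarrow> ('y, 'k) mpol) \<Rightarrow> ('x, 'k) mpol \<Rightarrow> ('y, 'k::comm_ring_1) mpol" where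
  "msubst h f = (\<Sum>e\<in>Poly_Mapping.keys f. mconst (Poly_Mapping.lookup f e) *
     (\<Prod>x\<in>Poly_Mapping.keys e. h x ^ Poly_Mapping.lookup e x))"

definition mderiv :: "'x \<Rightarrow> ('x, 'k) mpol \<Rightarrow> ('x, 'k::comm_ring_1) mpol" where
  "mderiv x f = (\<Sum>e\<in>Poly_Mapping.keys f.
     Poly_Mapping.single (e - Poly_Mapping.single x 1)
       (of_nat (Poly_Mapping.lookup e x) * Poly_Mapping.lookup f e))"


section \<open>Vector spaces on carriers, quotients and traces\<close>

text \<open>
  The scalars range over a field type; vectors live in a \<open>module\<close> record.  The components
  \<open>mult\<close> and \<open>one\<close> of such a record are irrelevant when it is only used as a vector space.
\<close>

definition quot_module :: "('k, 'v, 'z) module_scheme \<Rightarrow> 'v set \<Rightarrow> ('k, 'v set) module" where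
  "quot_module M N = ring.extend (M Quot N)
     (Module.module.fields (\<lambda>c X. N <+>\<^bsub>M\<^esub> ((\<lambda>x. c \<odot>\<^bsub>M\<^esub> x) ` X)))"

definition vspan :: "('k::field, 'v, 'z) module_scheme \<Rightarrow> 'v set \<Rightarrow> 'v set" where
  "vspan M S = {finsum M (\<lambda>b. c b \<odot>\<^bsub>M\<^esub> b) F | c F. finite F \<and> F \<subseteq> S}"

definition is_basis :: "('k::field, 'v, 'z) module_scheme \<Rightarrow> 'v set \<Rightarrow> 'v set \<Rightarrow> bool" where
  "is_basis M V S \<longleftrightarrow> finite S \<and> S \<subseteq> V \<and>
     (\<forall>x\<in>V. \<exists>!c. c \<in> S \<rightarrow>\<^sub>E UNIV \<and> x = finsum M (\<lambda>b. c b \<odot>\<^bsub>M\<^esub> b) S)"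

definition coords :: "('k::field, 'v, 'z) module_scheme \<Rightarrow> 'v set \<Rightarrow> 'v \<Rightarrow> 'v \<Rightarrow> 'k" where
  "coords M S x = (THE c. c \<in> S \<rightarrow>\<^sub>E UNIV \<and> x = finsum M (\<lambda>b. c b \<odot>\<^bsub>M\<^esub> b) S)"

text \<open>Trace of a linear endomorphism \<open>f\<close> of the finite-dimensional subspace \<open>V\<close> of \<open>M\<close>.\<close>

definition trace_on :: "('k::field, 'v, 'z) module_scheme \<Rightarrow> 'v set \<Rightarrow> ('v \<Rightarrow> 'v) \<Rightarrow> 'k" where
  "trace_on M V f = (let S = (SOME S. is_basis M V S) in \<Sum>b\<in>S. coords M S (f b) b)"


section \<open>The graded Varchenko--Gelfand ring of type B\<close>

text \<open>\<open>U i\<close>, \<open>Up i j\<close>, \<open>Um i j\<close> name the generators attached to the linear forms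
  $x_i$, $x_j - x_i$, $x_j + x_i$.\<close>

datatype gen = U nat | Up nat nat | Um nat nat

definition gens :: "nat \<Rightarrow> gen set" where
  "gens m = {U i | i. 1 \<le> i \<and> i \<le> m}
     \<union> {Up i j | i j. 1 \<le> i \<and> i < j \<and> j \<le> m}
     \<union> {Um i j | i j. 1 \<le> i \<and> i < j \<and> j \<le> m}"

abbreviation u :: "nat \<Rightarrow> (gen, 'k::field) mpol" where "u i \<equiv> mvar (U i)"
abbreviation up :: "nat \<Rightarrow> nat \<Rightarrow> (gen, 'k::field) mpol" where "up i j \<equiv> mvar (Up i j)"
abbreviation um :: "nat \<Rightarrow> nat \<Rightarrow> (gen, 'k::field) mpol" where "um i j \<equiv> mvar (Um i j)"

definition polyB :: "nat \<Rightarrow> ('k::field, (gen, 'k) mpol) module" where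
  "polyB m = \<lparr>carrier = {f. \<forall>e\<in>Poly_Mapping.keys f. Poly_Mapping.keys e \<subseteq> gens m},
     mult = (*), one = 1, zero = 0, add = (+), smult = (\<lambda>c f. mconst c * f)\<rparr>"

definition relsB :: "nat \<Rightarrow> (gen, 'k::field) mpol set" where
  "relsB m = {mvar a ^ 2 | a. a \<in> gens m}
     \<union> (\<Union>(i, j)\<in>{(i, j). 1 \<le> i \<and> i < j \<and> j \<le> m}.
          {u i * up i j - u i * um i j - up i j * um i j,
           u i * up i j - u i * u j - up i j * u j,
           u i * u j - u i * um i j - u j * um i j})
     \<union> (\<Union>(i, j, k)\<in>{(i, j, k). 1 \<le> i \<and> i < j \<and> j < k \<and> k \<le> m}.
          {up i j * up j k - up i j * up i k - up i k * up j k,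
           um i j * up j k - um i j * um i k - um i k * up j k,
           - (um i j * um j k) + um i j * up i k - up i k * um j k,
           - (up i j * um j k) + up i j * um i k - um i k * um j k})"

text \<open>
  The cohomology ring of the space of $m$ points of $\mathbb{R}^3$ with $x_i \ne 0$ and
  $x_i \ne \pm x_j$ enters through this presentation; a generator of cohomological degree two
  counts as degree one.
\<close>

definition idealJ :: "nat \<Rightarrow> (gen, 'k::field) mpol set" where
  "idealJ m = genideal (polyB m) (relsB m)"

definition Yring :: "nat \<Rightarrow> ('k::field, (gen, 'k) mpol set) module" where
  "Yring m = quot_module (polyB m) (idealJ m)"

definition Ycls :: "nat \<Rightarrow> (gen, 'k::field) mpol \<Rightarrow> (gen, 'k) mpol set" where
  "Ycls m f = idealJ m +>\<^bsub>polyB m\<^esub> f"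


section \<open>The associated graded ring\<close>

definition uideal :: "nat \<Rightarrow> (gen, 'k::field) mpol set set" where
  "uideal m = genideal (Yring m) ((\<lambda>i. Ycls m (u i)) ` {1..m})"

fun upow :: "nat \<Rightarrow> nat \<Rightarrow> (gen, 'k::field) mpol set set" where
  "upow m 0 = carrier (Yring m)"
| "upow m (Suc i) = ideal_prod (Yring m) (uideal m) (upow m i)"

definition grY :: "nat \<Rightarrow> nat \<Rightarrow> ('k::field, (gen, 'k) mpol set set) module" where
  "grY m i = quot_module ((Yring m)\<lparr>carrier := upow m i\<rparr>) (upow m (Suc i))"

definition vwset :: "nat \<Rightarrow> (gen, 'k::field) mpol set" where
  "vwset m = {up i j + um i j | i j. 1 \<le> i \<and> i < j \<and> j \<le> m}
     \<union> {up i j - um i j | i j. 1 \<le> i \<and> i < j \<and> j \<le> m}"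

text \<open>
  Monomials in the \<open>u\<^sub>i\<close>, \<open>v\<^sub>i\<^sub>j\<close>, \<open>w\<^sub>i\<^sub>j\<close> of total degree \<open>k\<close> (every generator
  counts as degree one) and of degree \<open>l\<close> in the \<open>v\<^sub>i\<^sub>j\<close>, \<open>w\<^sub>i\<^sub>j\<close>; there are none if \<open>k < l\<close>.
\<close>

definition bimonoms :: "nat \<Rightarrow> nat \<Rightarrow> nat \<Rightarrow> (gen, 'k::field) mpol set" where
  "bimonoms m k l = {prod_list xs * prod_list ys | xs ys.
     set xs \<subseteq> u ` {1..m} \<and> set ys \<subseteq> vwset m \<and> length ys = l \<and> length xs + length ys = k}"

text \<open>A monomial with \<open>k - l\<close> factors \<open>u\<^sub>i\<close> has its class in the graded piece of index \<open>k - l\<close>.\<close>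

definition grYcomp :: "nat \<Rightarrow> nat \<Rightarrow> nat \<Rightarrow> (gen, 'k::field) mpol set set set" where
  "grYcomp m k l = vspan (grY m (k - l))
     ((\<lambda>f. upow m (Suc (k - l)) +>\<^bsub>Yring m\<^esub> Ycls m f) ` bimonoms m k l)"


section \<open>The action of the signed permutation group\<close>

text \<open>Linear forms in $x_1, x_2, \dots$ are given by their coefficient functions.\<close>

fun lform :: "gen \<Rightarrow> nat \<Rightarrow> int" where
  "lform (U i) = (\<lambda>r. of_bool (r = i))"
| "lform (Up i j) = (\<lambda>r. of_bool (r = j) - of_bool (r = i))"
| "lform (Um i j) = (\<lambda>r. of_bool (r = j) + of_bool (r = i))"

text \<open>
  An element of the signed permutation group is a pair of signs \<open>s\<close> and a permutation \<open>\<pi>\<close> of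
  \<open>{1..m}\<close>; it acts linearly on forms by $x_i \mapsto s_i\, x_{\pi(i)}$.
\<close>

definition lform_act :: "(nat \<Rightarrow> int) \<Rightarrow> (nat \<Rightarrow> nat) \<Rightarrow> (nat \<Rightarrow> int) \<Rightarrow> (nat \<Rightarrow> int)" where
  "lform_act s \<pi> \<phi> = (\<lambda>r. s (inv_into UNIV \<pi> r) * \<phi> (inv_into UNIV \<pi> r))"

definition gen_act :: "nat \<Rightarrow> (nat \<Rightarrow> int) \<Rightarrow> (nat \<Rightarrow> nat) \<Rightarrow> gen \<Rightarrow> (gen, 'k::field) mpol" where
  "gen_act m s \<pi> a = (THE f. \<exists>b\<in>gens m.
     (lform_act s \<pi> (lform a) = lform b \<and> f = mvar b) \<or>
     (lform_act s \<pi> (lform a) = (\<lambda>r. - lform b r) \<and> f = - mvar b))"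

definition poly_act :: "nat \<Rightarrow> (nat \<Rightarrow> int) \<Rightarrow> (nat \<Rightarrow> nat) \<Rightarrow> (gen, 'k::field) mpol \<Rightarrow> (gen, 'k) mpol" where
  "poly_act m s \<pi> = msubst (gen_act m s \<pi>)"

text \<open>The induced actions on cosets are given by taking images.\<close>

definition Yact :: "nat \<Rightarrow> (nat \<Rightarrow> int) \<Rightarrow> (nat \<Rightarrow> nat)
    \<Rightarrow> (gen, 'k::field) mpol set \<Rightarrow> (gen, 'k) mpol set" where
  "Yact m s \<pi> y = poly_act m s \<pi> ` y"

definition gract :: "nat \<Rightarrow> (nat \<Rightarrow> int) \<Rightarrow> (nat \<Rightarrow> nat)
    \<Rightarrow> (gen, 'k::field) mpol set set \<Rightarrow> (gen, 'k) mpol set set" where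
  "gract m s \<pi> X = Yact m s \<pi> ` X"

definition grYfix :: "nat \<Rightarrow> nat \<Rightarrow> nat \<Rightarrow> (gen, 'k::field) mpol set set set" where
  "grYfix m k l = {X \<in> grYcomp m k l. \<forall>s \<in> {1..m} \<rightarrow>\<^sub>E {1, -1}. gract m s id X = X}"


section \<open>Symmetric functions and the Frobenius characteristic\<close>

text \<open>The variable with index \<open>i\<close> stands for the power sum $p_{i+1}$.\<close>

type_synonym 'k symfun = "(nat, 'k) mpol"

definition psum :: "nat \<Rightarrow> 'k::field symfun" where
  "psum i = mvar (i - 1)"

definition num_cycles :: "nat \<Rightarrow> (nat \<Rightarrow> nat) \<Rightarrow> nat \<Rightarrow> nat" where
  "num_cycles m \<pi> i = card {C \<in> orbit \<pi> ` {1..m}. card C = i}"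

definition pcycle :: "nat \<Rightarrow> (nat \<Rightarrow> nat) \<Rightarrow> 'k::field symfun" where
  "pcycle m \<pi> = (\<Prod>i\<in>{1..m}. psum i ^ num_cycles m \<pi> i)"

text \<open>Frobenius characteristic of the subspace \<open>V\<close> of \<open>M\<close> on which a permutation \<open>\<pi>\<close> of
  \<open>{1..m}\<close> acts by \<open>\<rho> \<pi>\<close>.\<close>

definition frob_ch :: "nat \<Rightarrow> ('k::field_char_0, 'v, 'z) module_scheme \<Rightarrow> 'v set
    \<Rightarrow> ((nat \<Rightarrow> nat) \<Rightarrow> 'v \<Rightarrow> 'v) \<Rightarrow> 'k symfun" where
  "frob_ch m M V \<rho> = mconst (1 / fact m) *
     (\<Sum>\<pi> | \<pi> permutes {1..m}. mconst (trace_on M V (\<rho> \<pi>)) * pcycle m \<pi>)"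

text \<open>
  Polynomials in \<open>t\<close> and \<open>q\<close> over the symmetric functions: \<open>t\<close> is the outer and \<open>q\<close> the inner
  variable.
\<close>

type_synonym 'k symfun_tq = "'k symfun poly poly"

definition tvar :: "'k::field symfun_tq" where
  "tvar = [:0, 1:]"

definition qvar :: "'k::field symfun_tq" where
  "qvar = [:[:0, 1:]:]"

definition p1 :: "'k::field symfun_tq" where
  "p1 = [:[:psum 1:]:]"

text \<open>The derivative by $p_1$, the variable with index \<open>0\<close>, taken coefficientwise.\<close>

definition d_p1 :: "'k::field symfun_tq \<Rightarrow> 'k symfun_tq" where
  "d_p1 = map_poly (map_poly (mderiv 0))"

text \<open>
  A permutation acts on the sign-invariants through its lift with all signs \<open>1\<close>.  Only finitely
  many components are nonzero, and \<open>Sum_any\<close> is the sum over all \<open>(k, l)\<close> with nonzero term.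
\<close>

definition frobS :: "nat \<Rightarrow> 'k::field_char_0 symfun_tq" where
  "frobS m = (if m = 0 then 1 else
     Sum_any (\<lambda>(k, l). monom (monom
       (frob_ch m (grY m (2 * k - l)) (grYfix m (2 * k) l) (gract m (\<lambda>_. 1))) l) k))"

end

theory Submission
  imports Defs
begin

text \<open>
  The class in the graded ring of a suitable multiple $\zeta_{ij}$ of $w_{ij}$ or $v_{ij}$ is, like
  $u_i$, an eigenvector of the sign changes, with the weight of the $i$-th sign.  Adding a point $n$ to a
  set $S$ of indices multiplies the ring by $\{1, u_n, \zeta_{na}, \zeta_{an}\}_{a \in S}$; using this
  twice and comparing weights, the invariants for $\{1, \dots, n\}$ are spanned by those for
  $\{1, \dots, n - 1\}$ and by $\zeta_{an} u_a F$ and $\zeta_{an} \zeta_{ab} F$, with $F$ invariant for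
  $\{1, \dots, n - 1\} - \{a\}$.  Evaluating the generators at signs of linear forms turns these elements
  into functions of the order of the $|x_i|$, where moving one point past another shows that they are linearly
  independent.  So they form a basis, the stabilizer of $n$ permutes its three kinds of blocks without signs,
  and the traces satisfy a recursion that is the claimed identity, since $\partial / \partial p_1$
  corresponds to restricting to that stabilizer.
\<close>

text \<open>The obstacle is that the ring is not graded by the number of u's, and that values at
  signs respect the relations only up to lower degree: the functions belong to a filtered ring, the
  traces to a doubly graded one. Two facts bridge this. Straightening keeps the length and the
  weight of a word and never lowers its number of u's. Conversely, \<open>filt\<close> consists of
  polynomials whose homogeneous parts have the values of shorter words or of words with enough u's;
  it is multiplicative and contains the relations and the powers of the ideal of the u's. Hence the
  coefficients of a function, at basis words of the right length and number of u's, are coordinates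
  in the graded ring, and the trace of \<pi> can be computed by composing functions of r with \<pi>.
  This matters because \<pi> need not permute the basis: the words depend on the order in which
  points are removed. But if \<pi> fixes the point removed first, multiplication by the function of
  a letter maps expansions into single blocks, and the diagonal coefficients are found without any
  relation.\<close>

type_synonym 'k gpoly = "(gen, 'k) mpol"

section \<open>Evaluation of polynomials\<close>

lemma mconst_0 [simp]: "mconst 0 = 0"
  by (simp add: mconst_def)

lemma mconst_1 [simp]: "mconst 1 = 1"
  by (simp add: mconst_def)

lemma mconst_add: "mconst (a + b) = mconst a + mconst b"
  by (simp add: mconst_def single_add)

lemma mconst_minus: "mconst (- a) = - mconst a"
  by (simp add: mconst_def single_uminus)

lemma mconst_mult: "mconst (a * b) = mconst a * mconst b"
  by (simp add: mconst_def mult_single)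

lemma mconst_sum: "mconst (sum f A) = (\<Sum>x\<in>A. mconst (f x))"
  by (induction A rule: infinite_finite_induct) (auto simp: mconst_add)

lemma mconst_of_nat: "mconst (of_nat n) = of_nat n"
  by (simp add: mconst_def)

interpretation mpol: vector_space "\<lambda>c (f::('x, 'k::field) mpol). mconst c * f"
  by unfold_locales (auto simp: algebra_simps mconst_add mconst_mult)

definition monom_val :: "('x \<Rightarrow> 'r::comm_ring_1) \<Rightarrow> ('x \<Rightarrow>\<^sub>0 nat) \<Rightarrow> 'r" where
  "monom_val h e = (\<Prod>x\<in>Poly_Mapping.keys e. h x ^ Poly_Mapping.lookup e x)"

text \<open>The scalars are mapped by a parameter because two evaluations are needed: into
  polynomials again, which is \<open>msubst\<close> and thus the group action, and into univariate
  polynomials, for the function model.\<close>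

definition peval :: "('k::comm_ring_1 \<Rightarrow> 'r::comm_ring_1) \<Rightarrow> ('x \<Rightarrow> 'r) \<Rightarrow> ('x, 'k) mpol \<Rightarrow> 'r" where
  "peval c h f = (\<Sum>e\<in>Poly_Mapping.keys f. c (Poly_Mapping.lookup f e) * monom_val h e)"

lemma monom_val_superset:
  assumes "finite A" "Poly_Mapping.keys e \<subseteq> A"
  shows "monom_val h e = (\<Prod>x\<in>A. h x ^ Poly_Mapping.lookup e x)"
  unfolding monom_val_def
  by (rule prod.mono_neutral_left) (use assms in \<open>auto simp: in_keys_iff\<close>)

lemma monom_val_add: "monom_val h (e + e') = monom_val h e * monom_val h e'"
proof -
  let ?A = "Poly_Mapping.keys e \<union> Poly_Mapping.keys e'"
  have "Poly_Mapping.keys (e + e') \<subseteq> ?A" by (rule keys_add)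
  then show ?thesis
    by (simp add: monom_val_superset[where A = ?A] lookup_add power_add prod.distrib)
qed

lemma monom_val_zero [simp]: "monom_val h 0 = 1"
  by (simp add: monom_val_def)

lemma mpol_expand:
  "f = (\<Sum>e\<in>Poly_Mapping.keys f. Poly_Mapping.single e (Poly_Mapping.lookup f e))"
  by (rule poly_mapping_eqI) (auto simp: lookup_sum lookup_single when_def in_keys_iff sum.If_cases
      Int_def)

lemma mpol_single: "Poly_Mapping.single e a = mconst a * monom_val mvar e"
proof -
  have p: "mvar x ^ n = Poly_Mapping.single (Poly_Mapping.single x n) (1::'b)" for x :: 'a and n
    by (induction n) (auto simp: mvar_def mult_single single_add[symmetric])
  have "(\<Prod>x\<in>A. Poly_Mapping.single (Poly_Mapping.single x (Poly_Mapping.lookup e x)) (1::'b))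
      = Poly_Mapping.single (\<Sum>x\<in>A. Poly_Mapping.single x (Poly_Mapping.lookup e x)) 1" for A
    by (induction A rule: infinite_finite_induct) (auto simp: mult_single)
  then show ?thesis
    unfolding monom_val_def p by (simp add: mconst_def mult_single mpol_expand[symmetric])
qed

lemma mpol_eq_sum_monom_val:
  "f = (\<Sum>e\<in>Poly_Mapping.keys f. mconst (Poly_Mapping.lookup f e) * monom_val mvar e)"
  by (simp only: mpol_single[symmetric] mpol_expand[symmetric])

locale scalar_hom =
  fixes c :: "'k::comm_ring_1 \<Rightarrow> 'r::comm_ring_1"
  assumes c_add: "c (a + b) = c a + c b" and c_mult: "c (a * b) = c a * c b" and c_one: "c 1 = 1"
begin

lemma c_zero: "c 0 = 0"
  using c_add[of 0 0] by simp

lemma peval_superset: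
  assumes "finite A" "Poly_Mapping.keys f \<subseteq> A"
  shows "peval c h f = (\<Sum>e\<in>A. c (Poly_Mapping.lookup f e) * monom_val h e)"
  unfolding peval_def
  by (rule sum.mono_neutral_left) (use assms in \<open>auto simp: in_keys_iff c_zero\<close>)

lemma peval_zero [simp]: "peval c h 0 = 0"
  by (simp add: peval_def)

lemma peval_add: "peval c h (f + g) = peval c h f + peval c h g"
proof -
  let ?A = "Poly_Mapping.keys f \<union> Poly_Mapping.keys g"
  have "Poly_Mapping.keys (f + g) \<subseteq> ?A" by (rule keys_add)
  then show ?thesis
    by (simp add: peval_superset[where A = ?A] lookup_add c_add sum.distrib algebra_simps)
qed

lemma peval_sum: "peval c h (sum f A) = (\<Sum>x\<in>A. peval c h (f x))"
  by (induction A rule: infinite_finite_induct) (auto simp: peval_add)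

lemma peval_single: "peval c h (Poly_Mapping.single e a) = c a * monom_val h e"
  by (simp add: peval_def c_zero)

lemma peval_mult: "peval c h (f * g) = peval c h f * peval c h g"
proof -
  have "peval c h (f * g) = peval c h ((\<Sum>e\<in>Poly_Mapping.keys f. Poly_Mapping.single e (Poly_Mapping.lookup f e))
     * (\<Sum>e\<in>Poly_Mapping.keys g. Poly_Mapping.single e (Poly_Mapping.lookup g e)))"
    by (simp only: mpol_expand[symmetric])
  also have "\<dots> = peval c h f * peval c h g"
    unfolding sum_product peval_sum peval_def[of c h f] peval_def[of c h g]
    by (simp add: mult_single peval_single c_mult monom_val_add mult_ac)
  finally show ?thesis .
qed

lemma peval_mvar [simp]: "peval c h (mvar x) = h x"
  by (simp add: mvar_def peval_single c_one monom_val_def)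

lemma peval_mconst [simp]: "peval c h (mconst a) = c a"
  by (simp add: mconst_def peval_single)

lemma peval_one [simp]: "peval c h 1 = 1"
  using peval_mconst[of h 1] by (simp add: c_one del: peval_mconst)

lemma peval_minus: "peval c h (- f) = - peval c h f"
  using peval_add[of h f "- f"] by (simp add: add_eq_0_iff)

lemma peval_diff: "peval c h (f - g) = peval c h f - peval c h g"
  using peval_add[of h f "- g"] by (simp add: peval_minus)

end

interpretation mconst: scalar_hom "mconst :: 'k::comm_ring_1 \<Rightarrow> ('x, 'k) mpol"
  by unfold_locales (auto simp: mconst_add mconst_mult)

interpretation pconst: scalar_hom "\<lambda>a::'k::comm_ring_1. [:a:]"
  by unfold_locales auto

lemma msubst_eq_peval: "msubst h = peval mconst h"
  by (auto simp: msubst_def peval_def monom_val_def fun_eq_iff)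


section \<open>The polynomial ring and the defining ideal\<close>

lemma polyB_simps [simp]:
  "mult (polyB m) = (*)" "one (polyB m) = 1" "zero (polyB m) = 0" "add (polyB m) = (+)"
  "smult (polyB m) = (\<lambda>c f. mconst c * f)"
  by (auto simp: polyB_def)

lemma mem_polyB: "f \<in> carrier (polyB m) \<longleftrightarrow> (\<forall>e\<in>Poly_Mapping.keys f. Poly_Mapping.keys e \<subseteq> gens m)"
  by (simp add: polyB_def)

lemma polyB_zero [intro, simp]: "0 \<in> carrier (polyB m)"
  by (simp add: mem_polyB)

lemma polyB_mconst [intro, simp]: "mconst c \<in> carrier (polyB m)"
  by (simp add: mem_polyB mconst_def)

lemma polyB_one [intro, simp]: "1 \<in> carrier (polyB m)"
  by (simp add: mem_polyB)

lemma polyB_add [intro]: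
  "f \<in> carrier (polyB m) \<Longrightarrow> g \<in> carrier (polyB m) \<Longrightarrow> f + g \<in> carrier (polyB m)"
  unfolding mem_polyB using keys_add[of f g] by blast

lemma polyB_mult [intro]:
  "f \<in> carrier (polyB m) \<Longrightarrow> g \<in> carrier (polyB m) \<Longrightarrow> f * g \<in> carrier (polyB m)"
proof -
  assume f: "f \<in> carrier (polyB m)" and g: "g \<in> carrier (polyB m)"
  have "Poly_Mapping.keys e \<subseteq> gens m" if "e \<in> Poly_Mapping.keys (f * g)" for e
  proof -
    obtain a b where "a \<in> Poly_Mapping.keys f" "b \<in> Poly_Mapping.keys g" "e = a + b"
      using keys_mult[of f g] \<open>e \<in> _\<close> by blast
    then show ?thesis
      using f g keys_add[of a b] unfolding mem_polyB by blast
  qed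
  then show ?thesis by (simp add: mem_polyB)
qed

lemma polyB_minus [intro]: "f \<in> carrier (polyB m) \<Longrightarrow> - f \<in> carrier (polyB m)"
  using polyB_mult[OF polyB_mconst[of "-1"], of f m] by (simp add: mconst_minus)

lemma polyB_diff [intro]:
  "f \<in> carrier (polyB m) \<Longrightarrow> g \<in> carrier (polyB m) \<Longrightarrow> f - g \<in> carrier (polyB m)"
  using polyB_add[of f m "- g"] by auto

lemma polyB_mvar [intro, simp]: "g \<in> gens m \<Longrightarrow> mvar g \<in> carrier (polyB m)"
  by (simp add: mem_polyB mvar_def)

lemma cring_polyB: "cring (polyB m :: ('k::field, 'k gpoly) module)"
proof (rule cringI)
  show "abelian_group (polyB m :: ('k, 'k gpoly) module)"
  proof (rule abelian_groupI)
    fix x :: "'k gpoly" assume "x \<in> carrier (polyB m)"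
    then show "\<exists>y\<in>carrier (polyB m). y \<oplus>\<^bsub>polyB m\<^esub> x = \<zero>\<^bsub>polyB m\<^esub>"
      by (intro bexI[of _ "- x"]) auto
  qed (auto simp: algebra_simps)
  show "Group.comm_monoid (polyB m :: ('k, 'k gpoly) module)"
    by (rule comm_monoidI) (auto simp: algebra_simps)
qed (auto simp: algebra_simps)

lemma gens_simps [simp]:
  "U i \<in> gens m \<longleftrightarrow> 1 \<le> i \<and> i \<le> m"
  "Up i j \<in> gens m \<longleftrightarrow> 1 \<le> i \<and> i < j \<and> j \<le> m"
  "Um i j \<in> gens m \<longleftrightarrow> 1 \<le> i \<and> i < j \<and> j \<le> m"
  by (auto simp: gens_def)

lemma relsB_subset: "relsB m \<subseteq> carrier (polyB m)"
  unfolding relsB_def power2_eq_square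
  by (auto intro!: polyB_add polyB_mult polyB_diff polyB_minus)

lemma idealJ_ideal: "ideal (idealJ m) (polyB m)"
  unfolding idealJ_def by (rule ring.genideal_ideal[OF cring.axioms(1)[OF cring_polyB] relsB_subset])

lemma idealJ_subset: "f \<in> idealJ m \<Longrightarrow> f \<in> carrier (polyB m)"
  using additive_subgroup.a_subset[OF ideal.axioms(1)[OF idealJ_ideal]] by blast

lemma idealJ_rels: "f \<in> relsB m \<Longrightarrow> f \<in> idealJ m"
  unfolding idealJ_def
  using ring.genideal_self[OF cring.axioms(1)[OF cring_polyB] relsB_subset] by blast

lemma idealJ_zero [intro, simp]: "0 \<in> idealJ m"
  using additive_subgroup.zero_closed[OF ideal.axioms(1)[OF idealJ_ideal], of m] by simp

lemma idealJ_add [intro]: "f \<in> idealJ m \<Longrightarrow> g \<in> idealJ m \<Longrightarrow> f + g \<in> idealJ m"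
  using additive_subgroup.a_closed[OF ideal.axioms(1)[OF idealJ_ideal], of f m g] by simp

lemma idealJ_mult_left [intro]: "f \<in> carrier (polyB m) \<Longrightarrow> g \<in> idealJ m \<Longrightarrow> f * g \<in> idealJ m"
  using ideal.I_l_closed[OF idealJ_ideal, of g m f] by simp

lemma idealJ_mconst [intro]: "g \<in> idealJ m \<Longrightarrow> mconst c * g \<in> idealJ m"
  by (rule idealJ_mult_left) auto

lemma idealJ_minus [intro]: "f \<in> idealJ m \<Longrightarrow> - f \<in> idealJ m"
  using idealJ_mconst[of f m "-1"] by (simp add: mconst_minus)

lemma idealJ_diff [intro]: "f \<in> idealJ m \<Longrightarrow> g \<in> idealJ m \<Longrightarrow> f - g \<in> idealJ m"
  using idealJ_add[of f m "- g"] by auto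

lemma idealJ_subspace: "mpol.subspace (idealJ m)"
  by (auto simp: mpol.subspace_def)

lemma polyB_subspace: "mpol.subspace (carrier (polyB m))"
  by (auto simp: mpol.subspace_def)

text \<open>Ideals of the polynomial ring get compared with \<open>idealJ\<close> by minimality;
  this reduces being an ideal to the closure properties that are checked in practice.\<close>

lemma polyB_idealI:
  fixes T :: "'k::field gpoly set"
  assumes T: "T \<subseteq> carrier (polyB m)" "mpol.subspace T"
    and mult: "\<And>p f. p \<in> carrier (polyB m) \<Longrightarrow> f \<in> T \<Longrightarrow> p * f \<in> T"
  shows "ideal T (polyB m :: ('k, 'k gpoly) module)"
proof (rule idealI)
  show "subgroup T (add_monoid (polyB m :: ('k, 'k gpoly) module))"
  proof (rule group.subgroupI)
    show grp: "Group.group (add_monoid (polyB m :: ('k, 'k gpoly) module))"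
      using abelian_group.a_group ring.is_abelian_group cring.axioms(1)[OF cring_polyB] by blast
    show "T \<noteq> {}"
      using mpol.subspace_0[OF T(2)] by auto
    fix f g :: "'k gpoly" assume f: "f \<in> T"
    then have "f \<in> carrier (polyB m)" "- f \<in> T"
      using T by (auto intro: mpol.subspace_neg)
    moreover have "inv\<^bsub>add_monoid (polyB m :: ('k, 'k gpoly) module)\<^esub> f = - f"
      by (rule group.inv_equality[OF grp]) (use calculation T in auto)
    ultimately show "inv\<^bsub>add_monoid (polyB m :: ('k, 'k gpoly) module)\<^esub> f \<in> T" by simp
    assume g: "g \<in> T"
    then show "f \<otimes>\<^bsub>add_monoid (polyB m)\<^esub> g \<in> T"
      using f mpol.subspace_add[OF T(2)] by auto
  qed (use T in auto)
  fix f p :: "'k gpoly" assume "f \<in> T" "p \<in> carrier (polyB m)"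
  then show "p \<otimes>\<^bsub>polyB m\<^esub> f \<in> T" "f \<otimes>\<^bsub>polyB m\<^esub> p \<in> T"
    using mult[of p f] by (simp_all add: mult.commute)
qed (rule cring.axioms(1)[OF cring_polyB])

section \<open>Generators homogeneous for the sign changes\<close>

text \<open>
  Up to a factor, \<open>zeta i j\<close> is \<open>w\<^sub>i\<^sub>j\<close> or \<open>v\<^sub>j\<^sub>i\<close>, arranged so that a signed permutation \<open>(s, \<pi>)\<close> acts by
  \<open>zeta i j \<mapsto> s\<^sub>i zeta (\<pi> i) (\<pi> j)\<close>; index \<open>0\<close> in the second position encodes \<open>u\<^sub>i\<close>.  With
  \<open>zeta 0 j = 0\<close>, the relations involving the \<open>u\<^sub>i\<close> become the instances with an index \<open>0\<close>
  of those for triples.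
\<close>

definition Pgen :: "nat \<Rightarrow> nat \<Rightarrow> 'k::field gpoly" where
  "Pgen i j = (if i < j then up i j else - up j i)"

definition Mgen :: "nat \<Rightarrow> nat \<Rightarrow> 'k::field gpoly" where
  "Mgen i j = (if i < j then um i j else um j i)"

definition zeta :: "nat \<Rightarrow> nat \<Rightarrow> 'k::field gpoly" where
  "zeta i j = (if i = 0 then 0 else if j = 0 then u i else mconst (1/2) * (Mgen i j - Pgen i j))"

lemma mconst_half: "mconst (1/2) * x + mconst (1/2) * x = (x :: ('x, 'k::field_char_0) mpol)"
proof -
  have "mconst (1/2) * x + mconst (1/2) * x = mconst (1/2 + 1/2) * x"
    by (simp only: mconst_add algebra_simps)
  then show ?thesis by simp
qed

lemma up_zeta: "1 \<le> i \<Longrightarrow> i < j \<Longrightarrow> up i j = zeta j i - (zeta i j :: 'k::field_char_0 gpoly)"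
  using mconst_half[of "up i j :: 'k gpoly"]
  by (simp add: zeta_def Pgen_def Mgen_def algebra_simps)

lemma um_zeta: "1 \<le> i \<Longrightarrow> i < j \<Longrightarrow> um i j = zeta i j + (zeta j i :: 'k::field_char_0 gpoly)"
  using mconst_half[of "um i j :: 'k gpoly"]
  by (simp add: zeta_def Pgen_def Mgen_def algebra_simps)

lemma u_zeta: "1 \<le> i \<Longrightarrow> u i = zeta i 0"
  by (simp add: zeta_def)

lemma zeta_0 [simp]: "zeta 0 j = 0"
  by (simp add: zeta_def)

text \<open>The relations between the \<open>zeta\<close> come out of the given ones multiplied by 2
  or 4, so 2 has to be invertible.\<close>

lemma idealJ_double:
  fixes f :: "'k::field_char_0 gpoly"
  assumes "f + f \<in> idealJ m" shows "f \<in> idealJ m"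
  using idealJ_mconst[OF assms, of "1/2"] mconst_half[of f] by (simp only: distrib_left)

text \<open>With \<open>a\<close> for zeta i j, \<open>b\<close> for zeta j k, \<open>c\<close> for
  zeta i k, and primes for reversed indices, the four relations of a triple are combinations of the
  same four quadrics \<open>A\<close>, \<open>Bi\<close>, \<open>Bj\<close>, \<open>Bk\<close>.
  These have four different weights under sign changes, and the coefficients form an invertible 4 by
  4 matrix of signs, so each quadric lies in the ideal by itself.\<close>

lemma arnold_products:
  fixes a a' b b' c c' :: "'r::comm_ring_1"
  defines "A \<equiv> a * c + a' * b + c' * b'" and "Bi \<equiv> a' * c' - b * c' - b' * a'"
    and "Bj \<equiv> a * b' - c * b' - c' * a" and "Bk \<equiv> c * b - a * b - a' * c"
  shows "(a' - a) * (b' - b) - (a' - a) * (c' - c) - (c' - c) * (b' - b) = - A - Bi - Bj - Bk"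
    and "(a + a') * (b' - b) - (a + a') * (c + c') - (c + c') * (b' - b) = - A - Bi + Bj + Bk"
    and "- ((a + a') * (b + b')) + (a + a') * (c' - c) - (c' - c) * (b + b') = - A + Bi - Bj + Bk"
    and "- ((a' - a) * (b + b')) + (a' - a) * (c + c') - (c + c') * (b + b') = - A + Bi + Bj - Bk"
  unfolding A_def Bi_def Bj_def Bk_def by (simp_all add: algebra_simps)

lemma zeta_sorted_relations:
  fixes i j k m :: nat
  defines "z \<equiv> zeta :: nat \<Rightarrow> nat \<Rightarrow> 'k::field_char_0 gpoly"
  assumes ijk: "1 \<le> i" "i < j" "j < k" "k \<le> m"
  shows "z i j * z i k + z j i * z j k + z k i * z k j \<in> idealJ m"
    and "z i k * z j k - z i j * z j k - z j i * z i k \<in> idealJ m"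
    and "z i j * z k j - z i k * z k j - z k i * z i j \<in> idealJ m"
    and "z j i * z k i - z j k * z k i - z k j * z j i \<in> idealJ m"
proof -
  let ?up = "up :: nat \<Rightarrow> nat \<Rightarrow> 'k gpoly" and ?um = "um :: nat \<Rightarrow> nat \<Rightarrow> 'k gpoly"
  define A where "A = z i j * z i k + z j i * z j k + z k i * z k j"
  define Bi where "Bi = z j i * z k i - z j k * z k i - z k j * z j i"
  define Bj where "Bj = z i j * z k j - z i k * z k j - z k i * z i j"
  define Bk where "Bk = z i k * z j k - z i j * z j k - z j i * z i k"
  have e: "?up i j = z j i - z i j" "?up i k = z k i - z i k" "?up j k = z k j - z j k"
    "?um i j = z i j + z j i" "?um i k = z i k + z k i" "?um j k = z j k + z k j"
    unfolding z_def using ijk by (auto intro!: up_zeta um_zeta)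
  define R0 where "R0 = ?up i j * ?up j k - ?up i j * ?up i k - ?up i k * ?up j k"
  define R1 where "R1 = ?um i j * ?up j k - ?um i j * ?um i k - ?um i k * ?up j k"
  define R2 where "R2 = - (?um i j * ?um j k) + ?um i j * ?up i k - ?up i k * ?um j k"
  define R3 where "R3 = - (?up i j * ?um j k) + ?up i j * ?um i k - ?um i k * ?um j k"
  have "{R0, R1, R2, R3} \<subseteq> relsB m"
    unfolding relsB_def R0_def R1_def R2_def R3_def
    using ijk by (intro subsetI UnI2 UN_I[of "(i, j, k)"]) auto
  then have "R0 \<in> idealJ m" "R1 \<in> idealJ m" "R2 \<in> idealJ m" "R3 \<in> idealJ m"
    using idealJ_rels by blast+
  moreover have "R0 = - A - Bi - Bj - Bk" "R1 = - A - Bi + Bj + Bk" "R2 = - A + Bi - Bj + Bk"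
    "R3 = - A + Bi + Bj - Bk"
    unfolding R0_def R1_def R2_def R3_def e A_def Bi_def Bj_def Bk_def by (rule arnold_products)+
  ultimately have R: "- A - Bi - Bj - Bk \<in> idealJ m" "- A - Bi + Bj + Bk \<in> idealJ m"
    "- A + Bi - Bj + Bk \<in> idealJ m" "- A + Bi + Bj - Bk \<in> idealJ m"
    by simp_all
  \<comment> \<open>Rows of the sign matrix are added or subtracted in pairs, and the results once
    more; every stage yields the double of what is wanted.\<close>
  have A_Bi: "A + Bi \<in> idealJ m"
    by (rule idealJ_double) (use idealJ_minus[OF idealJ_add[OF R(1) R(2)]] in \<open>simp add: add_ac\<close>)
  have A_Bi': "A - Bi \<in> idealJ m"
    by (rule idealJ_double) (use idealJ_minus[OF idealJ_add[OF R(3) R(4)]] in \<open>simp add: algebra_simps\<close>)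
  have B_B: "Bj + Bk \<in> idealJ m"
    by (rule idealJ_double) (use idealJ_diff[OF R(2) R(1)] in \<open>simp add: algebra_simps\<close>)
  have B_B': "Bk - Bj \<in> idealJ m"
    by (rule idealJ_double) (use idealJ_diff[OF R(3) R(4)] in \<open>simp add: algebra_simps\<close>)
  have "A \<in> idealJ m"
    by (rule idealJ_double) (use idealJ_add[OF A_Bi A_Bi'] in simp)
  moreover have "Bi \<in> idealJ m"
    by (rule idealJ_double) (use idealJ_diff[OF A_Bi A_Bi'] in simp)
  moreover have "Bk \<in> idealJ m"
    by (rule idealJ_double) (use idealJ_add[OF B_B B_B'] in simp)
  moreover have "Bj \<in> idealJ m"
    by (rule idealJ_double) (use idealJ_diff[OF B_B B_B'] in simp)
  ultimately show "z i j * z i k + z j i * z j k + z k i * z k j \<in> idealJ m"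
    and "z i k * z j k - z i j * z j k - z j i * z i k \<in> idealJ m"
    and "z i j * z k j - z i k * z k j - z k i * z i j \<in> idealJ m"
    and "z j i * z k i - z j k * z k i - z k j * z j i \<in> idealJ m"
    unfolding A_def Bi_def Bj_def Bk_def by simp_all
qed

text \<open>The same elimination for the relations of a pair, with \<open>x\<close>,
  \<open>y\<close> for u_i, u_j. The last two identities separate the squares of the two
  \<open>zeta\<close>, of which the squared generators give only the sum.\<close>

lemma pair_products:
  fixes a a' x y :: "'r::comm_ring_1"
  shows "(a + a') * (a + a') - (a' - a) * (a' - a) = (a * a' + a * a') + (a * a' + a * a')"
    and "(a + a') * (a + a') + (a' - a) * (a' - a) = (a * a + a' * a') + (a * a + a' * a')"
    and "- ((x * (a' - a) - x * y - (a' - a) * y) + (x * y - x * (a + a') - y * (a + a')))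
      = (x * a + y * a') + (x * a + y * a')"
    and "(x * y - x * (a + a') - y * (a + a')) - (x * (a' - a) - x * y - (a' - a) * y)
      = (x * y - a * y - a' * x) + (x * y - a * y - a' * x)"
    and "(x * (a' - a) - x * (a + a') - (a' - a) * (a + a')) + (a * a + a' * a')
      = (a * a - x * a) + (a * a - x * a)"
    and "(a * a + a' * a') - (a * a - x * a) - (x * a + y * a') = a' * a' - y * a'"
  by (simp_all add: algebra_simps)

lemma zeta_sorted_pair_relations:
  fixes i j m :: nat
  defines "z \<equiv> zeta :: nat \<Rightarrow> nat \<Rightarrow> 'k::field_char_0 gpoly"
  assumes ijk: "1 \<le> i" "i < j" "j \<le> m"
  shows "z i j * z j i \<in> idealJ m"
    and "z i j * z i j - z i 0 * z i j \<in> idealJ m"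
    and "z j i * z j i - z j 0 * z j i \<in> idealJ m"
    and "z i 0 * z i j + z j 0 * z j i \<in> idealJ m"
    and "z i 0 * z j 0 - z i j * z j 0 - z j i * z i 0 \<in> idealJ m"
proof -
  let ?up = "up :: nat \<Rightarrow> nat \<Rightarrow> 'k gpoly" and ?um = "um :: nat \<Rightarrow> nat \<Rightarrow> 'k gpoly"
  let ?u = "u :: nat \<Rightarrow> 'k gpoly"
  define a a' x y where "a = z i j" and "a' = z j i" and "x = z i 0" and "y = z j 0"
  have e: "?up i j = a' - a" "?um i j = a + a'" "?u i = x" "?u j = y"
    unfolding z_def a_def a'_def x_def y_def using ijk by (auto intro!: up_zeta um_zeta u_zeta)
  have "{?u i * ?up i j - ?u i * ?um i j - ?up i j * ?um i j, ?u i * ?up i j - ?u i * ?u j - ?up i j * ?u j,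
      ?u i * ?u j - ?u i * ?um i j - ?u j * ?um i j} \<subseteq> relsB m"
    unfolding relsB_def using ijk by (intro subsetI UnI1 UnI2 UN_I[of "(i, j)"]) auto
  moreover have "{?up i j ^ 2, ?um i j ^ 2} \<subseteq> relsB m"
    unfolding relsB_def using ijk by auto
  ultimately have R: "x * (a' - a) - x * (a + a') - (a' - a) * (a + a') \<in> idealJ m"
    "x * (a' - a) - x * y - (a' - a) * y \<in> idealJ m" "x * y - x * (a + a') - y * (a + a') \<in> idealJ m"
    "(a' - a) * (a' - a) \<in> idealJ m" "(a + a') * (a + a') \<in> idealJ m"
    unfolding e power2_eq_square using idealJ_rels by blast+
  have opp: "a * a' \<in> idealJ m"
    by (rule idealJ_double[OF idealJ_double]) (use idealJ_diff[OF R(5) R(4)] in \<open>simp only: pair_products\<close>)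
  have sq_sum: "a * a + a' * a' \<in> idealJ m"
    by (rule idealJ_double) (use idealJ_add[OF R(5) R(4)] in \<open>simp only: pair_products\<close>)
  have out: "x * a + y * a' \<in> idealJ m"
    by (rule idealJ_double) (use idealJ_minus[OF idealJ_add[OF R(2) R(3)]] in \<open>simp only: pair_products\<close>)
  have inc: "x * y - a * y - a' * x \<in> idealJ m"
    by (rule idealJ_double) (use idealJ_diff[OF R(3) R(2)] in \<open>simp only: pair_products\<close>)
  have sq: "a * a - x * a \<in> idealJ m"
    by (rule idealJ_double) (use idealJ_add[OF R(1) sq_sum] in \<open>simp only: pair_products\<close>)
  \<comment> \<open>The given relations are not symmetric in \<open>i\<close> and \<open>j\<close>;
    the square for the reversed pair is what remains of the sum of squares.\<close>
  have sq': "a' * a' - y * a' \<in> idealJ m"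
    using idealJ_diff[OF idealJ_diff[OF sq_sum sq] out] by (simp only: pair_products)
  show "z i j * z j i \<in> idealJ m"
    and "z i j * z i j - z i 0 * z i j \<in> idealJ m"
    and "z j i * z j i - z j 0 * z j i \<in> idealJ m"
    and "z i 0 * z i j + z j 0 * z j i \<in> idealJ m"
    and "z i 0 * z j 0 - z i j * z j 0 - z j i * z i 0 \<in> idealJ m"
    using opp sq sq' out inc by (simp_all only: a_def a'_def x_def y_def)
qed

lemma zeta_zero_sq: "1 \<le> i \<Longrightarrow> i \<le> m \<Longrightarrow> zeta i 0 * zeta i 0 \<in> idealJ m"
  by (rule idealJ_rels) (auto simp: relsB_def u_zeta[symmetric] power2_eq_square[symmetric])

lemma zeta_opposite:
  fixes m :: nat
  assumes "1 \<le> i" "1 \<le> j" "i \<noteq> j" "i \<le> m" "j \<le> m"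
  shows "(zeta i j * zeta j i :: 'k::field_char_0 gpoly) \<in> idealJ m"
  using assms zeta_sorted_pair_relations(1)[of i j m] zeta_sorted_pair_relations(1)[of j i m]
  by (cases i j rule: linorder_cases) (auto simp: mult.commute)

lemma zeta_sq:
  assumes "1 \<le> i" "1 \<le> j" "i \<noteq> j" "i \<le> m" "j \<le> m"
  shows "(zeta i j * zeta i j - zeta i 0 * zeta i j :: 'k::field_char_0 gpoly) \<in> idealJ m"
  using assms zeta_sorted_pair_relations(2)[of i j m] zeta_sorted_pair_relations(3)[of j i m]
  by (cases i j rule: linorder_cases) auto

text \<open>The sum is invariant under all permutations of the indices, so sorted triples suffice,
  with 0 allowed as the smallest index.\<close>

lemma zeta_outgoing:
  fixes m :: nat
  assumes "i \<noteq> j" "j \<noteq> k" "i \<noteq> k" "i \<le> m" "j \<le> m" "k \<le> m"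
  shows "(zeta i j * zeta i k + zeta j i * zeta j k + zeta k i * zeta k j :: 'k::field_char_0 gpoly)
    \<in> idealJ m"
proof -
  define A :: "nat \<Rightarrow> nat \<Rightarrow> nat \<Rightarrow> 'k gpoly"
    where "A = (\<lambda>i j k. zeta i j * zeta i k + zeta j i * zeta j k + zeta k i * zeta k j)"
  have sym: "A i j k = A j i k" "A i j k = A i k j" for i j k
    by (auto simp: A_def algebra_simps)
  have sorted: "A i j k \<in> idealJ m" if "i < j" "j < k" "k \<le> m" for i j k
    using that zeta_sorted_relations(1)[of i j k m] zeta_sorted_pair_relations(4)[of j k m]
    by (cases "i = 0") (auto simp: A_def algebra_simps)
  have "A i j k \<in> idealJ m"
    using assms sorted sym by (cases i j rule: linorder_cases; cases j k rule: linorder_cases;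
        cases i k rule: linorder_cases) (metis (no_types))+
  then show ?thesis by (simp add: A_def)
qed

text \<open>Only \<open>i\<close> and \<open>j\<close> may be exchanged, so a sorted triple enters
  in three ways, one for each choice of the index to which both factors of the first product
  point.\<close>

lemma zeta_incoming:
  fixes m :: nat
  assumes "i \<noteq> j" "j \<noteq> k" "i \<noteq> k" "i \<le> m" "j \<le> m" "k \<le> m"
  shows "(zeta i k * zeta j k - zeta i j * zeta j k - zeta j i * zeta i k :: 'k::field_char_0 gpoly)
    \<in> idealJ m"
proof -
  define D :: "nat \<Rightarrow> nat \<Rightarrow> nat \<Rightarrow> 'k gpoly"
    where "D = (\<lambda>i j k. zeta i k * zeta j k - zeta i j * zeta j k - zeta j i * zeta i k)"
  have sym: "D i j k = D j i k" for i j k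
    by (auto simp: D_def algebra_simps)
  have sorted: "D i j k \<in> idealJ m" "D i k j \<in> idealJ m" "D j k i \<in> idealJ m"
    if "i < j" "j < k" "k \<le> m" for i j k
  proof -
    have "D i j k \<in> idealJ m \<and> D i k j \<in> idealJ m \<and> D j k i \<in> idealJ m"
      using that zeta_sorted_relations(2-4)[of i j k m] zeta_sorted_pair_relations(5)[of j k m]
      by (cases "i = 0") (auto simp: D_def algebra_simps)
    then show "D i j k \<in> idealJ m" "D i k j \<in> idealJ m" "D j k i \<in> idealJ m" by auto
  qed
  have "D i j k \<in> idealJ m"
    using assms sorted sym by (cases i j rule: linorder_cases; cases j k rule: linorder_cases;
        cases i k rule: linorder_cases) (metis (no_types))+
  then show ?thesis by (simp add: D_def)
qed

lemma zeta_polyB: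
  "i \<in> {1..m} \<Longrightarrow> j \<in> {0..m} \<Longrightarrow> i \<noteq> j \<Longrightarrow> zeta i j \<in> carrier (polyB m)"
  by (auto simp: zeta_def Mgen_def Pgen_def intro!: polyB_mult polyB_diff polyB_minus polyB_add)


section \<open>Straightening\<close>

text \<open>Monomials are represented by words because length, number of u's and weight have to be
  read off from them, which a polynomial modulo relations does not allow.\<close>

definition zlist :: "(nat \<times> nat) list \<Rightarrow> 'k::field gpoly" where
  "zlist xs = (\<Prod>(i, j)\<leftarrow>xs. zeta i j)"

lemma zlist_simps [simp]:
  "zlist [] = 1" "zlist (p # xs) = zeta (fst p) (snd p) * zlist xs"
  by (auto simp: zlist_def case_prod_beta)

lemma zlist_append: "zlist (xs @ ys) = zlist xs * zlist ys"
  by (induction xs) (auto simp: mult_ac)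

definition pairs :: "nat set \<Rightarrow> (nat \<times> nat) set" where
  "pairs S = {(i, j). i \<in> S \<and> j \<in> insert 0 S \<and> i \<noteq> j}"

definition ucount :: "(nat \<times> nat) list \<Rightarrow> nat" where
  "ucount xs = length (filter (\<lambda>p. snd p = 0) xs)"

lemma ucount_simps [simp]:
  "ucount [] = 0" "ucount (p # xs) = (if snd p = 0 then Suc (ucount xs) else ucount xs)"
  by (auto simp: ucount_def)

lemma ucount_append: "ucount (xs @ ys) = ucount xs + ucount ys"
  by (simp add: ucount_def)

text \<open>The character by which the sign changes act: the \<open>i\<close>-th sign occurs with
  odd exponent exactly if \<open>wt xs i\<close>.\<close>

fun wt :: "(nat \<times> nat) list \<Rightarrow> nat \<Rightarrow> bool" where
  "wt [] i = False"
| "wt (p # xs) i = ((fst p = i) \<noteq> wt xs i)"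

lemma wt_outside: "xs \<in> lists (pairs S) \<Longrightarrow> i \<notin> S \<Longrightarrow> \<not> wt xs i"
  by (induction xs) (auto simp: pairs_def)

lemma zlist_polyB:
  assumes "xs \<in> lists (pairs S)" "S \<subseteq> {1..m}" shows "zlist xs \<in> carrier (polyB m)"
  using assms by (induction xs) (auto intro!: polyB_mult zeta_polyB simp: pairs_def)

text \<open>Straightening is phrased as membership in this space; the predicate \<open>Q\<close>
  tracks degree, number of u's and weight at once, so that reductions compose.\<close>

definition red :: "nat \<Rightarrow> ((nat \<times> nat) list \<Rightarrow> bool) \<Rightarrow> 'k::field gpoly set" where
  "red m Q = mpol.span (zlist ` Collect Q \<union> idealJ m)"

lemma red_base: "Q xs \<Longrightarrow> zlist xs \<in> red m Q"
  by (auto simp: red_def intro!: mpol.span_base)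

lemma red_idealJ: "f \<in> idealJ m \<Longrightarrow> f \<in> red m Q"
  by (auto simp: red_def intro!: mpol.span_base)

lemma red_add: "f \<in> red m Q \<Longrightarrow> g \<in> red m Q \<Longrightarrow> f + g \<in> red m Q"
  by (auto simp: red_def intro!: mpol.span_add)

lemma red_minus: "f \<in> red m Q \<Longrightarrow> - f \<in> red m Q"
  by (auto simp: red_def intro!: mpol.span_neg)

lemma red_diff: "f \<in> red m Q \<Longrightarrow> g \<in> red m Q \<Longrightarrow> f - g \<in> red m Q"
  by (auto simp: red_def intro!: mpol.span_diff)

lemma red_cong: "f - g \<in> idealJ m \<Longrightarrow> g \<in> red m Q \<Longrightarrow> f \<in> red m Q"
  using red_add[OF red_idealJ, of "f - g" m g Q] by simp

text \<open>\<open>idealJ\<close> absorbs \<open>p\<close>, so a multiple needs to be reduced on the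
  words of \<open>Q\<close> only.\<close>

lemma red_mult:
  assumes f: "f \<in> red m Q" and p: "p \<in> carrier (polyB m)"
    and "\<And>xs. Q xs \<Longrightarrow> p * zlist xs \<in> red m Q'"
  shows "p * f \<in> red m Q'"
proof -
  have "mpol.subspace {f. p * f \<in> red m Q'}"
    unfolding mpol.subspace_def red_def
    by (auto simp: distrib_left mult.left_commute[of p] intro: mpol.span_zero mpol.span_add mpol.span_scale)
  moreover have "zlist ` Collect Q \<union> idealJ m \<subseteq> {f. p * f \<in> red m Q'}"
    using assms by (auto intro: red_idealJ)
  ultimately show ?thesis
    using f mpol.span_minimal unfolding red_def[of m Q] by blast
qed

lemma red_bind:
  fixes f :: "'k::field gpoly"
  assumes "f \<in> red m Q" "\<And>xs. Q xs \<Longrightarrow> (zlist xs :: 'k gpoly) \<in> red m Q'"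
  shows "f \<in> red m Q'"
  using red_mult[OF assms(1) polyB_one, of Q'] assms(2) by simp

lemma red_mono: "f \<in> red m Q \<Longrightarrow> (\<And>xs. Q xs \<Longrightarrow> Q' xs) \<Longrightarrow> f \<in> red m Q'"
  by (erule red_bind[where Q' = Q']) (auto intro: red_base)

lemma red_base_eq: "Q xs \<Longrightarrow> f = zlist xs \<Longrightarrow> f \<in> red m Q"
  using red_base by blast

text \<open>Every product of two generators at \<open>a\<close> occurs in a relation whose other
  terms have one factor at \<open>a\<close>; only the square of zeta a j takes a second step. The
  number of u's may grow, since zeta j a squared is u_j * zeta j a and the relation for u_a * zeta j
  a contains u_a * u_j; hence the inequality.\<close>

lemma fiber_product:
  assumes S: "insert a S \<subseteq> {1..m}" and a: "a \<notin> S"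
    and p: "p \<in> pairs (insert a S) - pairs S" and q: "q \<in> pairs (insert a S) - pairs S"
  shows "(zlist [p, q] :: 'k::field_char_0 gpoly) \<in> red m (\<lambda>ys. \<exists>f\<in>pairs (insert a S) - pairs S. \<exists>c\<in>pairs S.
    ys = [f, c] \<and> ucount [p, q] \<le> ucount ys \<and> wt ys = wt [p, q])"
proof -
  let ?F = "pairs (insert a S) - pairs S"
  let ?Q = "\<lambda>p q ys. \<exists>f\<in>?F. \<exists>c\<in>pairs S. ys = [f, c] \<and> ucount [p, q] \<le> ucount ys \<and> wt ys = wt [p, q]"
  let ?R = "\<lambda>p q. (zlist [p, q] :: 'k gpoly) \<in> red m (?Q p q)"
  define z where "z = (zeta :: nat \<Rightarrow> nat \<Rightarrow> 'k gpoly)"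
  have sub: "j \<noteq> 0" "1 \<le> j" "j \<le> m" if "j \<in> insert a S" for j
    using S that by auto
  have ne: "a \<noteq> j" "j \<noteq> a" "j \<noteq> 0" "0 < j" "j \<le> m" if "j \<in> S" for j
    using S a that by auto
  have aj: "a \<noteq> 0" "1 \<le> a" "a \<le> m" using sub[of a] by auto
  have fib: "p \<in> ?F \<longleftrightarrow> p = (a, 0) \<or> (\<exists>j\<in>S. p = (a, j) \<or> p = (j, a))" for p
    using a sub by (cases p) (auto simp: pairs_def)
  have base: "z f1 f2 * z c1 c2 \<in> red m (?Q p q)"
    if "(f1, f2) \<in> ?F" "(c1, c2) \<in> pairs S" "ucount [p, q] \<le> ucount [(f1, f2), (c1, c2)]"
      "wt [(f1, f2), (c1, c2)] = wt [p, q]" for p q f1 f2 c1 c2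
    using red_base[of "?Q p q" "[(f1, f2), (c1, c2)]" m] that by (simp del: ucount_simps add: z_def)
  have sym: "?R p q = ?R q p" for p q
  proof -
    have "?Q p q = ?Q q p" by (auto simp: fun_eq_iff)
    then show ?thesis by (simp add: mult.commute)
  qed
  have out: "z i j * z i k + z j i * z j k + z k i * z k j \<in> idealJ m"
    if "i \<noteq> j" "j \<noteq> k" "i \<noteq> k" "i \<le> m" "j \<le> m" "k \<le> m" for i j k
    unfolding z_def using zeta_outgoing that by blast
  have inc: "z i k * z j k - z i j * z j k - z j i * z i k \<in> idealJ m"
    if "i \<noteq> j" "j \<noteq> k" "i \<noteq> k" "i \<le> m" "j \<le> m" "k \<le> m" for i j k
    unfolding z_def using zeta_incoming that by blast
  have z0: "z 0 j = 0" for j by (simp add: z_def)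
  have zl: "zlist [(i, j), (k, l)] = z i j * z k l" for i j k l
    by (simp add: z_def)
  \<comment> \<open>Six cases by the kinds of the two factors: in the names, 0 is u_a, 1 is zeta a j
    and 2 is zeta j a.\<close>
  have c00: "?R (a, 0) (a, 0)"
    unfolding zl by (rule red_idealJ) (use aj zeta_zero_sq z_def in auto)
  have c01: "?R (a, 0) (a, j)" if j: "j \<in> S" for j
    unfolding zl
  proof (rule red_cong)
    show "z a 0 * z a j - - (z j a * z j 0) \<in> idealJ m"
      using out[of a j 0] aj ne[OF j] by (auto simp: z0 mult.commute)
    show "- (z j a * z j 0) \<in> red m (?Q (a, 0) (a, j))"
      by (rule red_minus, rule base) (use j sub a aj in \<open>auto simp: fib pairs_def fun_eq_iff\<close>)
  qed
  have c02: "?R (a, 0) (j, a)" if j: "j \<in> S" for j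
    unfolding zl
  proof (rule red_cong)
    have "- (z a 0 * z j 0 - z a j * z j 0 - z j a * z a 0) \<in> idealJ m"
      by (rule idealJ_minus, rule inc) (use aj ne[OF j] in auto)
    then show "z a 0 * z j a - (z a 0 * z j 0 - z a j * z j 0) \<in> idealJ m"
      by (simp add: mult.commute)
    show "z a 0 * z j 0 - z a j * z j 0 \<in> red m (?Q (a, 0) (j, a))"
      by (rule red_diff; rule base) (use j sub a aj in \<open>auto simp: fib pairs_def fun_eq_iff\<close>)
  qed
  have c11: "?R (a, j) (a, k)" if j: "j \<in> S" and k: "k \<in> S" for j k
  proof (cases "j = k")
    case True
    show ?thesis
      unfolding zl
    proof (rule red_cong)
      \<comment> \<open>The square is u_a * zeta a j modulo the ideal, which the outgoing relation
        with an index 0 turns into - zeta j a * u_j.\<close>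
      have "(z a j * z a j - z a 0 * z a j) + (z a j * z a 0 + z j a * z j 0 + z 0 a * z 0 j) \<in> idealJ m"
        by (rule idealJ_add, use zeta_sq[of a j m] aj ne[OF j] in \<open>simp add: z_def\<close>,
            rule out) (use aj ne[OF j] in auto)
      then show "z a j * z a k - - (z j a * z j 0) \<in> idealJ m"
        using True by (simp add: z0 mult.commute)
      show "- (z j a * z j 0) \<in> red m (?Q (a, j) (a, k))"
        by (rule red_minus, rule base) (use j k sub a aj in \<open>auto simp: fib pairs_def fun_eq_iff\<close>)
    qed
  next
    case False
    show ?thesis
      unfolding zl
    proof (rule red_cong)
      show "z a j * z a k - (- (z j a * z j k) - z k a * z k j) \<in> idealJ m"
        using out[of a j k] aj ne[OF j] ne[OF k] False by (auto simp: algebra_simps)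
      show "- (z j a * z j k) - z k a * z k j \<in> red m (?Q (a, j) (a, k))"
        by (rule red_diff, rule red_minus; rule base)
          (use j k sub a aj False in \<open>auto simp: fib pairs_def fun_eq_iff\<close>)
    qed
  qed
  have c22: "?R (j, a) (k, a)" if j: "j \<in> S" and k: "k \<in> S" for j k
  proof (cases "j = k")
    case True
    show ?thesis
      unfolding zl
    proof (rule red_cong)
      show "z j a * z k a - z j a * z j 0 \<in> idealJ m"
        using True zeta_sq[of j a m] aj ne[OF j] unfolding z_def by (auto simp: mult.commute)
      show "z j a * z j 0 \<in> red m (?Q (j, a) (k, a))"
        by (rule base) (use j k True sub a aj in \<open>auto simp: fib pairs_def fun_eq_iff\<close>)
    qed
  next
    case False
    show ?thesis
      unfolding zl
    proof (rule red_cong)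
      show "z j a * z k a - (z k a * z j k + z j a * z k j) \<in> idealJ m"
        using inc[of j k a] aj ne[OF j] ne[OF k] False by (auto simp: algebra_simps)
      show "z k a * z j k + z j a * z k j \<in> red m (?Q (j, a) (k, a))"
        by (rule red_add; rule base) (use j k sub a aj False in \<open>auto simp: fib pairs_def fun_eq_iff\<close>)
    qed
  qed
  have c12: "?R (a, k) (j, a)" if j: "j \<in> S" and k: "k \<in> S" for j k
  proof (cases "j = k")
    case True
    then show ?thesis
      unfolding zl
      by (intro red_idealJ) (use zeta_opposite[of a j m] True aj ne[OF j] z_def in auto)
  next
    case False
    show ?thesis
      unfolding zl
    proof (rule red_cong)
      have "- (z j k * z a k - z j a * z a k - z a j * z j k) \<in> idealJ m"
        by (rule idealJ_minus, rule inc) (use aj ne[OF j] ne[OF k] False in auto)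
      then show "z a k * z j a - (z a k * z j k - z a j * z j k) \<in> idealJ m"
        by (simp add: algebra_simps)
      show "z a k * z j k - z a j * z j k \<in> red m (?Q (a, k) (j, a))"
        by (rule red_diff; rule base) (use j k sub a aj False in \<open>auto simp: fib pairs_def fun_eq_iff\<close>)
    qed
  qed
  show "?R p q"
    using p q c00 c01 c02 c11 c22 c12 unfolding fib using sym by blast
qed

text \<open>Read from the right, a word keeps at most one factor at \<open>a\<close>: a new factor
  away from \<open>a\<close> moves behind it, and a new factor at \<open>a\<close> is merged with it
  by \<open>fiber_product\<close>. So the ring is spanned by 1 and the generators at
  \<open>a\<close> over the words without \<open>a\<close>.\<close>

lemma fiber_straightening:
  assumes S: "insert a S \<subseteq> {1..m}" and a: "a \<notin> S" and xs: "xs \<in> lists (pairs (insert a S))"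
  shows "(zlist xs :: 'k::field_char_0 gpoly) \<in> red m (\<lambda>ys.
    (ys \<in> lists (pairs S) \<or> (\<exists>f zs. f \<in> pairs (insert a S) - pairs S \<and> zs \<in> lists (pairs S) \<and> ys = f # zs))
    \<and> length ys = length xs \<and> ucount xs \<le> ucount ys \<and> wt ys = wt xs)"
    (is "_ \<in> red m (?Q xs)")
  using xs
proof (induction xs)
  case Nil
  then show ?case by (intro red_base) auto
next
  case (Cons q xs)
  have q: "q \<in> pairs (insert a S)" using Cons by auto
  have pol: "zeta (fst q) (snd q) \<in> carrier (polyB m)"
    using q S by (auto simp: pairs_def intro!: zeta_polyB)
  have "(zlist xs :: 'k gpoly) \<in> red m (?Q xs)"
    by (rule Cons.IH)
  then have "zeta (fst q) (snd q) * (zlist xs :: 'k gpoly) \<in> red m (?Q (q # xs))"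
  proof (rule red_mult[OF _ pol])
    fix ys assume ys: "?Q xs ys"
    from ys have len: "length ys = length xs" and uc: "ucount xs \<le> ucount ys" and w: "wt ys = wt xs"
      by auto
    show "zeta (fst q) (snd q) * (zlist ys :: 'k gpoly) \<in> red m (?Q (q # xs))"
    proof (cases "ys \<in> lists (pairs S)")
      case True
      then have "q # ys \<in> lists (pairs S) \<or>
          (\<exists>f zs. f \<in> pairs (insert a S) - pairs S \<and> zs \<in> lists (pairs S) \<and> q # ys = f # zs)"
        using q by (cases q; cases "q \<in> pairs S") simp_all
      then have "?Q (q # xs) (q # ys)"
        using len uc w by (simp add: fun_eq_iff)
      then show ?thesis by (rule red_base_eq[where Q = "?Q (q # xs)"]) simp
    next
      case False
      then obtain f zs where f: "f \<in> pairs (insert a S) - pairs S" and zs: "zs \<in> lists (pairs S)"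
        and ys_eq: "ys = f # zs" using ys by auto
      show ?thesis
      proof (cases "q \<in> pairs S")
        case True
        then have "q # zs \<in> lists (pairs S)" using zs by simp
        moreover have "wt (f # q # zs) = wt (q # xs)"
          using w by (auto simp: ys_eq fun_eq_iff)
        ultimately have "?Q (q # xs) (f # q # zs)"
          using f len uc by (cases f; simp add: ys_eq split: if_splits)
        then show ?thesis by (rule red_base_eq[where Q = "?Q (q # xs)"]) (simp add: ys_eq mult_ac)
      next
        case False
        have "zlist zs * (zlist [q, f] :: 'k gpoly) \<in> red m (?Q (q # xs))"
        proof (rule red_mult[OF fiber_product[OF S a]])
          show "zlist zs \<in> carrier (polyB m)"
            using zs S by (intro zlist_polyB[of _ S]) auto
          fix us assume "\<exists>f'\<in>pairs (insert a S) - pairs S. \<exists>c\<in>pairs S. us = [f', c] \<and>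
            ucount [q, f] \<le> ucount us \<and> wt us = wt [q, f]"
          then obtain f' c where f': "f' \<in> pairs (insert a S) - pairs S" and c: "c \<in> pairs S"
            and us: "us = [f', c]" and ucus: "ucount [q, f] \<le> ucount [f', c]" and wus: "wt [f', c] = wt [q, f]"
            by auto
          have "wt (f' # c # zs) i = wt (q # xs) i" for i
            using fun_cong[OF wus, of i] fun_cong[OF w, of i] by (auto simp: ys_eq)
          then have "wt (f' # c # zs) = wt (q # xs)" by blast
          moreover have "ucount (q # xs) \<le> ucount (f' # c # zs)"
            using ucus uc by (simp add: ys_eq split: if_splits)
          moreover have "c # zs \<in> lists (pairs S)" using c zs by simp
          ultimately have "?Q (q # xs) (f' # c # zs)"
            using f' len by (cases f'; simp add: ys_eq del: ucount_simps)
          then show "zlist zs * (zlist us :: 'k gpoly) \<in> red m (?Q (q # xs))"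
            by (rule red_base_eq[where Q = "?Q (q # xs)"]) (simp add: us mult_ac)
        qed (use q False f in auto)
        moreover have "zlist zs * (zlist [q, f] :: 'k gpoly) = zeta (fst q) (snd q) * zlist ys"
          by (simp add: ys_eq mult_ac)
        ultimately show ?thesis by (simp only:)
      qed
    qed
  qed
  then show ?case by (simp only: zlist_simps)
qed

text \<open>
  Indexing set of a basis of the sign-invariants: \<open>(a, n, b)\<close> stands for \<open>zeta a n * zeta a b\<close>.
\<close>

function basis_words :: "nat list \<Rightarrow> (nat \<times> nat \<times> nat) list set" where
  "basis_words [] = {[]}"
| "basis_words (n # xs) = basis_words xs \<union>
     (\<Union>a\<in>set xs. \<Union>b\<in>insert 0 (set xs) - {a}. (\<lambda>w. (a, n, b) # w) ` basis_words (remove1 a xs))"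
  by pat_completeness auto
termination
  by (relation "Wellfounded.measure length") (auto simp: length_remove1 split: if_splits)

fun flat :: "(nat \<times> nat \<times> nat) list \<Rightarrow> (nat \<times> nat) list" where
  "flat [] = []"
| "flat ((a, n, b) # w) = (a, n) # (a, b) # flat w"

lemma weight_zero_straightening:
  assumes "set L \<subseteq> {1..m}" "distinct L" "xs \<in> lists (pairs (set L))" "\<And>i. \<not> wt xs i"
  shows "(zlist xs :: 'k::field_char_0 gpoly) \<in> red m (\<lambda>ys. ys \<in> flat ` basis_words L
    \<and> length ys = length xs \<and> ucount xs \<le> ucount ys)"
  using assms
proof (induction "length L" arbitrary: L xs rule: less_induct)
  case less
  let ?Q = "\<lambda>L xs ys. ys \<in> flat ` basis_words L \<and> length ys = length xs \<and> ucount xs \<le> ucount ys"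
  show ?case
  proof (cases L)
    case Nil
    then have "xs = []" using less.prems by (cases xs) (auto simp: pairs_def)
    then show ?thesis using Nil by (intro red_base) auto
  next
    case (Cons n T)
    have T: "n \<notin> set T" "distinct T" "insert n (set T) \<subseteq> {1..m}" using less.prems Cons by auto
    have "(zlist xs :: 'k gpoly) \<in> red m (\<lambda>ys.
      (ys \<in> lists (pairs (set T)) \<or> (\<exists>f zs. f \<in> pairs (insert n (set T)) - pairs (set T) \<and> zs \<in> lists (pairs (set T)) \<and> ys = f # zs))
      \<and> length ys = length xs \<and> ucount xs \<le> ucount ys \<and> wt ys = wt xs)" (is "_ \<in> red m ?R")
      using fiber_straightening[OF T(3,1), of xs] less.prems Cons by simp
    then show ?thesis
    proof (rule red_bind)
      fix ys assume ys: "?R ys"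
      then have len: "length ys = length xs" and uc: "ucount xs \<le> ucount ys" and w: "\<not> wt ys i" for i
        using less.prems(4) by auto
      show "(zlist ys :: 'k gpoly) \<in> red m (?Q L xs)"
      proof (cases "ys \<in> lists (pairs (set T))")
        case True
        have "(zlist ys :: 'k gpoly) \<in> red m (?Q T ys)"
          using less.hyps[of T ys] True T w Cons by auto
        then show ?thesis
          by (rule red_mono) (use len uc Cons in auto)
      next
        case False
        then obtain f zs where f: "f \<in> pairs (insert n (set T)) - pairs (set T)"
          and zs: "zs \<in> lists (pairs (set T))" and ys_eq: "ys = f # zs"
          using ys by auto
        \<comment> \<open>\<open>n\<close> occurs in no other letter, so as first index of
          \<open>f\<close> it would have odd weight.\<close>
        have "fst f \<noteq> n"
          using w[of n] wt_outside[OF zs T(1)] by (auto simp: ys_eq)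
        then obtain a where a: "a \<in> set T" "f = (a, n)"
          using f by (cases f) (auto simp: pairs_def)
        define T' where "T' = remove1 a T"
        have aT': "a \<notin> set T'" and T': "distinct T'" "length T' < length L" "insert a (set T') = set T"
          using T a Cons by (auto simp: T'_def length_remove1)
        have wzs: "wt zs i \<longleftrightarrow> i = a" for i
          using w[of i] by (auto simp: ys_eq a)
        have "(zlist zs :: 'k gpoly) \<in> red m (\<lambda>us.
          (us \<in> lists (pairs (set T')) \<or> (\<exists>f vs. f \<in> pairs (set T) - pairs (set T') \<and> vs \<in> lists (pairs (set T')) \<and> us = f # vs))
          \<and> length us = length zs \<and> ucount zs \<le> ucount us \<and> wt us = wt zs)" (is "_ \<in> red m ?R'")
          using fiber_straightening[of a "set T'" m zs] zs T(3) aT' by (simp only: T') simp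
        then have "zeta a n * (zlist zs :: 'k gpoly) \<in> red m (?Q L xs)"
        proof (rule red_mult)
          show "zeta a n \<in> carrier (polyB m)"
            using T a by (intro zeta_polyB) auto
          fix us assume us: "?R' us"
          \<comment> \<open>The rest of the word has odd weight exactly at \<open>a\<close>, so
            after straightening at \<open>a\<close> a letter containing \<open>a\<close> remains,
            and by the same parity it starts with \<open>a\<close>.\<close>
          have "us \<notin> lists (pairs (set T'))"
            using us wzs[of a] wt_outside[of us "set T'" a] aT' by auto
          then obtain g vs where g: "g \<in> pairs (set T) - pairs (set T')" and vs: "vs \<in> lists (pairs (set T'))"
            and us_eq: "us = g # vs" using us by auto
          have wus: "wt (g # vs) i = wt zs i" for i
            using us by (simp add: us_eq del: wt.simps)
          have "fst g = a"
            using wus[of a] wzs[of a] wt_outside[OF vs aT'] by simp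
          then obtain b where b: "b \<in> insert 0 (set T) - {a}" "g = (a, b)"
            using g by (cases g) (auto simp: pairs_def)
          have "\<not> wt vs i" for i
            using wus[of i] wzs[of i] by (auto simp: b)
          then have "(zlist vs :: 'k gpoly) \<in> red m (?Q T' vs)"
            using less.hyps[of T' vs] T(3) T' vs by blast
          then have "(zeta a n * zeta a b) * (zlist vs :: 'k gpoly) \<in> red m (?Q L xs)"
          proof (rule red_mult)
            show "zeta a n * zeta a b \<in> carrier (polyB m)"
              using T a b by (intro polyB_mult zeta_polyB) auto
            fix ts assume ts: "?Q T' vs ts"
            then obtain w where w: "w \<in> basis_words T'" "ts = flat w" by auto
            have "flat ((a, n, b) # w) \<in> flat ` basis_words L"
              using w a b unfolding Cons T'_def by (intro imageI) auto
            then have "?Q L xs ((a, n) # (a, b) # ts)"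
              using ts us len uc by (auto simp: w us_eq b ys_eq a split: if_splits)
            then show "(zeta a n * zeta a b) * (zlist ts :: 'k gpoly) \<in> red m (?Q L xs)"
              by (rule red_base_eq[where Q = "?Q L xs"]) (simp add: mult_ac)
          qed
          then show "zeta a n * (zlist us :: 'k gpoly) \<in> red m (?Q L xs)"
            by (simp add: us_eq b mult_ac)
        qed
        then show ?thesis by (simp add: ys_eq a)
      qed
    qed
  qed
qed

section \<open>A function model\<close>

text \<open>
  On a point of $\mathbb{R}^m$ off all the hyperplanes, replace every generator by the sign of its
  linear form.  A relation then holds up to terms of lower degree.  Such a point enters only through
  the signs \<open>s i\<close> and the comparisons of the absolute values \<open>r i\<close> of its coordinates, and
  \<open>zeta i j\<close> takes the value \<open>s i * theta r i j\<close>.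
\<close>

definition theta :: "(nat \<Rightarrow> real) \<Rightarrow> nat \<Rightarrow> nat \<Rightarrow> 'k::field" where
  "theta r i j = (if j = 0 \<or> r j < r i then 1 else 0)"

text \<open>The sign of x_j - x_i or x_j + x_i is decided by the coordinate of larger absolute
  value: for positive indices at most one \<open>theta\<close> in each sum is nonzero. The signs are
  field elements, like the values of the functions.\<close>

fun gen_sign :: "(nat \<Rightarrow> 'k) \<Rightarrow> (nat \<Rightarrow> real) \<Rightarrow> gen \<Rightarrow> 'k::field" where
  "gen_sign s r (U i) = s i"
| "gen_sign s r (Up i j) = s j * theta r j i - s i * theta r i j"
| "gen_sign s r (Um i j) = s i * theta r i j + s j * theta r j i"

text \<open>The indeterminate records the degree: setting it to 1 gives the value at the point, and
  its coefficients are the values of the homogeneous parts.\<close>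

definition Phi :: "(nat \<Rightarrow> 'k) \<Rightarrow> (nat \<Rightarrow> real) \<Rightarrow> 'k::field gpoly \<Rightarrow> 'k poly" where
  "Phi s r = peval (\<lambda>c. [:c:]) (\<lambda>g. monom (gen_sign s r g) 1)"

lemma Phi_simps [simp]:
  "Phi s r (mvar x) = monom (gen_sign s r x) 1"
  "Phi s r (mconst c) = [:c:]"
  "Phi s r (f + g) = Phi s r f + Phi s r g"
  "Phi s r (f - g) = Phi s r f - Phi s r g"
  "Phi s r (- f) = - Phi s r f"
  "Phi s r (f * g) = Phi s r f * Phi s r g"
  "Phi s r 0 = 0"
  "Phi s r 1 = 1"
  by (simp_all add: Phi_def pconst.peval_add pconst.peval_diff pconst.peval_minus pconst.peval_mult)

lemma Phi_zeta:
  assumes "1 \<le> i" "i \<noteq> j"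
  shows "Phi s r (zeta i j) = monom (s i * theta r i j :: 'k::field_char_0) 1"
  using assms
  by (auto simp: zeta_def Mgen_def Pgen_def add_monom diff_monom minus_monom smult_monom
      distrib_left diff_divide_distrib theta_def)

definition sign_val :: "(nat \<Rightarrow> 'k) \<Rightarrow> (nat \<times> nat) list \<Rightarrow> 'k::comm_ring_1" where
  "sign_val s xs = (\<Prod>p\<leftarrow>xs. s (fst p))"

definition theta_val :: "(nat \<Rightarrow> real) \<Rightarrow> (nat \<times> nat) list \<Rightarrow> 'k::field" where
  "theta_val r xs = (\<Prod>p\<leftarrow>xs. theta r (fst p) (snd p))"

lemma val_simps [simp]:
  "sign_val s [] = 1" "sign_val s (p # xs) = s (fst p) * sign_val s xs"
  "theta_val r [] = 1" "theta_val r (p # xs) = theta r (fst p) (snd p) * theta_val r xs"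
  by (auto simp: sign_val_def theta_val_def)

lemma Phi_zlist:
  assumes "xs \<in> lists (pairs S)" "0 \<notin> S"
  shows "Phi s r (zlist xs) = monom (sign_val s xs * theta_val r xs :: 'k::field_char_0) (length xs)"
  using assms
proof (induction xs)
  case (Cons p xs)
  then have "Phi s r (zeta (fst p) (snd p)) = monom (s (fst p) * theta r (fst p) (snd p)) 1"
    by (intro Phi_zeta) (auto simp: pairs_def intro!: Suc_leI gr0I)
  then show ?case using Cons by (simp add: mult_monom mult_ac)
qed (simp add: monom_0)

definition good_point :: "nat \<Rightarrow> (nat \<Rightarrow> 'k::field) \<Rightarrow> (nat \<Rightarrow> real) \<Rightarrow> bool" where
  "good_point m s r \<longleftrightarrow> (\<forall>i\<in>{1..m}. s i * s i = 1) \<and> inj_on r {1..m}"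

section \<open>Spans of monomials in the \<open>zeta\<close>\<close>

definition zspan :: "nat \<Rightarrow> ((nat \<times> nat) list \<Rightarrow> bool) \<Rightarrow> 'k::field gpoly set" where
  "zspan m Q = mpol.span (zlist ` {xs \<in> lists (pairs {1..m}). Q xs})"

lemma zspan_base: "xs \<in> lists (pairs {1..m}) \<Longrightarrow> Q xs \<Longrightarrow> zlist xs \<in> zspan m Q"
  by (auto simp: zspan_def intro!: mpol.span_base)

lemma zspan_subspace: "mpol.subspace (zspan m Q)"
  by (simp add: zspan_def)

lemma zspan_minimal:
  assumes "mpol.subspace V" "\<And>xs. xs \<in> lists (pairs {1..m}) \<Longrightarrow> Q xs \<Longrightarrow> zlist xs \<in> V"
  shows "zspan m Q \<subseteq> V"
  unfolding zspan_def using assms by (intro mpol.span_minimal) auto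

lemma zspan_mono: "(\<And>xs. Q xs \<Longrightarrow> Q' xs) \<Longrightarrow> zspan m Q \<subseteq> zspan m Q'"
  by (intro zspan_minimal zspan_subspace zspan_base)

lemma subspace_mult_preimage:
  assumes "mpol.subspace V" shows "mpol.subspace {f. p * f \<in> V}"
  using assms unfolding mpol.subspace_def
  by (auto simp: distrib_left mult.left_commute[of p])

lemma zspan_mult:
  assumes f: "f \<in> zspan m Q" and g: "g \<in> zspan m Q'" and "\<And>xs ys. Q xs \<Longrightarrow> Q' ys \<Longrightarrow> R (xs @ ys)"
  shows "f * g \<in> zspan m R"
proof -
  have "zspan m Q' \<subseteq> {g. f * g \<in> zspan m R}"
  proof (rule zspan_minimal[OF subspace_mult_preimage[OF zspan_subspace]])
    fix ys assume ys: "ys \<in> lists (pairs {1..m})" "Q' ys"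
    have "zspan m Q \<subseteq> {f. zlist ys * f \<in> zspan m R}"
    proof (rule zspan_minimal[OF subspace_mult_preimage[OF zspan_subspace]])
      fix xs assume "xs \<in> lists (pairs {1..m})" "Q xs"
      then have "zlist (xs @ ys) \<in> zspan m R"
        using ys assms(3) by (intro zspan_base) auto
      then show "zlist xs \<in> {f. zlist ys * f \<in> zspan m R}"
        by (simp add: zlist_append mult.commute)
    qed
    then show "zlist ys \<in> {g. f * g \<in> zspan m R}"
      using f by (auto simp: mult.commute)
  qed
  then show ?thesis using g by auto
qed

text \<open>The generators are linear combinations of the \<open>zeta\<close>, so linear claims on
  the polynomial ring need to be checked on words only.\<close>

lemma polyB_eq_zspan: "carrier (polyB m) = (zspan m (\<lambda>_. True) :: 'k::field_char_0 gpoly set)"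
proof
  have one: "1 \<in> (zspan m (\<lambda>_. True) :: 'k gpoly set)"
    using zspan_base[of "[]" m "\<lambda>_. True"] by simp
  have z: "zeta i j \<in> (zspan m (\<lambda>_. True) :: 'k gpoly set)" if "(i, j) \<in> pairs {1..m}" for i j
    using zspan_base[of "[(i, j)]" m "\<lambda>_. True"] that by simp
  have var: "mvar g \<in> (zspan m (\<lambda>_. True) :: 'k gpoly set)" if "g \<in> gens m" for g
  proof (cases g)
    case (U i)
    then show ?thesis using that by (auto simp: u_zeta pairs_def intro!: z)
  next
    case (Up i j)
    then show ?thesis using that
      by (auto simp: up_zeta pairs_def intro!: z mpol.subspace_diff[OF zspan_subspace])
  next
    case (Um i j)
    then show ?thesis using that
      by (auto simp: um_zeta pairs_def intro!: z mpol.subspace_add[OF zspan_subspace])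
  qed
  have mult: "f * g \<in> (zspan m (\<lambda>_. True) :: 'k gpoly set)"
    if "f \<in> zspan m (\<lambda>_. True)" "g \<in> zspan m (\<lambda>_. True)" for f g
    by (rule zspan_mult[OF that]) simp
  have pow: "f ^ n \<in> (zspan m (\<lambda>_. True) :: 'k gpoly set)" if "f \<in> zspan m (\<lambda>_. True)" for f n
    using that by (induction n) (auto intro: one mult)
  have mono: "monom_val mvar e \<in> (zspan m (\<lambda>_. True) :: 'k gpoly set)"
    if "Poly_Mapping.keys e \<subseteq> gens m" for e
  proof -
    have "(\<Prod>x\<in>A. mvar x ^ Poly_Mapping.lookup e x) \<in> (zspan m (\<lambda>_. True) :: 'k gpoly set)"
      if "A \<subseteq> gens m" for A
      using that by (induction A rule: infinite_finite_induct) (auto intro!: one mult pow var)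
    then show ?thesis using that by (simp add: monom_val_def)
  qed
  show "carrier (polyB m) \<subseteq> (zspan m (\<lambda>_. True) :: 'k gpoly set)"
  proof
    fix f :: "'k gpoly" assume "f \<in> carrier (polyB m)"
    then have "(\<Sum>e\<in>Poly_Mapping.keys f. mconst (Poly_Mapping.lookup f e) * monom_val mvar e) \<in> zspan m (\<lambda>_. True)"
      by (intro mpol.subspace_sum[OF zspan_subspace] mpol.subspace_scale[OF zspan_subspace] mono)
        (auto simp: mem_polyB)
    then show "f \<in> zspan m (\<lambda>_. True)" by (simp only: mpol_eq_sum_monom_val[symmetric])
  qed
  show "(zspan m (\<lambda>_. True) :: 'k gpoly set) \<subseteq> carrier (polyB m)"
    by (rule zspan_minimal[OF polyB_subspace]) (auto intro: zlist_polyB)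
qed

text \<open>
  These ideals contain \<open>idealJ m\<close> and the \<open>c\<close>-th power of the ideal of the \<open>u\<^sub>i\<close>, and thus
  reduce independence in the graded ring to independence of functions.
\<close>

definition filt :: "nat \<Rightarrow> nat \<Rightarrow> 'k::field_char_0 gpoly set" where
  "filt m c = {f \<in> carrier (polyB m). \<forall>d.
     \<exists>g\<in>zspan m (\<lambda>xs. length xs < d \<or> length xs = d \<and> c \<le> ucount xs).
       \<forall>s r. good_point m s r \<longrightarrow> coeff (Phi s r f) d = poly (Phi s r g) 1}"

lemma filtI:
  fixes f :: "'k::field_char_0 gpoly"
  assumes "f \<in> carrier (polyB m)"
    and "\<And>d. \<exists>g\<in>zspan m (\<lambda>xs. length xs < d \<or> length xs = d \<and> c \<le> ucount xs).
       \<forall>s r. good_point m s r \<longrightarrow> coeff (Phi s r f) d = poly (Phi s r g) 1"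
  shows "f \<in> filt m c"
  using assms by (simp add: filt_def)

lemma filtE:
  fixes f :: "'k::field_char_0 gpoly"
  assumes "f \<in> filt m c"
  obtains g where "g \<in> zspan m (\<lambda>xs. length xs < d \<or> length xs = d \<and> c \<le> ucount xs)"
    and "\<And>s r. good_point m s r \<Longrightarrow> coeff (Phi s r f) d = poly (Phi s r g) 1"
  using assms unfolding filt_def by blast

lemma filt_polyB: "f \<in> filt m c \<Longrightarrow> f \<in> carrier (polyB m)"
  by (simp add: filt_def)

lemma filt_subspace: "mpol.subspace (filt m c)"
  unfolding mpol.subspace_def
proof (intro conjI ballI allI)
  show "0 \<in> filt m c"
    by (rule filtI) (auto intro!: bexI[of _ 0] mpol.subspace_0 zspan_subspace)
next
  fix f g :: "'a gpoly" assume f: "f \<in> filt m c" and g: "g \<in> filt m c"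
  show "f + g \<in> filt m c"
  proof (rule filtI)
    fix d
    obtain f' where f': "f' \<in> zspan m (\<lambda>xs. length xs < d \<or> length xs = d \<and> c \<le> ucount xs)"
      "\<And>s r. good_point m s r \<Longrightarrow> coeff (Phi s r f) d = poly (Phi s r f') 1"
      using filtE[OF f, where d = d] by blast
    obtain g' where g': "g' \<in> zspan m (\<lambda>xs. length xs < d \<or> length xs = d \<and> c \<le> ucount xs)"
      "\<And>s r. good_point m s r \<Longrightarrow> coeff (Phi s r g) d = poly (Phi s r g') 1"
      using filtE[OF g, where d = d] by blast
    show "\<exists>h\<in>zspan m (\<lambda>xs. length xs < d \<or> length xs = d \<and> c \<le> ucount xs).
        \<forall>s r. good_point m s r \<longrightarrow> coeff (Phi s r (f + g)) d = poly (Phi s r h) 1"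
      by (rule bexI[OF _ mpol.subspace_add[OF zspan_subspace f'(1) g'(1)]]) (simp add: f'(2) g'(2))
  qed (use f g in \<open>auto dest: filt_polyB\<close>)
next
  fix a and f :: "'a gpoly" assume f: "f \<in> filt m c"
  show "mconst a * f \<in> filt m c"
  proof (rule filtI)
    fix d
    obtain f' where f': "f' \<in> zspan m (\<lambda>xs. length xs < d \<or> length xs = d \<and> c \<le> ucount xs)"
      "\<And>s r. good_point m s r \<Longrightarrow> coeff (Phi s r f) d = poly (Phi s r f') 1"
      using filtE[OF f, where d = d] by blast
    show "\<exists>h\<in>zspan m (\<lambda>xs. length xs < d \<or> length xs = d \<and> c \<le> ucount xs).
        \<forall>s r. good_point m s r \<longrightarrow> coeff (Phi s r (mconst a * f)) d = poly (Phi s r h) 1"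
      by (rule bexI[OF _ mpol.subspace_scale[OF zspan_subspace f'(1), of a]]) (simp add: f'(2))
  qed (use f in \<open>auto dest: filt_polyB\<close>)
qed

text \<open>Homogeneous parts multiply by convolution. A product of two admissible words either is
  shorter than the full degree, or both factors have full length and then the numbers of u's add
  up.\<close>

lemma filt_mult:
  fixes f g :: "'k::field_char_0 gpoly"
  assumes f: "f \<in> filt m a" and g: "g \<in> filt m b"
  shows "f * g \<in> filt m (a + b)"
proof (rule filtI)
  show "f * g \<in> carrier (polyB m)" using f g by (auto dest: filt_polyB)
  fix d
  let ?Z = "\<lambda>c d. zspan m (\<lambda>xs. length xs < d \<or> length xs = d \<and> c \<le> ucount xs) :: 'k gpoly set"
  have "\<forall>d. \<exists>h. h \<in> ?Z a d \<and> (\<forall>s r. good_point m s r \<longrightarrow> coeff (Phi s r f) d = poly (Phi s r h) 1)"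
    using f unfolding filt_def by blast
  from choice[OF this] obtain F where F: "\<And>d. F d \<in> ?Z a d"
    "\<And>d s r. good_point m s r \<Longrightarrow> coeff (Phi s r f) d = poly (Phi s r (F d)) 1"
    by blast
  have "\<forall>d. \<exists>h. h \<in> ?Z b d \<and> (\<forall>s r. good_point m s r \<longrightarrow> coeff (Phi s r g) d = poly (Phi s r h) 1)"
    using g unfolding filt_def by blast
  from choice[OF this] obtain G where G: "\<And>d. G d \<in> ?Z b d"
    "\<And>d s r. good_point m s r \<Longrightarrow> coeff (Phi s r g) d = poly (Phi s r (G d)) 1"
    by blast
  define h where "h = (\<Sum>i\<le>d. F i * G (d - i))"
  have Phi_sum: "Phi s r (sum k A) = (\<Sum>i\<in>A. Phi s r (k i))" for s r and k :: "nat \<Rightarrow> 'k gpoly" and A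
    by (induction A rule: infinite_finite_induct) auto
  have "F i * G (d - i) \<in> ?Z (a + b) d" if "i \<le> d" for i
    using that by (intro zspan_mult[OF F(1) G(1)]) (auto simp: ucount_append)
  then have "h \<in> ?Z (a + b) d"
    unfolding h_def by (intro mpol.subspace_sum[OF zspan_subspace]) auto
  moreover have "coeff (Phi s r (f * g)) d = poly (Phi s r h) 1" if "good_point m s r" for s r
    using F(2)[OF that] G(2)[OF that] by (simp add: h_def Phi_sum coeff_mult poly_sum)
  ultimately show "\<exists>h\<in>?Z (a + b) d. \<forall>s r. good_point m s r \<longrightarrow> coeff (Phi s r (f * g)) d = poly (Phi s r h) 1"
    by blast
qed

lemma zlist_filt:
  assumes "xs \<in> lists (pairs {1..m})" "c \<le> ucount xs"
  shows "(zlist xs :: 'k::field_char_0 gpoly) \<in> filt m c"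
proof (rule filtI)
  show "zlist xs \<in> carrier (polyB m)" using assms by (intro zlist_polyB[of _ "{1..m}"]) auto
  fix d
  let ?Z = "zspan m (\<lambda>xs. length xs < d \<or> length xs = d \<and> c \<le> ucount xs) :: 'k gpoly set"
  let ?g = "if length xs = d then zlist xs else 0 :: 'k gpoly"
  have "?g \<in> ?Z"
    using assms mpol.subspace_0[OF zspan_subspace] by (auto intro!: zspan_base)
  moreover have "coeff (Phi s r (zlist xs)) d = poly (Phi s r ?g) 1" for s and r :: "nat \<Rightarrow> real"
    using assms(1) by (simp add: Phi_zlist[OF assms(1)] poly_monom)
  ultimately show "\<exists>g\<in>?Z. \<forall>s (r :: nat \<Rightarrow> real). good_point m s r \<longrightarrow> coeff (Phi s r (zlist xs)) d = poly (Phi s r g) 1"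
    by blast
qed

lemma polyB_filt: "f \<in> carrier (polyB m) \<Longrightarrow> f \<in> filt m 0"
  using zspan_minimal[OF filt_subspace, of m "\<lambda>_. True" m 0] zlist_filt
  by (auto simp: polyB_eq_zspan)

lemma filt_mult_polyB: "f \<in> filt m c \<Longrightarrow> p \<in> carrier (polyB m) \<Longrightarrow> p * f \<in> filt m c"
  using filt_mult[OF polyB_filt, of p m f c] by simp

lemma filt_ideal: "ideal (filt m c) (polyB m :: ('k::field_char_0, 'k gpoly) module)"
  by (rule polyB_idealI) (auto intro: filt_mult_polyB filt_subspace filt_polyB)

text \<open>A constant is also the value of a multiple of the empty word, whose length 0 is below 2;
  so a quadric with constant values lies in \<open>filt m c\<close> for every
  \<open>c\<close>.\<close>

lemma filt_const_degree_two:
  fixes f :: "'k::field_char_0 gpoly"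
  assumes f: "f \<in> carrier (polyB m)" and v: "\<And>s r. good_point m s r \<Longrightarrow> Phi s r f = monom a 2"
  shows "f \<in> filt m c"
proof (rule filtI[OF f])
  fix d
  let ?Z = "zspan m (\<lambda>xs. length xs < d \<or> length xs = d \<and> c \<le> ucount xs) :: 'k gpoly set"
  show "\<exists>g\<in>?Z. \<forall>s r. good_point m s r \<longrightarrow> coeff (Phi s r f) d = poly (Phi s r g) 1"
  proof (cases "d = 2")
    case True
    have "mconst a * zlist [] \<in> ?Z"
      by (intro mpol.subspace_scale[OF zspan_subspace] zspan_base) (auto simp: True)
    then show ?thesis by (intro bexI[of _ "mconst a"]) (auto simp: v True)
  next
    case False
    then show ?thesis
      by (intro bexI[of _ 0] mpol.subspace_0 zspan_subspace) (auto simp: v)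
  qed
qed

lemma good_pointD:
  assumes "good_point m s r"
  shows "i \<in> {1..m} \<Longrightarrow> s i * s i = 1"
    and "i \<in> {1..m} \<Longrightarrow> j \<in> {1..m} \<Longrightarrow> i \<noteq> j \<Longrightarrow> r i < r j \<or> r j < r i"
  using assms unfolding good_point_def by (simp, metis inj_on_contraD linorder_neqE)

lemma mvar_square_filt: "g \<in> gens m \<Longrightarrow> (mvar g ^ 2 :: 'k::field_char_0 gpoly) \<in> filt m c"
proof (rule filt_const_degree_two[where a = 1])
  fix s :: "nat \<Rightarrow> 'k" and r assume g: "g \<in> gens m" and p: "good_point m s r"
  have "gen_sign s r g * gen_sign s r g = 1"
  proof (cases g)
    case (Up i j)
    then show ?thesis
      using g good_pointD(1)[OF p, of i] good_pointD(1)[OF p, of j] good_pointD(2)[OF p, of i j]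
      by (auto simp: theta_def)
  next
    case (Um i j)
    then show ?thesis
      using g good_pointD(1)[OF p, of i] good_pointD(1)[OF p, of j] good_pointD(2)[OF p, of i j]
      by (auto simp: theta_def)
  qed (use g good_pointD(1)[OF p] in auto)
  then show "Phi s r (mvar g ^ 2) = monom 1 2"
    by (simp add: power2_eq_square mult_monom numeral_2_eq_2)
qed (auto simp: power2_eq_square)

text \<open>Each relation reads a b - a c - b c, where, up to signs of the forms, \<open>c\<close>
  belongs to a positive combination of the forms of \<open>a\<close> and \<open>b\<close>. If
  \<open>a\<close> and \<open>b\<close> have equal signs, \<open>c\<close> has the same; otherwise
  the two products with \<open>c\<close> cancel. The value is -1 in both cases. The relations for
  triples behave alike.\<close>

lemma pair_relation_filt:
  fixes m :: nat
  assumes "1 \<le> i" "i < j" "j \<le> m"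
  shows "(u i * up i j - u i * um i j - up i j * um i j :: 'k::field_char_0 gpoly) \<in> filt m c"
    and "(u i * up i j - u i * u j - up i j * u j :: 'k gpoly) \<in> filt m c"
    and "(u i * u j - u i * um i j - u j * um i j :: 'k gpoly) \<in> filt m c"
proof -
  have vals: "gen_sign s r (U i) * gen_sign s r (Up i j) - gen_sign s r (U i) * gen_sign s r (Um i j)
      - gen_sign s r (Up i j) * gen_sign s r (Um i j) = - 1"
    "gen_sign s r (U i) * gen_sign s r (Up i j) - gen_sign s r (U i) * gen_sign s r (U j)
      - gen_sign s r (Up i j) * gen_sign s r (U j) = - 1"
    "gen_sign s r (U i) * gen_sign s r (U j) - gen_sign s r (U i) * gen_sign s r (Um i j)
      - gen_sign s r (U j) * gen_sign s r (Um i j) = - 1"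
    if "good_point m s r" for s :: "nat \<Rightarrow> 'k" and r
    using good_pointD(1)[OF that, of i] good_pointD(1)[OF that, of j] good_pointD(2)[OF that, of i j] assms
    by (auto simp: theta_def algebra_simps)
  show "(u i * up i j - u i * um i j - up i j * um i j :: 'k gpoly) \<in> filt m c"
    and "(u i * up i j - u i * u j - up i j * u j :: 'k gpoly) \<in> filt m c"
    and "(u i * u j - u i * um i j - u j * um i j :: 'k gpoly) \<in> filt m c"
    using assms by (intro filt_const_degree_two[where a = "-1"];
        simp add: mult_monom diff_monom numeral_2_eq_2[symmetric] vals del: gen_sign.simps;
        intro polyB_diff polyB_mult polyB_mvar; simp)+
qed

lemma triple_relation_filt:
  fixes m :: nat
  assumes "1 \<le> i" "i < j" "j < k" "k \<le> m"
  shows "(up i j * up j k - up i j * up i k - up i k * up j k :: 'k::field_char_0 gpoly) \<in> filt m c"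
    and "(um i j * up j k - um i j * um i k - um i k * up j k :: 'k gpoly) \<in> filt m c"
    and "(- (um i j * um j k) + um i j * up i k - up i k * um j k :: 'k gpoly) \<in> filt m c"
    and "(- (up i j * um j k) + up i j * um i k - um i k * um j k :: 'k gpoly) \<in> filt m c"
proof -
  let ?p = "\<lambda>(s :: nat \<Rightarrow> 'k) r i j. gen_sign s r (Up i j)" and ?m = "\<lambda>(s :: nat \<Rightarrow> 'k) r i j. gen_sign s r (Um i j)"
  have vals: "?p s r i j * ?p s r j k - ?p s r i j * ?p s r i k - ?p s r i k * ?p s r j k = - 1"
    "?m s r i j * ?p s r j k - ?m s r i j * ?m s r i k - ?m s r i k * ?p s r j k = - 1"
    "- (?m s r i j * ?m s r j k) + ?m s r i j * ?p s r i k - ?p s r i k * ?m s r j k = - 1"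
    "- (?p s r i j * ?m s r j k) + ?p s r i j * ?m s r i k - ?m s r i k * ?m s r j k = - 1"
    if "good_point m s r" for s :: "nat \<Rightarrow> 'k" and r
    using good_pointD(1)[OF that, of i] good_pointD(1)[OF that, of j] good_pointD(1)[OF that, of k]
      good_pointD(2)[OF that, of i j] good_pointD(2)[OF that, of i k] good_pointD(2)[OF that, of j k] assms
    by (auto simp: theta_def algebra_simps)
  show "(up i j * up j k - up i j * up i k - up i k * up j k :: 'k gpoly) \<in> filt m c"
    and "(um i j * up j k - um i j * um i k - um i k * up j k :: 'k gpoly) \<in> filt m c"
    and "(- (um i j * um j k) + um i j * up i k - up i k * um j k :: 'k gpoly) \<in> filt m c"
    and "(- (up i j * um j k) + up i j * um i k - um i k * um j k :: 'k gpoly) \<in> filt m c"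
    using assms by (intro filt_const_degree_two[where a = "-1"];
        (simp only: Phi_simps mult_monom diff_monom add_monom minus_monom vals one_add_one)?;
        intro polyB_diff polyB_add polyB_minus polyB_mult polyB_mvar; simp)+
qed

text \<open>Holding for every \<open>c\<close>, this says that each homogeneous part of an element
  of the ideal has the values of words shorter than its degree: relations are invisible in top
  degree.\<close>

lemma idealJ_filt: "(idealJ m :: 'k::field_char_0 gpoly set) \<subseteq> filt m c"
  unfolding idealJ_def
proof (rule ring.genideal_minimal[OF cring.axioms(1)[OF cring_polyB] filt_ideal])
  show "(relsB m :: 'k gpoly set) \<subseteq> filt m c"
    unfolding relsB_def
    by (safe; rule mvar_square_filt pair_relation_filt triple_relation_filt; assumption)
qed

text \<open>On words of weight zero the signs cancel, so all of them may be set to 1 and only the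
  order of the absolute values remains.\<close>

definition Ev :: "(nat \<Rightarrow> real) \<Rightarrow> 'k::field_char_0 gpoly \<Rightarrow> 'k" where
  "Ev r f = poly (Phi (\<lambda>_. 1) r f) 1"

lemma Ev_simps [simp]:
  "Ev r (f + g) = Ev r f + Ev r g" "Ev r (f - g) = Ev r f - Ev r g" "Ev r 0 = 0"
  "Ev r (mconst a * f) = a * Ev r f"
  by (simp_all add: Ev_def)

lemma Ev_sum: "Ev r (sum f A) = (\<Sum>x\<in>A. Ev r (f x))"
  by (induction A rule: infinite_finite_induct) auto

lemma sign_val_one [simp]: "sign_val (\<lambda>_. 1) xs = 1"
  by (induction xs) auto

lemma Ev_zlist: "xs \<in> lists (pairs S) \<Longrightarrow> 0 \<notin> S \<Longrightarrow> Ev r (zlist xs) = theta_val r xs"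
  by (simp add: Ev_def Phi_zlist poly_monom)

section \<open>Averaging over the sign changes\<close>

abbreviation wt0 :: "(nat \<times> nat) list \<Rightarrow> bool" where
  "wt0 xs \<equiv> \<forall>i. \<not> wt xs i"

lemma sign_val_eq_prod:
  assumes "xs \<in> lists (pairs {1..m})" "\<And>i. i \<in> {1..m} \<Longrightarrow> s i * s i = 1"
  shows "sign_val s xs = (\<Prod>i\<in>{1..m}. if wt xs i then s i else 1)"
  using assms(1)
proof (induction xs)
  case (Cons p xs)
  then have p: "fst p \<in> {1..m}" by (auto simp: pairs_def)
  let ?f = "\<lambda>xs i. if wt xs i then s i else 1"
  have "(\<Prod>i\<in>{1..m}. ?f (p # xs) i) = ?f (p # xs) (fst p) * (\<Prod>i\<in>{1..m} - {fst p}. ?f (p # xs) i)"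
    using p by (intro prod.remove) auto
  also have "(\<Prod>i\<in>{1..m} - {fst p}. ?f (p # xs) i) = (\<Prod>i\<in>{1..m} - {fst p}. ?f xs i)"
    by (rule prod.cong) auto
  also have "?f (p # xs) (fst p) = s (fst p) * ?f xs (fst p)"
    using assms(2)[OF p] by simp
  also have "s (fst p) * ?f xs (fst p) * (\<Prod>i\<in>{1..m} - {fst p}. ?f xs i) = s (fst p) * (\<Prod>i\<in>{1..m}. ?f xs i)"
    using p by (simp only: mult.assoc) (subst prod.remove[of "{1..m}" "fst p"], auto)
  finally show ?case using Cons by simp
qed simp

definition sign_vectors :: "nat \<Rightarrow> (nat \<Rightarrow> 'k::comm_ring_1) set" where
  "sign_vectors m = {1..m} \<rightarrow>\<^sub>E {1, -1}"

lemma sign_vectors_sq: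
  assumes "s \<in> sign_vectors m" "i \<in> {1..m}" shows "s i * s i = 1"
proof -
  have "s i \<in> {1, -1}"
    using assms unfolding sign_vectors_def by (rule PiE_mem)
  then show ?thesis by auto
qed

text \<open>Orthogonality of the characters of the group of sign changes: the sum factors over the
  points, and a point of odd weight contributes 1 + (-1).\<close>

lemma sum_sign_val:
  assumes "xs \<in> lists (pairs {1..m})"
  shows "(\<Sum>s\<in>sign_vectors m. sign_val s xs) = (if wt0 xs then 2 ^ m else (0::'k::{comm_ring_1, ring_char_0}))"
proof -
  have ne: "(1::'k) \<noteq> -1"
    using of_nat_neq_0[of 1, where 'a = 'k] by (auto simp: eq_neg_iff_add_eq_0)
  have "(\<Sum>s\<in>sign_vectors m. sign_val s xs)
      = (\<Sum>s\<in>sign_vectors m. \<Prod>i\<in>{1..m}. if wt xs i then s i else (1::'k))"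
    by (intro sum.cong refl sign_val_eq_prod assms) (rule sign_vectors_sq)
  also have "\<dots> = (\<Prod>i\<in>{1..m}. \<Sum>y\<in>{1, -1}. if wt xs i then y else (1::'k))"
    unfolding sign_vectors_def
    by (subst prod_sum_PiE[where f = "\<lambda>i y. if wt xs i then y else 1"]) auto
  also have "\<dots> = (if wt0 xs then 2 ^ m else 0)"
  proof (cases "wt0 xs")
    case True
    then show ?thesis using ne by simp
  next
    case False
    then obtain i where i: "wt xs i" "i \<in> {1..m}"
      using wt_outside[OF assms] by blast
    then show ?thesis using ne by (simp only: False if_False) (rule prod_zero, auto)
  qed
  finally show ?thesis .
qed

text \<open>Summing over all signs discards the words of nonzero weight, and what is left no longer
  depends on signs.\<close>

lemma sign_average:
  fixes g :: "'k::field_char_0 gpoly"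
  assumes "g \<in> zspan m Q"
  shows "\<exists>g'\<in>zspan m (\<lambda>xs. Q xs \<and> wt0 xs).
    \<forall>r. (\<Sum>s\<in>sign_vectors m. poly (Phi s r g) 1) = 2 ^ m * Ev r g'"
proof -
  let ?Z = "zspan m (\<lambda>xs. Q xs \<and> wt0 xs) :: 'k gpoly set"
  let ?A = "\<lambda>g r. \<Sum>s\<in>sign_vectors m. poly (Phi s r (g :: 'k gpoly)) 1"
  let ?V = "{g. \<exists>g'\<in>?Z. \<forall>r. ?A g r = 2 ^ m * Ev r g'}"
  have "mpol.subspace ?V"
    unfolding mpol.subspace_def
  proof (intro conjI ballI allI)
    show "0 \<in> ?V" by (auto intro!: bexI[of _ 0] mpol.subspace_0 zspan_subspace)
  next
    fix f g assume "f \<in> ?V" "g \<in> ?V"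
    then obtain f' g' where h: "f' \<in> ?Z" "\<And>r. ?A f r = 2 ^ m * Ev r f'"
      "g' \<in> ?Z" "\<And>r. ?A g r = 2 ^ m * Ev r g'" by blast
    show "f + g \<in> ?V"
      by (rule CollectI, rule bexI[OF _ mpol.subspace_add[OF zspan_subspace h(1) h(3)]])
        (simp add: sum.distrib h(2,4) distrib_left)
  next
    fix c g assume "g \<in> ?V"
    then obtain g' where h: "g' \<in> ?Z" "\<And>r. ?A g r = 2 ^ m * Ev r g'" by blast
    show "mconst c * g \<in> ?V"
      by (rule CollectI, rule bexI[OF _ mpol.subspace_scale[OF zspan_subspace h(1), of c]])
        (simp add: sum_distrib_left[symmetric] h(2))
  qed
  moreover have "zlist xs \<in> ?V" if xs: "xs \<in> lists (pairs {1..m})" "Q xs" for xs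
  proof -
    have A: "?A (zlist xs) r = (if wt0 xs then 2 ^ m else 0) * theta_val r xs" for r
    proof -
      have "?A (zlist xs) r = (\<Sum>s\<in>sign_vectors m. sign_val s xs) * theta_val r xs"
        unfolding sum_distrib_right using xs
        by (intro sum.cong refl) (simp add: Phi_zlist[OF xs(1)] poly_monom)
      then show ?thesis using sum_sign_val[OF xs(1), where 'k = 'k] by simp
    qed
    show ?thesis
    proof (cases "wt0 xs")
      case True
      then have "zlist xs \<in> ?Z" using xs by (intro zspan_base) auto
      moreover have "?A (zlist xs) r = 2 ^ m * Ev r (zlist xs)" for r
        using True A[of r] by (simp add: Ev_zlist[OF xs(1)])
      ultimately show ?thesis by blast
    next
      case False
      then have "?A (zlist xs) r = 2 ^ m * Ev r 0" for r
        using A[of r] by (simp only: False if_False) simp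
      then show ?thesis using mpol.subspace_0[OF zspan_subspace] by blast
    qed
  qed
  ultimately have "zspan m Q \<subseteq> ?V" by (intro zspan_minimal)
  then show ?thesis using assms by blast
qed

text \<open>Membership in \<open>filt\<close> provides a polynomial with the same values in shorter
  words or words with enough u's, but of arbitrary weights. The values of \<open>h\<close> do not
  depend on the signs, so averaging leaves just the part of weight zero.\<close>

lemma leading_value:
  fixes h :: "'k::field_char_0 gpoly"
  assumes h: "h \<in> filt m c" and hom: "h \<in> zspan m (\<lambda>xs. length xs = d \<and> wt0 xs)"
  shows "\<exists>g\<in>zspan m (\<lambda>xs. (length xs < d \<or> length xs = d \<and> c \<le> ucount xs) \<and> wt0 xs).
    \<forall>r. inj_on r {1..m} \<longrightarrow> Ev r h = Ev r g"
proof -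
  have val: "coeff (Phi s r h) d = Ev r h" if "good_point m s r" for s r
  proof -
    have sq: "s i * s i = 1" if "i \<in> {1..m}" for i
      using good_pointD(1) \<open>good_point m s r\<close> that by blast
    let ?V = "{h. coeff (Phi s r h) d = Ev r h}"
    have "mpol.subspace ?V" by (auto simp: mpol.subspace_def)
    moreover have "zlist xs \<in> ?V"
      if xs: "xs \<in> lists (pairs {1..m})" "length xs = d \<and> wt0 xs" for xs
    proof -
      have "sign_val s xs = 1"
        using sign_val_eq_prod[OF xs(1) sq] xs(2) by simp
      then show ?thesis
        using xs(2) by (simp add: Phi_zlist[OF xs(1)] Ev_zlist[OF xs(1)])
    qed
    ultimately have "zspan m (\<lambda>xs. length xs = d \<and> wt0 xs) \<subseteq> ?V" by (rule zspan_minimal)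
    then show ?thesis using hom by blast
  qed
  obtain g where g: "g \<in> zspan m (\<lambda>xs. length xs < d \<or> length xs = d \<and> c \<le> ucount xs)"
    and gv: "\<And>s r. good_point m s r \<Longrightarrow> coeff (Phi s r h) d = poly (Phi s r g) 1"
    using filtE[OF h, where d = d] by blast
  obtain g' where g': "g' \<in> zspan m (\<lambda>xs. (length xs < d \<or> length xs = d \<and> c \<le> ucount xs) \<and> wt0 xs)"
    and avg: "\<And>r. (\<Sum>s\<in>sign_vectors m. poly (Phi s r g) 1) = 2 ^ m * Ev r g'"
    using sign_average[OF g] by blast
  have "Ev r h = Ev r g'" if r: "inj_on r {1..m}" for r
  proof -
    have "good_point m s r" if "s \<in> sign_vectors m" for s :: "nat \<Rightarrow> 'k"
      using that r by (simp add: good_point_def sign_vectors_sq)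
    then have "(\<Sum>s\<in>sign_vectors m. poly (Phi (s :: nat \<Rightarrow> 'k) r g) 1) = (\<Sum>s\<in>(sign_vectors m :: (nat \<Rightarrow> 'k) set). Ev r h)"
      by (intro sum.cong refl) (simp add: gv[symmetric] val)
    then have "2 ^ m * Ev r g' = of_nat (card (sign_vectors m :: (nat \<Rightarrow> 'k) set)) * Ev r h"
      using avg[of r] by simp
    \<comment> \<open>The sign vectors are counted by the orthogonality sum for the empty
      word.\<close>
    moreover have "of_nat (card (sign_vectors m :: (nat \<Rightarrow> 'k) set)) = (2 ^ m :: 'k)"
      using sum_sign_val[of "[]" m, where 'k = 'k] by (simp del: of_nat_power of_nat_eq_iff)
    ultimately show ?thesis by simp
  qed
  then show ?thesis using g' by blast
qed

section \<open>Expansion of values in basis words\<close>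

lemma span_image_eq:
  fixes h :: "'a \<Rightarrow> ('x, 'k::field) mpol"
  assumes "finite W"
  shows "mpol.span (h ` W) = range (\<lambda>b. \<Sum>w\<in>W. mconst (b w) * h w)"
proof
  have "mpol.subspace (range (\<lambda>b. \<Sum>w\<in>W. mconst (b w) * h w))"
    unfolding mpol.subspace_def
  proof (intro conjI ballI allI)
    show "0 \<in> range (\<lambda>b. \<Sum>w\<in>W. mconst (b w) * h w)"
      by (rule range_eqI[of _ _ "\<lambda>_. 0"]) simp
  next
    fix x y assume "x \<in> range (\<lambda>b. \<Sum>w\<in>W. mconst (b w) * h w)" "y \<in> range (\<lambda>b. \<Sum>w\<in>W. mconst (b w) * h w)"
    then obtain b b' where "x = (\<Sum>w\<in>W. mconst (b w) * h w)" "y = (\<Sum>w\<in>W. mconst (b' w) * h w)"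
      by blast
    then have "x + y = (\<Sum>w\<in>W. mconst (b w + b' w) * h w)"
      by (simp only: mconst_add distrib_right sum.distrib)
    then show "x + y \<in> range (\<lambda>b. \<Sum>w\<in>W. mconst (b w) * h w)"
      by (rule range_eqI[of _ _ "\<lambda>w. b w + b' w"])
  next
    fix c x assume "x \<in> range (\<lambda>b. \<Sum>w\<in>W. mconst (b w) * h w)"
    then obtain b where "x = (\<Sum>w\<in>W. mconst (b w) * h w)" by blast
    then have "mconst c * x = (\<Sum>w\<in>W. mconst (c * b w) * h w)"
      by (simp only: mconst_mult sum_distrib_left mult.assoc)
    then show "mconst c * x \<in> range (\<lambda>b. \<Sum>w\<in>W. mconst (b w) * h w)"
      by (rule range_eqI[of _ _ "\<lambda>w. c * b w"])
  qed
  moreover have "h w \<in> range (\<lambda>b. \<Sum>w\<in>W. mconst (b w) * h w)" if "w \<in> W" for w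
  proof (rule range_eqI)
    have "(\<Sum>v\<in>W. mconst (if v = w then 1 else 0) * h v) = (\<Sum>v\<in>W. if v = w then h v else 0)"
      by (intro sum.cong) auto
    then show "h w = (\<Sum>v\<in>W. mconst (if v = w then 1 else 0) * h v)"
      using assms that by simp
  qed
  ultimately show "mpol.span (h ` W) \<subseteq> range (\<lambda>b. \<Sum>w\<in>W. mconst (b w) * h w)"
    by (intro mpol.span_minimal) auto
  show "range (\<lambda>b. \<Sum>w\<in>W. mconst (b w) * h w) \<subseteq> mpol.span (h ` W)"
    by (auto intro!: mpol.span_sum mpol.span_scale intro: mpol.span_base)
qed

lemma pairs_mono: "S \<subseteq> T \<Longrightarrow> pairs S \<subseteq> pairs T"
  by (auto simp: pairs_def)

lemma basis_words_finite [simp]: "finite (basis_words L)"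
  by (induction L rule: basis_words.induct) auto

lemma basis_words_flat:
  assumes "w \<in> basis_words L" "distinct L" "0 \<notin> set L"
  shows "flat w \<in> lists (pairs (set L))" and "wt0 (flat w)"
proof -
  have "flat w \<in> lists (pairs (set L)) \<and> wt0 (flat w)"
    using assms
  proof (induction L arbitrary: w rule: basis_words.induct)
    case (2 n xs)
    show ?case
    proof (cases "w \<in> basis_words xs")
      case True
      then have "flat w \<in> lists (pairs (set xs)) \<and> wt0 (flat w)"
        using 2 by auto
      then show ?thesis using lists_mono[OF pairs_mono[of "set xs" "set (n # xs)"]] by auto
    next
      case False
      then obtain a b v where v: "a \<in> set xs" "b \<in> insert 0 (set xs) - {a}"
        "v \<in> basis_words (remove1 a xs)" "w = (a, n, b) # v"
        using 2 by auto
      then have "flat v \<in> lists (pairs (set (remove1 a xs))) \<and> wt0 (flat v)"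
        using 2 by auto
      moreover have "set (remove1 a xs) \<subseteq> set (n # xs)"
        using set_remove1_subset by fastforce
      ultimately have "flat v \<in> lists (pairs (set (n # xs)))" "wt0 (flat v)"
        using lists_mono[OF pairs_mono[of "set (remove1 a xs)" "set (n # xs)"]] by blast+
      then show ?thesis using v 2 by (auto simp: pairs_def)
    qed
  qed auto
  then show "flat w \<in> lists (pairs (set L))" and "wt0 (flat w)" by blast+
qed

definition wspan :: "nat list \<Rightarrow> ((nat \<times> nat) list \<Rightarrow> bool) \<Rightarrow> 'k::field gpoly set" where
  "wspan L Q = mpol.span ((\<lambda>w. zlist (flat w)) ` {w \<in> basis_words L. Q (flat w)})"

lemma wspan_subspace: "mpol.subspace (wspan L Q)"
  by (simp add: wspan_def)

lemma wspan_mono: "(\<And>xs. Q xs \<Longrightarrow> Q' xs) \<Longrightarrow> wspan L Q \<subseteq> wspan L Q'"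
  unfolding wspan_def by (rule mpol.span_mono) auto

lemma wspan_expand:
  "f \<in> wspan L Q \<Longrightarrow> \<exists>b. f = (\<Sum>w\<in>{w \<in> basis_words L. Q (flat w)}. mconst (b w) * zlist (flat w))"
  unfolding wspan_def by (subst (asm) span_image_eq) auto

lemma wspan_zspan:
  assumes "distinct L" "set L = {1..m}"
  shows "wspan L Q \<subseteq> zspan m (\<lambda>xs. Q xs \<and> wt0 xs)"
  unfolding wspan_def
proof (rule mpol.span_minimal[OF _ zspan_subspace], rule image_subsetI)
  fix w assume w: "w \<in> {w \<in> basis_words L. Q (flat w)}"
  have "0 \<notin> set L" using assms(2) by simp
  from basis_words_flat[OF _ assms(1) this, of w] w
  show "zlist (flat w) \<in> zspan m (\<lambda>xs. Q xs \<and> wt0 xs)"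
    unfolding assms(2) by (intro zspan_base) auto
qed

lemma red_decompose:
  assumes "f \<in> red m (\<lambda>ys. ys \<in> flat ` basis_words L \<and> Q ys)"
  obtains a where "a \<in> wspan L Q" "f - a \<in> idealJ m"
proof -
  have "zlist ` {ys. ys \<in> flat ` basis_words L \<and> Q ys}
      = (\<lambda>w. zlist (flat w) :: 'a gpoly) ` {w \<in> basis_words L. Q (flat w)}"
    by auto
  then have "f \<in> mpol.span ((\<lambda>w. zlist (flat w)) ` {w \<in> basis_words L. Q (flat w)} \<union> idealJ m)"
    using assms by (simp only: red_def Collect_mem_eq)
  then obtain a j where "a \<in> wspan L Q" and j: "j \<in> mpol.span (idealJ m)" and "f = a + j"
    unfolding wspan_def mpol.span_Un by blast
  moreover have "j \<in> idealJ m"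
    using j mpol.span_minimal[OF order_refl idealJ_subspace] by blast
  ultimately show ?thesis using that by simp
qed

lemma ucount_le_length: "ucount xs \<le> length xs"
  by (simp add: ucount_def)

text \<open>By induction on the degree: straightening changes a word by an element of the ideal,
  which has the values of shorter words.\<close>

lemma value_expansion:
  fixes f :: "'k::field_char_0 gpoly"
  assumes L: "distinct L" "set L = {1..m}"
    and f: "f \<in> zspan m (\<lambda>xs. (length xs < d \<or> length xs = d \<and> c \<le> ucount xs) \<and> wt0 xs)"
  shows "\<exists>g\<in>wspan L (\<lambda>xs. length xs < d \<or> length xs = d \<and> c \<le> ucount xs).
    \<forall>r. inj_on r {1..m} \<longrightarrow> Ev r f = Ev r g"
  using f
proof (induction d arbitrary: c f rule: less_induct)
  case (less d)
  let ?W = "wspan L (\<lambda>xs. length xs < d \<or> length xs = d \<and> c \<le> ucount xs) :: 'k gpoly set"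
  let ?V = "{f. \<exists>g\<in>?W. \<forall>r. inj_on r {1..m} \<longrightarrow> Ev r f = Ev r g}"
  have V: "mpol.subspace ?V"
    unfolding mpol.subspace_def
  proof (intro conjI ballI allI)
    show "0 \<in> ?V" by (auto intro!: bexI[of _ 0] mpol.subspace_0 wspan_subspace)
  next
    fix f g assume "f \<in> ?V" "g \<in> ?V"
    then obtain f' g' where h: "f' \<in> ?W" "\<And>r. inj_on r {1..m} \<Longrightarrow> Ev r f = Ev r f'"
      "g' \<in> ?W" "\<And>r. inj_on r {1..m} \<Longrightarrow> Ev r g = Ev r g'" by blast
    show "f + g \<in> ?V"
      by (rule CollectI, rule bexI[OF _ mpol.subspace_add[OF wspan_subspace h(1) h(3)]])
        (simp add: h(2,4))
  next
    fix a g assume "g \<in> ?V"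
    then obtain g' where h: "g' \<in> ?W" "\<And>r. inj_on r {1..m} \<Longrightarrow> Ev r g = Ev r g'" by blast
    show "mconst a * g \<in> ?V"
      by (rule CollectI, rule bexI[OF _ mpol.subspace_scale[OF wspan_subspace h(1), of a]])
        (simp add: h(2))
  qed
  have "zlist xs \<in> ?V"
    if xs: "xs \<in> lists (pairs {1..m})" "(length xs < d \<or> length xs = d \<and> c \<le> ucount xs) \<and> wt0 xs" for xs
  proof -
    let ?e = "length xs"
    obtain a where a: "a \<in> wspan L (\<lambda>ys. length ys = ?e \<and> ucount xs \<le> ucount ys)"
      and aJ: "(zlist xs - a :: 'k gpoly) \<in> idealJ m"
      using red_decompose[OF weight_zero_straightening[of L m xs]] L xs by auto
    let ?hom = "zspan m (\<lambda>ys. length ys = ?e \<and> wt0 ys) :: 'k gpoly set"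
    have "a \<in> ?hom"
      using a wspan_zspan[OF L] zspan_mono[of "\<lambda>ys. (length ys = ?e \<and> ucount xs \<le> ucount ys) \<and> wt0 ys"
          "\<lambda>ys. length ys = ?e \<and> wt0 ys" m] by blast
    moreover have "zlist xs \<in> ?hom" using xs by (intro zspan_base) auto
    ultimately have "zlist xs - a \<in> ?hom" by (rule mpol.subspace_diff[OF zspan_subspace, rotated])
    \<comment> \<open>\<open>Suc ?e\<close> exceeds the number of u's of any word of length
      \<open>?e\<close>, so only the alternative of shorter words survives.\<close>
    with aJ obtain g where g: "g \<in> zspan m (\<lambda>ys. (length ys < ?e \<or> length ys = ?e \<and> Suc ?e \<le> ucount ys) \<and> wt0 ys)"
      and gv: "\<And>r. inj_on r {1..m} \<Longrightarrow> Ev r (zlist xs - a) = Ev r g"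
      using leading_value idealJ_filt by blast
    have g_low: "g \<in> zspan m (\<lambda>ys. length ys < ?e \<and> wt0 ys)"
      by (rule subsetD[OF zspan_mono g]) (auto dest: order_trans[OF _ ucount_le_length])
    have "\<exists>g'\<in>wspan L (\<lambda>ys. length ys < ?e). \<forall>r. inj_on r {1..m} \<longrightarrow> Ev r g = Ev r g'"
    proof (cases ?e)
      case 0
      then have "zspan m (\<lambda>ys. length ys < ?e \<and> wt0 ys) = {0 :: 'k gpoly}"
        by (simp add: zspan_def)
      then show ?thesis using g_low by (intro bexI[of _ 0] mpol.subspace_0 wspan_subspace) auto
    next
      case (Suc e')
      then have "e' < d" using xs by auto
      moreover have "g \<in> zspan m (\<lambda>ys. (length ys < e' \<or> length ys = e' \<and> 0 \<le> ucount ys) \<and> wt0 ys)"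
        by (rule subsetD[OF zspan_mono g_low]) (auto simp: Suc)
      ultimately obtain g' where "g' \<in> wspan L (\<lambda>ys. length ys < e' \<or> length ys = e' \<and> 0 \<le> ucount ys)"
        "\<forall>r. inj_on r {1..m} \<longrightarrow> Ev r g = Ev r g'"
        using less.IH by blast
      moreover have "wspan L (\<lambda>ys. length ys < e' \<or> length ys = e' \<and> 0 \<le> ucount ys)
          \<subseteq> (wspan L (\<lambda>ys. length ys < ?e) :: 'k gpoly set)"
        by (rule wspan_mono) (auto simp: Suc)
      ultimately show ?thesis by blast
    qed
    then obtain g' where g': "g' \<in> wspan L (\<lambda>ys. length ys < ?e)"
      "\<And>r. inj_on r {1..m} \<Longrightarrow> Ev r g = Ev r g'" by blast
    have "a \<in> ?W"
      by (rule subsetD[OF wspan_mono a]) (use xs in auto)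
    moreover have "g' \<in> ?W"
      by (rule subsetD[OF wspan_mono g'(1)]) (use xs in auto)
    ultimately have "a + g' \<in> ?W" by (rule mpol.subspace_add[OF wspan_subspace])
    moreover have "Ev r (zlist xs) = Ev r (a + g')" if "inj_on r {1..m}" for r
      using gv[OF that] g'(2)[OF that] by (simp add: algebra_simps)
    ultimately show ?thesis by blast
  qed
  with V have "zspan m (\<lambda>xs. (length xs < d \<or> length xs = d \<and> c \<le> ucount xs) \<and> wt0 xs) \<subseteq> ?V"
    by (rule zspan_minimal)
  then show ?case using less.prems by blast
qed

section \<open>Independence of the basis functions\<close>

text \<open>As \<open>t\<close> decreases past the value at \<open>a\<close>, exactly the term
  \<open>F a\<close> is added. Above all values only \<open>F0\<close> is present, and then the
  terms vanish one after another in decreasing order of \<open>r\<close>.\<close>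

lemma threshold_independent:
  fixes F :: "'a \<Rightarrow> 'k::ab_group_add" and r :: "'a \<Rightarrow> real"
  assumes A: "finite A" "inj_on r A"
    and zero: "\<And>t. t \<notin> r ` A \<Longrightarrow> F0 + (\<Sum>a\<in>A. if t < r a then F a else 0) = 0"
  shows "F0 = 0" and "a \<in> A \<Longrightarrow> F a = 0"
proof -
  \<comment> \<open>A threshold just under \<open>x\<close> that separates it from all smaller
    values; inserting \<open>x - 1\<close> keeps the set under the maximum nonempty.\<close>
  have below: "\<exists>t. t \<notin> r ` A \<and> t < x \<and> (\<forall>a\<in>A. r a < x \<longrightarrow> r a < t)" for x
  proof -
    define y where "y = Max (insert (x - 1) (r ` {a \<in> A. r a < x}))"
    have fin: "finite (insert (x - 1) (r ` {a \<in> A. r a < x}))" using A by simp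
    have "y \<in> insert (x - 1) (r ` {a \<in> A. r a < x})"
      unfolding y_def using fin by (intro Max_in) auto
    then have "y < x" by auto
    then obtain t where t: "y < t" "t < x" using dense by blast
    have "r a < t" if "a \<in> A" "r a < x" for a
    proof -
      have "r a \<le> y" unfolding y_def using that fin by (intro Max_ge) auto
      then show ?thesis using t by simp
    qed
    then show ?thesis using t by (intro exI[of _ t]) auto
  qed
  obtain t where t: "\<forall>a\<in>A. r a < t"
  proof
    show "\<forall>a\<in>A. r a < Max (insert 0 (r ` A)) + 1"
      using A by (auto simp: less_le_trans[OF _ add_right_mono[OF Max_ge]] intro!: le_less_trans[OF Max_ge less_add_one])
  qed
  then have "(\<Sum>a\<in>A. if t < r a then F a else 0) = 0"
    by (intro sum.neutral) auto
  with t zero[of t] show F0: "F0 = 0" by auto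
  show "F a = 0" if "a \<in> A"
    using that
  proof (induction "card {b \<in> A. r a < r b}" arbitrary: a rule: less_induct)
    case less
    obtain t where t: "t \<notin> r ` A" "t < r a" "\<And>b. b \<in> A \<Longrightarrow> r b < r a \<Longrightarrow> r b < t"
      using below[of "r a"] by blast
    have "F b = 0" if b: "b \<in> A" "b \<noteq> a" "t < r b" for b
    proof (rule less.hyps)
      have "r a < r b"
        using b t(3)[of b] A(2) less.prems by (metis inj_on_contraD linorder_neqE not_less_iff_gr_or_eq)
      then have "{c \<in> A. r b < r c} \<subset> {c \<in> A. r a < r c}" using b by auto
      then show "card {c \<in> A. r b < r c} < card {c \<in> A. r a < r c}"
        using A by (intro psubset_card_mono) auto
    qed (use b in auto)
    then have "(\<Sum>b\<in>A. if t < r b then F b else 0) = (\<Sum>b\<in>A. if b = a then F a else 0)"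
      using t(2) by (intro sum.cong) auto
    then show ?case using zero[OF t(1)] F0 A less.prems by simp
  qed
qed

lemma basis_words_head: "(a, n, b) # w \<in> basis_words T \<Longrightarrow> n \<in> set T"
  by (induction T) auto

text \<open>The pieces in the recursion for \<open>basis_words\<close> are disjoint: the first
  letter of a word for \<open>T\<close> has its middle entry in \<open>T\<close>, hence different
  from \<open>n\<close>.\<close>

lemma sum_basis_words:
  assumes "distinct (n # T)"
  shows "sum f (basis_words (n # T)) = sum f (basis_words T)
    + (\<Sum>a\<in>set T. \<Sum>b\<in>insert 0 (set T) - {a}. \<Sum>w\<in>basis_words (remove1 a T). f ((a, n, b) # w))"
proof -
  let ?I = "SIGMA a:set T. SIGMA b:insert 0 (set T) - {a}. basis_words (remove1 a T)"
  let ?h = "\<lambda>(a, b, w). (a, n, b) # w"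
  have eq: "basis_words (n # T) = basis_words T \<union> ?h ` ?I"
    by (force simp: image_iff)
  have disj: "basis_words T \<inter> ?h ` ?I = {}"
    using assms basis_words_head by auto
  have inj: "inj_on ?h ?I" by (auto simp: inj_on_def)
  have fin: "finite ?I" by auto
  have "sum f (?h ` ?I) = (\<Sum>(a, b, w)\<in>?I. f ((a, n, b) # w))"
    by (subst sum.reindex[OF inj]) (auto intro!: sum.cong)
  also have "\<dots> = (\<Sum>a\<in>set T. \<Sum>b\<in>insert 0 (set T) - {a}. \<Sum>w\<in>basis_words (remove1 a T). f ((a, n, b) # w))"
    by (subst sum.Sigma[symmetric]; (auto simp: case_prod_unfold)?)
       (simp add: sum.cartesian_product case_prod_unfold)
  finally show ?thesis
    unfolding eq using fin disj by (subst sum.union_disjoint) auto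
qed

definition word_val :: "(nat \<Rightarrow> real) \<Rightarrow> (nat \<times> nat \<times> nat) list \<Rightarrow> 'k::field" where
  "word_val r w = theta_val r (flat w)"

lemma word_val_simps [simp]:
  "word_val r [] = 1"
  "word_val r ((a, n, b) # w) = theta r a n * theta r a b * word_val r w"
  by (simp_all add: word_val_def mult.assoc)

lemma theta_val_agree:
  assumes "xs \<in> lists (pairs S)" "\<And>i. i \<in> S \<Longrightarrow> r i = r' i"
  shows "theta_val r xs = (theta_val r' xs :: 'k::field)"
  using assms(1)
proof (induction xs)
  case (Cons p xs)
  then have "theta r (fst p) (snd p) = (theta r' (fst p) (snd p) :: 'k)"
    using assms(2) by (auto simp: theta_def pairs_def)
  then show ?case using Cons by simp
qed simp

lemma word_val_agree:
  assumes "w \<in> basis_words L" "distinct L" "0 \<notin> set L" "\<And>i. i \<in> set L \<Longrightarrow> r i = r' i"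
  shows "word_val r w = word_val r' w"
  unfolding word_val_def using basis_words_flat(1)[OF assms(1-3)] assms(4) by (rule theta_val_agree)

text \<open>Two threshold arguments for each letter. First only the value at \<open>n\<close> moves:
  the part \<open>F0\<close> of words for \<open>T\<close> and the coefficients \<open>F\<close> of
  theta r a n do not depend on it, so they vanish separately. Then in \<open>F\<close> only the
  value at \<open>a\<close> moves: the coefficients \<open>G\<close> of theta r a b do not depend on
  it, and b = 0 is the constant term.\<close>

lemma word_val_independent:
  fixes c :: "(nat \<times> nat \<times> nat) list \<Rightarrow> 'k::field"
  assumes "distinct L" "0 \<notin> set L"
    and "\<And>r. inj_on r (set L) \<Longrightarrow> (\<Sum>w\<in>basis_words L. c w * word_val r w) = 0"
    and "w \<in> basis_words L"
  shows "c w = 0"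
  using assms
proof (induction "length L" arbitrary: L c w rule: less_induct)
  case less
  show ?case
  proof (cases L)
    case Nil
    then show ?thesis using less.prems(3)[of "\<lambda>_. 0"] less.prems(4) by simp
  next
    case (Cons n T)
    have nT: "distinct (n # T)" "n \<notin> set T" "distinct T" "0 \<notin> set T" "n \<noteq> 0"
      using less.prems Cons by auto
    define G where "G r a b = (\<Sum>w\<in>basis_words (remove1 a T). c ((a, n, b) # w) * word_val r w)" for r a b
    define F0 where "F0 r = (\<Sum>w\<in>basis_words T. c w * word_val r w)" for r
    define F where "F r a = (\<Sum>b\<in>insert 0 (set T) - {a}. theta r a b * G r a b)" for r a
    have G_agree: "G r a b = G r' a b" if "\<And>i. i \<in> set T \<Longrightarrow> i \<noteq> a \<Longrightarrow> r i = r' i" for r r' a b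
      unfolding G_def using that nT set_remove1_subset[of a T]
      by (intro sum.cong refl arg_cong2[where f = "(*)"] word_val_agree[where L = "remove1 a T"]) auto
    have F0_agree: "F0 r = F0 r'" if "\<And>i. i \<in> set T \<Longrightarrow> r i = r' i" for r r'
      unfolding F0_def using that nT
      by (intro sum.cong refl arg_cong2[where f = "(*)"] word_val_agree[where L = T]) auto
    have F_agree: "F r a = F r' a" if "\<And>i. i \<in> set T \<Longrightarrow> r i = r' i" "a \<in> set T" for r r' a
      unfolding F_def
    proof (intro sum.cong refl)
      fix b assume "b \<in> insert 0 (set T) - {a}"
      then show "theta r a b * G r a b = theta r' a b * G r' a b"
        using G_agree[of a r r' b] that by (auto simp: theta_def)
    qed
    have expand: "(\<Sum>w\<in>basis_words L. c w * word_val r w) = F0 r + (\<Sum>a\<in>set T. theta r a n * F r a)" for r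
      unfolding Cons sum_basis_words[OF nT(1)] F0_def F_def G_def
      by (simp add: sum_distrib_left mult_ac)
    have zero: "F0 r = 0 \<and> (\<forall>a\<in>set T. F r a = 0)" if r: "inj_on r (set T)" for r
    proof -
      have "F0 r + (\<Sum>a\<in>set T. if t < r a then F r a else 0) = 0" if t: "t \<notin> r ` set T" for t
      proof -
        define r' where "r' = r(n := t)"
        have ag: "r' i = r i" if "i \<in> set T" for i using that nT by (auto simp: r'_def)
        have "inj_on r' (set L)"
          using r t nT unfolding Cons r'_def by (auto simp: inj_on_def)
        then have "F0 r' + (\<Sum>a\<in>set T. theta r' a n * F r' a) = 0"
          using less.prems(3) expand by metis
        moreover have "F0 r' = F0 r" using ag by (intro F0_agree) auto
        moreover have "(\<Sum>a\<in>set T. theta r' a n * F r' a) = (\<Sum>a\<in>set T. if t < r a then F r a else 0)"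
        proof (intro sum.cong refl)
          fix a assume a: "a \<in> set T"
          have "F r' a = F r a" using ag a by (intro F_agree) auto
          then show "theta r' a n * F r' a = (if t < r a then F r a else 0)"
            using a nT ag[OF a] by (auto simp: theta_def r'_def)
        qed
        ultimately show ?thesis by simp
      qed
      then show ?thesis using threshold_independent[OF finite_set r] by blast
    qed
    have Gzero: "G r a 0 = 0 \<and> (\<forall>b\<in>set (remove1 a T). G r a b = 0)"
      if a: "a \<in> set T" and r: "inj_on r (set (remove1 a T))" for r a
    proof -
      let ?T' = "set (remove1 a T)"
      have T': "?T' = set T - {a}" using nT by simp
      have a0: "a \<noteq> 0" using a nT by metis
      \<comment> \<open>In theta r a b the moving value is the larger one, in the threshold lemma it
        is the smaller one; negating all values repairs this.\<close>
      have inj': "inj_on (\<lambda>i. - r i) ?T'" using r by (auto simp: inj_on_def)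
      have "G r a 0 + (\<Sum>b\<in>?T'. if t < - r b then G r a b else 0) = 0"
        if t: "t \<notin> (\<lambda>i. - r i) ` ?T'" for t
      proof -
        define r' where "r' = r(a := - t)"
        have "r b \<noteq> - t" if "b \<in> set T - {a}" for b
        proof
          assume "r b = - t"
          then have "t = - r b" by simp
          then show False using t that T' by blast
        qed
        then have "inj_on r' (set T)"
          using r unfolding T' r'_def by (auto simp: inj_on_def dest: sym)
        then have "F r' a = 0" using zero a by blast
        moreover have "F r' a = (\<Sum>b\<in>insert 0 ?T'. theta r' a b * G r' a b)"
          unfolding F_def using a0 T' by (intro sum.cong) auto
        moreover have "\<dots> = theta r' a 0 * G r' a 0 + (\<Sum>b\<in>?T'. theta r' a b * G r' a b)"
          using nT T' by (subst sum.insert) auto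
        moreover have "G r' a b = G r a b" for b by (rule G_agree) (auto simp: r'_def)
        moreover have "(\<Sum>b\<in>?T'. theta r' a b * G r a b) = (\<Sum>b\<in>?T'. if t < - r b then G r a b else 0)"
          using nT T' by (intro sum.cong refl) (auto simp: theta_def r'_def)
        ultimately show ?thesis by (simp add: theta_def)
      qed
      then show ?thesis using threshold_independent[OF finite_set inj', where F = "G r a" and ?F0.0 = "G r a 0"] by blast
    qed
    show ?thesis
    proof (cases "w \<in> basis_words T")
      case True
      have len: "length T < length L" by (simp add: Cons)
      show ?thesis
        by (rule less.hyps[OF len nT(3,4) _ True]) (use zero F0_def in auto)
    next
      case False
      then obtain a b v where v: "a \<in> set T" "b \<in> insert 0 (set T) - {a}"
        "v \<in> basis_words (remove1 a T)" "w = (a, n, b) # v"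
        using less.prems(4) Cons by auto
      have len: "length (remove1 a T) < length L" using v(1) by (simp add: Cons length_remove1)
      have "c ((a, n, b) # v) = 0"
      proof (rule less.hyps[OF len _ _ _ v(3), where c = "\<lambda>v. c ((a, n, b) # v)"])
        show "distinct (remove1 a T)" "0 \<notin> set (remove1 a T)" using nT by auto
        fix r :: "nat \<Rightarrow> real" assume "inj_on r (set (remove1 a T))"
        then show "(\<Sum>v\<in>basis_words (remove1 a T). c ((a, n, b) # v) * word_val r v) = 0"
          using Gzero[OF v(1)] v(2) nT by (auto simp: G_def)
      qed
      then show ?thesis using v by simp
    qed
  qed
qed

text \<open>The coefficients of a function of \<open>r\<close> in the basis functions; meaningful on \<open>basis_words L\<close> only.\<close>

definition is_coef :: "nat list \<Rightarrow> ((nat \<Rightarrow> real) \<Rightarrow> 'k::field) \<Rightarrow> ((nat \<times> nat \<times> nat) list \<Rightarrow> 'k) \<Rightarrow> bool" where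
  "is_coef L F c \<longleftrightarrow> (\<forall>r. inj_on r (set L) \<longrightarrow> F r = (\<Sum>w\<in>basis_words L. c w * word_val r w))"

definition coef :: "nat list \<Rightarrow> ((nat \<Rightarrow> real) \<Rightarrow> 'k::field) \<Rightarrow> (nat \<times> nat \<times> nat) list \<Rightarrow> 'k" where
  "coef L F = (SOME c. is_coef L F c)"

lemma is_coef_unique:
  assumes L: "distinct L" "0 \<notin> set L" and "is_coef L F c" "is_coef L F c'" "w \<in> basis_words L"
  shows "c w = c' w"
proof -
  have "c w - c' w = 0"
    using assms by (intro word_val_independent[OF L, where c = "\<lambda>w. c w - c' w"])
      (auto simp: is_coef_def algebra_simps sum_subtractf)
  then show ?thesis by simp
qed

lemma is_coef_coef: "is_coef L F c \<Longrightarrow> is_coef L F (coef L F)"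
  unfolding coef_def by (rule someI[of "is_coef L F"])

lemma coef_eq:
  assumes "distinct L" "0 \<notin> set L" "is_coef L F c" "w \<in> basis_words L"
  shows "coef L F w = c w"
  using is_coef_unique[OF assms(1,2) is_coef_coef[OF assms(3)] assms(3,4)] .

section \<open>From functions back to the graded ring\<close>

lemma Ev_word_sum:
  assumes "distinct L" "0 \<notin> set L"
  shows "Ev r (\<Sum>w\<in>{w \<in> basis_words L. Q w}. mconst (b w) * zlist (flat w))
    = (\<Sum>w\<in>basis_words L. (if Q w then b w else 0) * word_val r w :: 'k::field_char_0)"
proof -
  have "Ev r (\<Sum>w\<in>{w \<in> basis_words L. Q w}. mconst (b w) * zlist (flat w))
      = (\<Sum>w\<in>{w \<in> basis_words L. Q w}. b w * word_val r w)"
    unfolding Ev_sum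
  proof (intro sum.cong refl)
    fix w assume "w \<in> {w \<in> basis_words L. Q w}"
    then have "flat w \<in> lists (pairs (set L))" using basis_words_flat(1)[of w L] assms by auto
    then show "Ev r (mconst (b w) * zlist (flat w)) = b w * word_val r w"
      by (simp add: Ev_zlist[OF _ assms(2)] word_val_def)
  qed
  also have "\<dots> = (\<Sum>w\<in>basis_words L. if Q w then b w * word_val r w else 0)"
    by (rule sum.inter_filter) simp
  finally show ?thesis by (simp add: if_distrib[of "\<lambda>x. x * _"] cong: if_cong)
qed

text \<open>Straightening expands the word in basis words of its own length, up to an element of the
  ideal, whose values are those of shorter words. Since the coefficients of a function are unique,
  those at words of length \<open>d\<close> are the straightening coefficients, which need not be
  computed. Words with more u's are collected in \<open>e\<close>.\<close>

lemma leading_coefficients: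
  assumes L: "distinct L" "set L = {1..m}" and xs: "xs \<in> lists (pairs {1..m})" "wt0 xs"
  defines "d \<equiv> length xs" and "c \<equiv> ucount xs"
  defines "C \<equiv> coef L (\<lambda>r. theta_val r xs :: 'k::field_char_0)"
  shows "\<exists>e\<in>wspan L (\<lambda>ys. length ys = d \<and> Suc c \<le> ucount ys).
    (zlist xs - (\<Sum>w\<in>{w \<in> basis_words L. length (flat w) = d \<and> ucount (flat w) = c}. mconst (C w) * zlist (flat w))
      - e :: 'k gpoly) \<in> idealJ m"
    and "is_coef L (\<lambda>r. theta_val r xs) C"
proof -
  have L0: "0 \<notin> set L" using L by simp
  obtain a where a: "a \<in> wspan L (\<lambda>ys. length ys = d \<and> c \<le> ucount ys)"
    and aJ: "(zlist xs - a :: 'k gpoly) \<in> idealJ m"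
    using red_decompose[OF weight_zero_straightening[of L m xs]] L xs unfolding d_def c_def by auto
  obtain b where b: "a = (\<Sum>w\<in>{w \<in> basis_words L. length (flat w) = d \<and> c \<le> ucount (flat w)}. mconst (b w) * zlist (flat w))"
    using wspan_expand[OF a] by blast
  let ?hom = "zspan m (\<lambda>ys. length ys = d \<and> wt0 ys) :: 'k gpoly set"
  have "a \<in> ?hom"
    using a wspan_zspan[OF L] zspan_mono[of "\<lambda>ys. (length ys = d \<and> c \<le> ucount ys) \<and> wt0 ys"
        "\<lambda>ys. length ys = d \<and> wt0 ys" m] by blast
  moreover have "zlist xs \<in> ?hom" using xs by (intro zspan_base) (auto simp: d_def)
  ultimately have "zlist xs - a \<in> ?hom" by (rule mpol.subspace_diff[OF zspan_subspace, rotated])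
  moreover have "zlist xs - a \<in> filt m (Suc d)" using aJ idealJ_filt by blast
  ultimately obtain g where g: "g \<in> zspan m (\<lambda>ys. (length ys < d \<or> length ys = d \<and> Suc d \<le> ucount ys) \<and> wt0 ys)"
    and gv: "\<And>r. inj_on r {1..m} \<Longrightarrow> Ev r (zlist xs - a) = Ev r g"
    using leading_value by blast
  obtain g' where g': "g' \<in> wspan L (\<lambda>ys. length ys < d \<or> length ys = d \<and> Suc d \<le> ucount ys)"
    and gv': "\<And>r. inj_on r {1..m} \<Longrightarrow> Ev r g = Ev r g'"
    using value_expansion[OF L g] by blast
  obtain b' where b': "g' = (\<Sum>w\<in>{w \<in> basis_words L. length (flat w) < d \<or> length (flat w) = d \<and> Suc d \<le> ucount (flat w)}.
      mconst (b' w) * zlist (flat w))"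
    using wspan_expand[OF g'] by blast
  \<comment> \<open>The supports of the two summands are disjoint because no word of length
    \<open>d\<close> has \<open>Suc d\<close> u's; so \<open>C'\<close> agrees with \<open>b\<close>
    on words of length \<open>d\<close> with at least \<open>c\<close> u's.\<close>
  define C' where "C' w = (if length (flat w) = d \<and> c \<le> ucount (flat w) then b w else 0)
     + (if length (flat w) < d \<or> length (flat w) = d \<and> Suc d \<le> ucount (flat w) then b' w else 0)" for w
  have isC': "is_coef L (\<lambda>r. theta_val r xs) C'"
    unfolding is_coef_def
  proof (intro allI impI)
    fix r :: "nat \<Rightarrow> real" assume "inj_on r (set L)"
    then have "Ev r (zlist xs) = Ev r a + Ev r g'"
      using gv[of r] gv'[of r] L by (simp add: algebra_simps)
    then show "theta_val r xs = (\<Sum>w\<in>basis_words L. C' w * word_val r w)"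
      unfolding b b' Ev_word_sum[OF L(1) L0] C'_def distrib_right sum.distrib
      by (simp add: Ev_zlist[OF xs(1)])
  qed
  then show isC: "is_coef L (\<lambda>r. theta_val r xs) C"
    unfolding C_def by (rule is_coef_coef)
  have CC': "C w = C' w" if "w \<in> basis_words L" for w
    using is_coef_unique[OF L(1) L0 isC isC' that] .
  define e where "e = (\<Sum>w\<in>{w \<in> basis_words L. length (flat w) = d \<and> Suc c \<le> ucount (flat w)}. mconst (b w) * (zlist (flat w) :: 'k gpoly))"
  have e_mem: "e \<in> wspan L (\<lambda>ys. length ys = d \<and> Suc c \<le> ucount ys)"
    unfolding e_def wspan_def by (auto intro!: mpol.span_sum mpol.span_scale intro: mpol.span_base)
  have a_eq: "a = (\<Sum>w\<in>{w \<in> basis_words L. length (flat w) = d \<and> ucount (flat w) = c}. mconst (C w) * zlist (flat w)) + e"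
  proof -
    have split: "{w \<in> basis_words L. length (flat w) = d \<and> c \<le> ucount (flat w)}
        = {w \<in> basis_words L. length (flat w) = d \<and> ucount (flat w) = c}
          \<union> {w \<in> basis_words L. length (flat w) = d \<and> Suc c \<le> ucount (flat w)}" by auto
    have "C w = b w" if "w \<in> {w \<in> basis_words L. length (flat w) = d \<and> ucount (flat w) = c}" for w
      using that CC'[of w] ucount_le_length[of "flat w"] by (auto simp: C'_def)
    then have "(\<Sum>w\<in>{w \<in> basis_words L. length (flat w) = d \<and> ucount (flat w) = c}. mconst (C w) * zlist (flat w))
      = (\<Sum>w\<in>{w \<in> basis_words L. length (flat w) = d \<and> ucount (flat w) = c}. mconst (b w) * (zlist (flat w) :: 'k gpoly))"
      by (intro sum.cong) auto
    then show ?thesis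
      unfolding b split e_def by (subst sum.union_disjoint) auto
  qed
  show "\<exists>e\<in>wspan L (\<lambda>ys. length ys = d \<and> Suc c \<le> ucount ys).
    (zlist xs - (\<Sum>w\<in>{w \<in> basis_words L. length (flat w) = d \<and> ucount (flat w) = c}. mconst (C w) * zlist (flat w))
      - e :: 'k gpoly) \<in> idealJ m"
    using aJ unfolding a_eq diff_diff_eq by (intro bexI[OF _ e_mem])
qed

text \<open>As a function, a combination in \<open>filt m (Suc c)\<close> has a second expansion, in
  words that are shorter or have more u's. The supports are disjoint, so uniqueness makes all
  coefficients vanish.\<close>

lemma graded_independent:
  fixes b :: "_ \<Rightarrow> 'k::field_char_0"
  assumes L: "distinct L" "set L = {1..m}"
    and f: "(\<Sum>w\<in>{w \<in> basis_words L. length (flat w) = d \<and> ucount (flat w) = c}. mconst (b w) * zlist (flat w)) \<in> filt m (Suc c)"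
      (is "?f \<in> _")
    and w: "w \<in> basis_words L" "length (flat w) = d" "ucount (flat w) = c"
  shows "b w = 0"
proof -
  have L0: "0 \<notin> set L" using L by simp
  have "?f \<in> wspan L (\<lambda>ys. length ys = d \<and> ucount ys = c)"
    unfolding wspan_def by (auto intro!: mpol.span_sum mpol.span_scale intro: mpol.span_base)
  then have "?f \<in> zspan m (\<lambda>ys. length ys = d \<and> wt0 ys)"
    using wspan_zspan[OF L] zspan_mono[of "\<lambda>ys. (length ys = d \<and> ucount ys = c) \<and> wt0 ys"
        "\<lambda>ys. length ys = d \<and> wt0 ys" m] by blast
  from leading_value[OF f this]
  obtain g where g: "g \<in> zspan m (\<lambda>ys. (length ys < d \<or> length ys = d \<and> Suc c \<le> ucount ys) \<and> wt0 ys)"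
    and gv: "\<And>r. inj_on r {1..m} \<Longrightarrow> Ev r ?f = Ev r g" by blast
  obtain g' where g': "g' \<in> wspan L (\<lambda>ys. length ys < d \<or> length ys = d \<and> Suc c \<le> ucount ys)"
    and gv': "\<And>r. inj_on r {1..m} \<Longrightarrow> Ev r g = Ev r g'"
    using value_expansion[OF L g] by blast
  obtain b' where b': "g' = (\<Sum>w\<in>{w \<in> basis_words L. length (flat w) < d \<or> length (flat w) = d \<and> Suc c \<le> ucount (flat w)}.
      mconst (b' w) * zlist (flat w))"
    using wspan_expand[OF g'] by blast
  let ?c1 = "\<lambda>w. if length (flat w) = d \<and> ucount (flat w) = c then b w else 0"
  let ?c2 = "\<lambda>w. if length (flat w) < d \<or> length (flat w) = d \<and> Suc c \<le> ucount (flat w) then b' w else 0"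
  have "?c1 w = ?c2 w"
  proof (rule is_coef_unique[OF L(1) L0 _ _ w(1)])
    show "is_coef L (\<lambda>r. Ev r ?f) ?c1"
      unfolding is_coef_def Ev_word_sum[OF L(1) L0] by simp
    show "is_coef L (\<lambda>r. Ev r ?f) ?c2"
      unfolding is_coef_def
    proof (intro allI impI)
      fix r :: "nat \<Rightarrow> real" assume "inj_on r (set L)"
      then have "Ev r ?f = Ev r g'" using gv gv' L by simp
      then show "Ev r ?f = (\<Sum>w\<in>basis_words L. ?c2 w * word_val r w)"
        unfolding b' Ev_word_sum[OF L(1) L0] .
    qed
  qed
  then show ?thesis using w by simp
qed

section \<open>Modules presented by polynomials\<close>

text \<open>Presents a space as the image of polynomials under a linear map, so that iterated cosets
  are handled only through their representatives.\<close>

definition lin_rep :: "('k::field, 'v, 'z) module_scheme \<Rightarrow> ('x, 'k) mpol set \<Rightarrow> (('x, 'k) mpol \<Rightarrow> 'v) \<Rightarrow> bool" where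
  "lin_rep M A \<psi> \<longleftrightarrow> mpol.subspace A \<and> carrier M = \<psi> ` A \<and> \<zero>\<^bsub>M\<^esub> = \<psi> 0 \<and>
     (\<forall>f\<in>A. \<forall>g\<in>A. \<psi> f \<oplus>\<^bsub>M\<^esub> \<psi> g = \<psi> (f + g)) \<and> (\<forall>c. \<forall>f\<in>A. c \<odot>\<^bsub>M\<^esub> \<psi> f = \<psi> (mconst c * f))"

lemma mconst_diff: "mconst (a - b) = mconst a - mconst b"
  by (simp add: mconst_def single_diff)

lemma lin_repD:
  assumes "lin_rep M A \<psi>"
  shows "mpol.subspace A" "carrier M = \<psi> ` A" "\<zero>\<^bsub>M\<^esub> = \<psi> 0"
    "f \<in> A \<Longrightarrow> g \<in> A \<Longrightarrow> \<psi> f \<oplus>\<^bsub>M\<^esub> \<psi> g = \<psi> (f + g)" "f \<in> A \<Longrightarrow> c \<odot>\<^bsub>M\<^esub> \<psi> f = \<psi> (mconst c * f)"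
  using assms by (auto simp: lin_rep_def)

lemma subspaceD:
  assumes "mpol.subspace A"
  shows "0 \<in> A" "f \<in> A \<Longrightarrow> g \<in> A \<Longrightarrow> f + g \<in> A" "f \<in> A \<Longrightarrow> mconst c * f \<in> A"
    "f \<in> A \<Longrightarrow> - f \<in> A" "f \<in> A \<Longrightarrow> g \<in> A \<Longrightarrow> f - g \<in> A"
    "(\<And>x. x \<in> X \<Longrightarrow> p x \<in> A) \<Longrightarrow> sum p X \<in> A"
  using assms by (simp_all add: mpol.subspace_0 mpol.subspace_add mpol.subspace_scale mpol.subspace_neg
      mpol.subspace_diff mpol.subspace_sum)

lemma lin_rep_abelian_group:
  assumes "lin_rep M A \<psi>" shows "abelian_group M"
proof -
  note d = lin_repD[OF assms] and s = subspaceD[OF lin_repD(1)[OF assms]]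
  show ?thesis
  proof (rule abelian_groupI)
    fix x assume "x \<in> carrier M"
    then obtain f where f: "f \<in> A" "x = \<psi> f" using d(2) by auto
    then have "\<psi> (- f) \<oplus>\<^bsub>M\<^esub> x = \<zero>\<^bsub>M\<^esub>" using d(4)[of "- f" f] s(4) d(3) by simp
    then show "\<exists>y\<in>carrier M. y \<oplus>\<^bsub>M\<^esub> x = \<zero>\<^bsub>M\<^esub>"
      using f s(4) d(2) by blast
  next
    fix x y z assume "x \<in> carrier M" "y \<in> carrier M" "z \<in> carrier M"
    then obtain f g h where "f \<in> A" "x = \<psi> f" "g \<in> A" "y = \<psi> g" "h \<in> A" "z = \<psi> h"
      using d(2) by auto
    then show "(x \<oplus>\<^bsub>M\<^esub> y) \<oplus>\<^bsub>M\<^esub> z = x \<oplus>\<^bsub>M\<^esub> (y \<oplus>\<^bsub>M\<^esub> z)"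
      using s(2) d(4) by (simp add: add.assoc)
  next
    fix x y assume "x \<in> carrier M" "y \<in> carrier M"
    then obtain f g where "f \<in> A" "x = \<psi> f" "g \<in> A" "y = \<psi> g"
      using d(2) by auto
    then show "x \<oplus>\<^bsub>M\<^esub> y = y \<oplus>\<^bsub>M\<^esub> x" "x \<oplus>\<^bsub>M\<^esub> y \<in> carrier M"
      using s(2) d(2,4) by (simp_all add: add.commute)
  next
    fix x assume "x \<in> carrier M"
    then obtain f where "f \<in> A" "x = \<psi> f" using d(2) by auto
    then show "\<zero>\<^bsub>M\<^esub> \<oplus>\<^bsub>M\<^esub> x = x" using s(1) d(3) d(4)[of 0 f] by simp
  next
    show "\<zero>\<^bsub>M\<^esub> \<in> carrier M" using d(2,3) s(1) by auto
  qed
qed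

lemma lin_rep_finsum:
  assumes "lin_rep M A \<psi>" "finite F" "\<And>i. i \<in> F \<Longrightarrow> p i \<in> A"
  shows "finsum M (\<lambda>i. \<psi> (p i)) F = \<psi> (sum p F)"
  using assms(2,3)
proof (induction F rule: finite_induct)
  case empty
  interpret abelian_group M by (rule lin_rep_abelian_group[OF assms(1)])
  show ?case using lin_repD(3)[OF assms(1)] by simp
next
  case (insert x F)
  interpret abelian_group M by (rule lin_rep_abelian_group[OF assms(1)])
  note d = lin_repD[OF assms(1)] and s = subspaceD[OF lin_repD(1)[OF assms(1)]]
  have "finsum M (\<lambda>i. \<psi> (p i)) (insert x F) = \<psi> (p x) \<oplus>\<^bsub>M\<^esub> finsum M (\<lambda>i. \<psi> (p i)) F"
    using insert d(2) by (intro finsum_insert) auto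
  also have "\<dots> = \<psi> (p x + sum p F)"
    using insert d(4) s(6)[of F p] by simp
  finally show ?case using insert by simp
qed

lemma lin_rep_finsum_scaled:
  assumes rep: "lin_rep M A \<psi>" and "finite F" "\<And>i. i \<in> F \<Longrightarrow> p i \<in> A" "\<And>i. i \<in> F \<Longrightarrow> h i = \<psi> (p i)"
  shows "finsum M (\<lambda>i. c i \<odot>\<^bsub>M\<^esub> h i) F = \<psi> (\<Sum>i\<in>F. mconst (c i) * p i)"
proof -
  interpret abelian_group M by (rule lin_rep_abelian_group[OF rep])
  note d = lin_repD[OF rep] and s = subspaceD[OF lin_repD(1)[OF rep]]
  have "finsum M (\<lambda>i. c i \<odot>\<^bsub>M\<^esub> h i) F = finsum M (\<lambda>i. \<psi> (mconst (c i) * p i)) F"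
    using assms(3,4) d s by (intro finsum_cong') auto
  also have "\<dots> = \<psi> (\<Sum>i\<in>F. mconst (c i) * p i)"
    using assms s by (intro lin_rep_finsum[OF rep]) auto
  finally show ?thesis .
qed

lemma lin_rep_restrict:
  assumes "lin_rep M A \<psi>" "mpol.subspace B" "B \<subseteq> A"
  shows "lin_rep (M\<lparr>carrier := \<psi> ` B\<rparr>) B \<psi>"
  using assms unfolding lin_rep_def by (auto simp: subset_iff)

lemma quot_module_simps:
  "carrier (quot_module M N) = a_rcosets\<^bsub>M\<^esub> N" "mult (quot_module M N) = rcoset_mult M N"
  "one (quot_module M N) = N +>\<^bsub>M\<^esub> \<one>\<^bsub>M\<^esub>" "zero (quot_module M N) = N" "add (quot_module M N) = set_add M"
  "smult (quot_module M N) = (\<lambda>c X. N <+>\<^bsub>M\<^esub> ((\<lambda>x. c \<odot>\<^bsub>M\<^esub> x) ` X))"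
  by (simp_all add: quot_module_def FactRing_def ring.defs module.defs)

lemma lin_rep_coset:
  assumes rep: "lin_rep M A \<psi>" and B: "B \<subseteq> A" and f: "f \<in> A"
  shows "\<psi> ` B +>\<^bsub>M\<^esub> \<psi> f = (\<lambda>h. \<psi> (h + f)) ` B"
  using lin_repD(4)[OF rep _ f] B unfolding a_r_coset_def' by (auto simp: image_iff) (metis subsetD)+

text \<open>A quotient is presented by the same polynomials; \<open>ker\<close> ensures that
  equality of cosets depends on \<open>B\<close> alone. Applied twice, this reaches the graded
  pieces.\<close>

lemma lin_rep_quot:
  assumes rep: "lin_rep M A \<psi>" and B: "mpol.subspace B" "B \<subseteq> A"
    and ker: "\<And>f. f \<in> A \<Longrightarrow> \<psi> f = \<zero>\<^bsub>M\<^esub> \<Longrightarrow> f \<in> B"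
  shows "lin_rep (quot_module M (\<psi> ` B)) A (\<lambda>f. \<psi> ` B +>\<^bsub>M\<^esub> \<psi> f)"
    and "f \<in> A \<Longrightarrow> g \<in> A \<Longrightarrow> \<psi> ` B +>\<^bsub>M\<^esub> \<psi> f = \<psi> ` B +>\<^bsub>M\<^esub> \<psi> g \<longleftrightarrow> f - g \<in> B"
proof -
  note d = lin_repD[OF rep] and s = subspaceD[OF d(1)] and sB = subspaceD[OF B(1)]
  note coset = lin_rep_coset[OF rep B(2)]
  have eqI: "(\<lambda>h. \<psi> (h + f)) ` B = (\<lambda>h. \<psi> (h + g)) ` B" if "f - g \<in> B" for f g
  proof -
    have sub: "(\<lambda>h. \<psi> (h + f)) ` B \<subseteq> (\<lambda>h. \<psi> (h + g)) ` B" if "f - g \<in> B" for f g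
    proof (rule image_subsetI)
      fix h assume "h \<in> B"
      then have "h + (f - g) \<in> B" using that sB(2) by blast
      moreover have "\<psi> (h + f) = \<psi> (h + (f - g) + g)" by simp
      ultimately show "\<psi> (h + f) \<in> (\<lambda>h. \<psi> (h + g)) ` B" by blast
    qed
    have "g - f \<in> B" using sB(4)[OF that] by simp
    then show ?thesis using sub[of f g] sub[of g f] that by blast
  qed
  show "\<psi> ` B +>\<^bsub>M\<^esub> \<psi> f = \<psi> ` B +>\<^bsub>M\<^esub> \<psi> g \<longleftrightarrow> f - g \<in> B" if f: "f \<in> A" and g: "g \<in> A"
  proof
    assume "\<psi> ` B +>\<^bsub>M\<^esub> \<psi> f = \<psi> ` B +>\<^bsub>M\<^esub> \<psi> g"
    then have "\<psi> (0 + f) \<in> (\<lambda>h. \<psi> (h + g)) ` B"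
      unfolding coset[OF f] coset[OF g] using sB(1) by blast
    then obtain h where h: "h \<in> B" "\<psi> f = \<psi> (h + g)" by auto
    have hg: "h + g \<in> A" using h B g s(2) by blast
    have "\<psi> (f - (h + g)) = \<psi> f \<oplus>\<^bsub>M\<^esub> \<psi> (- (h + g))"
      using d(4)[OF f s(4)[OF hg]] by (simp only: diff_conv_add_uminus)
    also have "\<dots> = \<zero>\<^bsub>M\<^esub>"
      using d(4)[OF hg s(4)[OF hg]] d(3) h(2) by simp
    finally have "f - (h + g) \<in> B" using ker f hg s(5) by blast
    then have "(f - (h + g)) + h \<in> B" using h sB(2) by blast
    then show "f - g \<in> B" by (simp add: algebra_simps)
  next
    assume "f - g \<in> B"
    then show "\<psi> ` B +>\<^bsub>M\<^esub> \<psi> f = \<psi> ` B +>\<^bsub>M\<^esub> \<psi> g"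
      unfolding coset[OF f] coset[OF g] by (rule eqI)
  qed
  show "lin_rep (quot_module M (\<psi> ` B)) A (\<lambda>f. \<psi> ` B +>\<^bsub>M\<^esub> \<psi> f)"
    unfolding lin_rep_def quot_module_simps
  proof (intro conjI ballI allI)
    show "mpol.subspace A" by (rule d(1))
    show "a_rcosets\<^bsub>M\<^esub> (\<psi> ` B) = (\<lambda>f. \<psi> ` B +>\<^bsub>M\<^esub> \<psi> f) ` A"
      unfolding A_RCOSETS_def' d(2) by auto
    show "\<psi> ` B = \<psi> ` B +>\<^bsub>M\<^esub> \<psi> 0"
      by (simp add: coset[OF s(1)])
  next
    fix f g assume f: "f \<in> A" and g: "g \<in> A"
    have "(\<lambda>h. \<psi> (h + f)) ` B <+>\<^bsub>M\<^esub> (\<lambda>h. \<psi> (h + g)) ` B = (\<lambda>h. \<psi> (h + (f + g))) ` B"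
    proof
      show "(\<lambda>h. \<psi> (h + f)) ` B <+>\<^bsub>M\<^esub> (\<lambda>h. \<psi> (h + g)) ` B \<subseteq> (\<lambda>h. \<psi> (h + (f + g))) ` B"
      proof
        fix x assume "x \<in> (\<lambda>h. \<psi> (h + f)) ` B <+>\<^bsub>M\<^esub> (\<lambda>h. \<psi> (h + g)) ` B"
        then obtain h k where h: "h \<in> B" "k \<in> B" "x = \<psi> (h + f) \<oplus>\<^bsub>M\<^esub> \<psi> (k + g)"
          unfolding set_add_def' by auto
        then have "x = \<psi> ((h + k) + (f + g))"
          using d(4)[of "h + f" "k + g"] f g s(2) B(2) by (simp add: subset_iff add_ac)
        then show "x \<in> (\<lambda>h. \<psi> (h + (f + g))) ` B" using h sB(2) by blast
      qed
      show "(\<lambda>h. \<psi> (h + (f + g))) ` B \<subseteq> (\<lambda>h. \<psi> (h + f)) ` B <+>\<^bsub>M\<^esub> (\<lambda>h. \<psi> (h + g)) ` B"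
      proof (rule image_subsetI)
        fix h assume h: "h \<in> B"
        then have "\<psi> (h + (f + g)) = \<psi> (h + f) \<oplus>\<^bsub>M\<^esub> \<psi> (0 + g)"
          using d(4)[of "h + f" g] f g s(2) B(2) by (simp add: subset_iff add_ac)
        then show "\<psi> (h + (f + g)) \<in> (\<lambda>h. \<psi> (h + f)) ` B <+>\<^bsub>M\<^esub> (\<lambda>h. \<psi> (h + g)) ` B"
          unfolding set_add_def' using h sB(1) by blast
      qed
    qed
    then show "(\<psi> ` B +>\<^bsub>M\<^esub> \<psi> f) <+>\<^bsub>M\<^esub> (\<psi> ` B +>\<^bsub>M\<^esub> \<psi> g) = \<psi> ` B +>\<^bsub>M\<^esub> \<psi> (f + g)"
      using f g s(2) by (simp add: coset)
  next
    fix c f assume f: "f \<in> A"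
    have "\<psi> ` B <+>\<^bsub>M\<^esub> ((\<lambda>x. c \<odot>\<^bsub>M\<^esub> x) ` (\<lambda>h. \<psi> (h + f)) ` B) = (\<lambda>h. \<psi> (h + mconst c * f)) ` B"
    proof
      show "\<psi> ` B <+>\<^bsub>M\<^esub> ((\<lambda>x. c \<odot>\<^bsub>M\<^esub> x) ` (\<lambda>h. \<psi> (h + f)) ` B) \<subseteq> (\<lambda>h. \<psi> (h + mconst c * f)) ` B"
      proof
        fix x assume "x \<in> \<psi> ` B <+>\<^bsub>M\<^esub> ((\<lambda>x. c \<odot>\<^bsub>M\<^esub> x) ` (\<lambda>h. \<psi> (h + f)) ` B)"
        then obtain h k where h: "h \<in> B" "k \<in> B" "x = \<psi> h \<oplus>\<^bsub>M\<^esub> (c \<odot>\<^bsub>M\<^esub> \<psi> (k + f))"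
          unfolding set_add_def' by auto
        then have "x = \<psi> (h + mconst c * (k + f))"
          using d(4)[of h "mconst c * (k + f)"] d(5)[of "k + f" c] f s(2,3) B(2) by (simp add: subset_iff)
        then have "x = \<psi> ((h + mconst c * k) + mconst c * f)" by (simp add: distrib_left add_ac)
        then show "x \<in> (\<lambda>h. \<psi> (h + mconst c * f)) ` B" using h sB(2,3) by blast
      qed
      show "(\<lambda>h. \<psi> (h + mconst c * f)) ` B \<subseteq> \<psi> ` B <+>\<^bsub>M\<^esub> ((\<lambda>x. c \<odot>\<^bsub>M\<^esub> x) ` (\<lambda>h. \<psi> (h + f)) ` B)"
      proof (rule image_subsetI)
        fix h assume h: "h \<in> B"
        then have "\<psi> (h + mconst c * f) = \<psi> h \<oplus>\<^bsub>M\<^esub> (c \<odot>\<^bsub>M\<^esub> \<psi> (0 + f))"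
          using d(4)[of h "mconst c * f"] d(5)[of f c] f s(3) B(2) by (simp add: subset_iff)
        then show "\<psi> (h + mconst c * f) \<in> \<psi> ` B <+>\<^bsub>M\<^esub> ((\<lambda>x. c \<odot>\<^bsub>M\<^esub> x) ` (\<lambda>h. \<psi> (h + f)) ` B)"
          unfolding set_add_def' using h sB(1) by blast
      qed
    qed
    then show "\<psi> ` B <+>\<^bsub>M\<^esub> ((\<lambda>x. c \<odot>\<^bsub>M\<^esub> x) ` (\<psi> ` B +>\<^bsub>M\<^esub> \<psi> f)) = \<psi> ` B +>\<^bsub>M\<^esub> \<psi> (mconst c * f)"
      using f s(3) by (simp add: coset)
  qed
qed


section \<open>Traces\<close>

text \<open>\<open>p\<close> induces a basis of $B / (B \cap K)$ with coordinate functions \<open>\<gamma>\<close>.\<close>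

definition frame :: "('x, 'k::field) mpol set \<Rightarrow> ('x, 'k) mpol set \<Rightarrow> 'i set \<Rightarrow> ('i \<Rightarrow> ('x, 'k) mpol)
    \<Rightarrow> (('x, 'k) mpol \<Rightarrow> 'i \<Rightarrow> 'k) \<Rightarrow> bool" where
  "frame B K I p \<gamma> \<longleftrightarrow> finite I \<and> (\<forall>i\<in>I. p i \<in> B) \<and>
     (\<forall>f\<in>B. f - (\<Sum>i\<in>I. mconst (\<gamma> f i) * p i) \<in> K) \<and>
     (\<forall>c. (\<Sum>i\<in>I. mconst (c i) * p i) \<in> K \<longrightarrow> (\<forall>i\<in>I. c i = 0))"

definition lin_op :: "('x, 'k::field) mpol set \<Rightarrow> ('x, 'k) mpol set \<Rightarrow> (('x, 'k) mpol \<Rightarrow> ('x, 'k) mpol) \<Rightarrow> bool" where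
  "lin_op B K G \<longleftrightarrow> (\<forall>f g. G (f + g) = G f + G g) \<and> (\<forall>c f. G (mconst c * f) = mconst c * G f) \<and>
     (\<forall>f\<in>B. G f \<in> B) \<and> (\<forall>f\<in>B \<inter> K. G f \<in> K)"

lemma lin_op_sum:
  assumes "lin_op B K G" shows "G (\<Sum>i\<in>I. mconst (c i) * p i) = (\<Sum>i\<in>I. mconst (c i) * G (p i))"
proof -
  have add: "G (f + g) = G f + G g" and sc: "G (mconst c * f) = mconst c * G f" for f g c
    using assms by (auto simp: lin_op_def)
  have "G 0 = 0" using add[of 0 0] by simp
  then show ?thesis by (induction I rule: infinite_finite_induct) (auto simp: add sc)
qed

lemma lin_op_diff: "lin_op B K G \<Longrightarrow> G (f - g) = G f - G g"
  using lin_op_def[of B K G] by (metis add_diff_cancel_right' diff_add_cancel)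

lemma frame_unique:
  assumes K: "mpol.subspace K" and fr: "frame B K I p \<gamma>"
    and f: "f \<in> B" "f - (\<Sum>i\<in>I. mconst (c i) * p i) \<in> K" and i: "i \<in> I"
  shows "\<gamma> f i = c i"
proof -
  have "f - (\<Sum>i\<in>I. mconst (\<gamma> f i) * p i) \<in> K"
    using fr f unfolding frame_def by blast
  from mpol.subspace_diff[OF K f(2) this]
  have "(\<Sum>i\<in>I. mconst (\<gamma> f i) * p i) - (\<Sum>i\<in>I. mconst (c i) * p i) \<in> K"
    by simp
  then have "(\<Sum>i\<in>I. mconst (\<gamma> f i - c i) * p i) \<in> K"
    by (simp only: mconst_diff left_diff_distrib sum_subtractf)
  then show ?thesis using fr i unfolding frame_def by fastforce
qed

lemma frame_coord_cong:
  assumes K: "mpol.subspace K" and fr: "frame B K I p \<gamma>" and f: "f \<in> B" "g \<in> B" "f - g \<in> K" and i: "i \<in> I"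
  shows "\<gamma> f i = \<gamma> g i"
proof (rule frame_unique[OF K fr f(1) _ i])
  have "g - (\<Sum>i\<in>I. mconst (\<gamma> g i) * p i) \<in> K"
    using fr f unfolding frame_def by blast
  from mpol.subspace_add[OF K f(3) this]
  show "f - (\<Sum>i\<in>I. mconst (\<gamma> g i) * p i) \<in> K" by simp
qed

lemma frame_coord_sum:
  assumes K: "mpol.subspace K" and fr: "frame B K I p \<gamma>" and q: "\<And>j. j \<in> S \<Longrightarrow> q j \<in> B"
    and B: "mpol.subspace B" and i: "i \<in> I"
  shows "\<gamma> (\<Sum>j\<in>S. mconst (c j) * q j) i = (\<Sum>j\<in>S. c j * \<gamma> (q j) i)"
proof (rule frame_unique[OF K fr _ _ i])
  show "(\<Sum>j\<in>S. mconst (c j) * q j) \<in> B"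
    using q B by (intro mpol.subspace_sum mpol.subspace_scale)
  have "(\<Sum>j\<in>S. mconst (c j) * (q j - (\<Sum>i\<in>I. mconst (\<gamma> (q j) i) * p i))) \<in> K"
    using q fr K unfolding frame_def by (intro mpol.subspace_sum mpol.subspace_scale) auto
  also have "(\<Sum>j\<in>S. mconst (c j) * (q j - (\<Sum>i\<in>I. mconst (\<gamma> (q j) i) * p i)))
      = (\<Sum>j\<in>S. mconst (c j) * q j) - (\<Sum>j\<in>S. \<Sum>i\<in>I. mconst (c j * \<gamma> (q j) i) * p i)"
    by (simp only: right_diff_distrib sum_subtractf sum_distrib_left mconst_mult mult.assoc)
  also have "(\<Sum>j\<in>S. \<Sum>i\<in>I. mconst (c j * \<gamma> (q j) i) * p i) = (\<Sum>i\<in>I. mconst (\<Sum>j\<in>S. c j * \<gamma> (q j) i) * p i)"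
    by (subst sum.swap) (simp only: mconst_sum sum_distrib_right)
  finally show "(\<Sum>j\<in>S. mconst (c j) * q j) - (\<Sum>i\<in>I. mconst (\<Sum>j\<in>S. c j * \<gamma> (q j) i) * p i) \<in> K" .
qed

lemma frame_op_coord:
  assumes B: "mpol.subspace B" and K: "mpol.subspace K" and frp: "frame B K I p \<gamma>" and frq: "frame B K S q \<delta>"
    and G: "lin_op B K G" and f: "f \<in> B" and s: "s \<in> S"
  shows "\<delta> (G f) s = (\<Sum>i\<in>I. \<gamma> f i * \<delta> (G (p i)) s)"
proof -
  have p: "p i \<in> B" if "i \<in> I" for i using frp that unfolding frame_def by blast
  have GB: "G h \<in> B" if "h \<in> B" for h using G that unfolding lin_op_def by blast
  let ?e = "\<Sum>i\<in>I. mconst (\<gamma> f i) * p i"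
  have e: "?e \<in> B" using p B by (intro mpol.subspace_sum mpol.subspace_scale)
  have "f - ?e \<in> B \<inter> K" using frp f e B unfolding frame_def by (auto intro: mpol.subspace_diff)
  then have "G (f - ?e) \<in> K" using G unfolding lin_op_def by blast
  then have "\<delta> (G f) s = \<delta> (G ?e) s"
    using f e s by (intro frame_coord_cong[OF K frq]) (auto simp: lin_op_diff[OF G] intro: GB)
  also have "\<dots> = (\<Sum>i\<in>I. \<gamma> f i * \<delta> (G (p i)) s)"
    unfolding lin_op_sum[OF G] using p s by (intro frame_coord_sum[OF K frq _ B]) (auto intro: GB)
  finally show ?thesis .
qed

lemma lin_op_id: "lin_op B K (\<lambda>f. f)"
  by (auto simp: lin_op_def)

text \<open>The coordinates of \<open>G\<close> in one frame are expanded through the other, and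
  after exchanging the sums the same formula for the identity contracts them again.\<close>

lemma frame_trace:
  assumes B: "mpol.subspace B" and K: "mpol.subspace K" and frp: "frame B K I p \<gamma>" and frq: "frame B K S q \<delta>"
    and G: "lin_op B K G"
  shows "(\<Sum>s\<in>S. \<delta> (G (q s)) s) = (\<Sum>i\<in>I. \<gamma> (G (p i)) i)"
proof -
  have p: "p i \<in> B" if "i \<in> I" for i using frp that unfolding frame_def by blast
  have q: "q s \<in> B" if "s \<in> S" for s using frq that unfolding frame_def by blast
  have GB: "G h \<in> B" if "h \<in> B" for h using G that unfolding lin_op_def by blast
  have "(\<Sum>s\<in>S. \<delta> (G (q s)) s) = (\<Sum>s\<in>S. \<Sum>i\<in>I. \<gamma> (q s) i * \<delta> (G (p i)) s)"
    using q by (intro sum.cong refl frame_op_coord[OF B K frp frq G]) auto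
  also have "\<dots> = (\<Sum>i\<in>I. \<Sum>s\<in>S. \<delta> (G (p i)) s * \<gamma> (q s) i)"
    by (subst sum.swap) (simp add: mult.commute)
  also have "\<dots> = (\<Sum>i\<in>I. \<gamma> (G (p i)) i)"
    using p GB by (intro sum.cong refl frame_op_coord[OF B K frq frp lin_op_id, symmetric]) auto
  finally show ?thesis .
qed

lemma frame_trace_commute:
  assumes B: "mpol.subspace B" and K: "mpol.subspace K" and fr: "frame B K I p \<gamma>"
    and G: "lin_op B K G" and H: "lin_op B K H"
  shows "(\<Sum>i\<in>I. \<gamma> (G (H (p i))) i) = (\<Sum>i\<in>I. \<gamma> (H (G (p i))) i)"
proof -
  have p: "p i \<in> B" if "i \<in> I" for i using fr that unfolding frame_def by blast
  have GB: "G h \<in> B" "H h \<in> B" if "h \<in> B" for h using G H that unfolding lin_op_def by blast+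
  have "(\<Sum>i\<in>I. \<gamma> (G (H (p i))) i) = (\<Sum>i\<in>I. \<Sum>j\<in>I. \<gamma> (H (p i)) j * \<gamma> (G (p j)) i)"
    using p GB by (intro sum.cong refl frame_op_coord[OF B K fr fr G]) auto
  also have "\<dots> = (\<Sum>j\<in>I. \<Sum>i\<in>I. \<gamma> (G (p j)) i * \<gamma> (H (p i)) j)"
    by (subst sum.swap) (simp add: mult.commute)
  also have "\<dots> = (\<Sum>j\<in>I. \<gamma> (H (G (p j))) j)"
    using p GB by (intro sum.cong refl frame_op_coord[OF B K fr fr H, symmetric]) auto
  finally show ?thesis .
qed

text \<open>\<open>trace_on\<close> uses a basis given by choice. The frame shows that there is one,
  and the coordinates in the chosen basis make up a second frame, whose trace is the same.\<close>

lemma trace_on_frame: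
  assumes rep: "lin_rep M A \<psi>" and B: "mpol.subspace B" "B \<subseteq> A" and K: "mpol.subspace K"
    and ker: "\<And>f g. f \<in> A \<Longrightarrow> g \<in> A \<Longrightarrow> \<psi> f = \<psi> g \<longleftrightarrow> f - g \<in> K"
    and fr: "frame B K I p \<gamma>" and G: "lin_op B K G" and F: "\<And>f. f \<in> B \<Longrightarrow> F (\<psi> f) = \<psi> (G f)"
  shows "trace_on M (\<psi> ` B) F = (\<Sum>i\<in>I. \<gamma> (G (p i)) i)"
proof -
  have GB: "G h \<in> B" if "h \<in> B" for h using G that unfolding lin_op_def by blast
  have p: "p i \<in> B" if "i \<in> I" for i using fr that unfolding frame_def by blast
  have fin: "finite I" using fr unfolding frame_def by blast
  have indep: "\<forall>i\<in>I. c i = 0" if "(\<Sum>i\<in>I. mconst (c i) * p i) \<in> K" for c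
    using fr that unfolding frame_def by blast
  \<comment> \<open>A basis is a set of vectors, so different indices must have different classes; a
    coincidence would be a relation with coefficients 1 and -1.\<close>
  have inj: "inj_on (\<lambda>i. \<psi> (p i)) I"
  proof (rule inj_onI, rule ccontr)
    fix i j assume ij: "i \<in> I" "j \<in> I" "\<psi> (p i) = \<psi> (p j)" "i \<noteq> j"
    have "(\<Sum>k\<in>I. mconst ((if k = i then 1 else 0) - (if k = j then 1 else 0)) * p k)
        = (\<Sum>k\<in>I. (if k = i then p k else 0) - (if k = j then p k else 0))"
      using ij(4) by (intro sum.cong) (auto simp: mconst_minus)
    also have "\<dots> = p i - p j" using ij fin by (simp add: sum_subtractf)
    also have "p i - p j \<in> K" using ij p B ker by blast
    finally show False using indep[of "\<lambda>k. (if k = i then 1 else 0) - (if k = j then 1 else 0)"] ij by force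
  qed
  have "is_basis M (\<psi> ` B) ((\<lambda>i. \<psi> (p i)) ` I)"
    unfolding is_basis_def
  proof (intro conjI ballI)
    let ?T = "(\<lambda>i. \<psi> (p i)) ` I"
    let ?inv = "the_inv_into I (\<lambda>i. \<psi> (p i))"
    show "finite ?T" using fin by simp
    show "?T \<subseteq> \<psi> ` B" using p by auto
    fix x assume "x \<in> \<psi> ` B"
    then obtain f where f: "f \<in> B" "x = \<psi> f" by blast
    have fs: "finsum M (\<lambda>b. c b \<odot>\<^bsub>M\<^esub> b) ?T = \<psi> (\<Sum>i\<in>I. mconst (c (\<psi> (p i))) * p i)" for c
    proof -
      have "finsum M (\<lambda>b. c b \<odot>\<^bsub>M\<^esub> b) ?T = \<psi> (\<Sum>b\<in>?T. mconst (c b) * p (?inv b))"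
      proof (rule lin_rep_finsum_scaled[OF rep])
        show "finite ?T" using fin by simp
        fix b assume "b \<in> ?T"
        then obtain i where i: "i \<in> I" "b = \<psi> (p i)" by blast
        then have "?inv b = i" by (simp add: the_inv_into_f_f[OF inj])
        then show "p (?inv b) \<in> A" "b = \<psi> (p (?inv b))" using i p B by auto
      qed
      then show ?thesis by (simp add: sum.reindex[OF inj] the_inv_into_f_f[OF inj])
    qed
    have comb: "(\<Sum>i\<in>I. mconst (c i) * p i) \<in> A" for c
      using p B by (intro subsetD[OF B(2)] mpol.subspace_sum mpol.subspace_scale)
    have fA: "f \<in> A" using f B by blast
    show "\<exists>!c. c \<in> ?T \<rightarrow>\<^sub>E UNIV \<and> x = finsum M (\<lambda>b. c b \<odot>\<^bsub>M\<^esub> b) ?T"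
    proof (rule ex1I[of _ "restrict (\<lambda>b. \<gamma> f (?inv b)) ?T"], intro conjI)
      have eq: "(\<Sum>i\<in>I. mconst (restrict (\<lambda>b. \<gamma> f (?inv b)) ?T (\<psi> (p i))) * p i) = (\<Sum>i\<in>I. mconst (\<gamma> f i) * p i)"
        by (intro sum.cong refl) (simp add: the_inv_into_f_f[OF inj])
      have "f - (\<Sum>i\<in>I. mconst (\<gamma> f i) * p i) \<in> K"
        using fr f(1) by (simp add: frame_def)
      then have "\<psi> f = \<psi> (\<Sum>i\<in>I. mconst (\<gamma> f i) * p i)"
        using ker[OF fA comb] by simp
      then show "x = finsum M (\<lambda>b. restrict (\<lambda>b. \<gamma> f (?inv b)) ?T b \<odot>\<^bsub>M\<^esub> b) ?T"
        by (simp only: fs f(2) eq)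
    next
      fix c assume c: "c \<in> ?T \<rightarrow>\<^sub>E UNIV \<and> x = finsum M (\<lambda>b. c b \<odot>\<^bsub>M\<^esub> b) ?T"
      then have "\<psi> f = \<psi> (\<Sum>i\<in>I. mconst (c (\<psi> (p i))) * p i)"
        by (simp only: fs f(2))
      then have "f - (\<Sum>i\<in>I. mconst (c (\<psi> (p i))) * p i) \<in> K"
        using ker[OF fA comb] by simp
      then have "\<gamma> f i = c (\<psi> (p i))" if "i \<in> I" for i
        using frame_unique[OF K fr f(1), of "\<lambda>i. c (\<psi> (p i))"] that by blast
      then show "c = restrict (\<lambda>b. \<gamma> f (?inv b)) ?T"
        using c by (intro extensionalityI[of _ ?T]) (auto simp: PiE_def the_inv_into_f_f[OF inj])
    qed auto
  qed
  then have basis: "is_basis M (\<psi> ` B) (SOME S. is_basis M (\<psi> ` B) S)" (is "is_basis _ _ ?S")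
    by (rule someI)
  define S where "S = ?S"
  have S: "finite S" "S \<subseteq> \<psi> ` B"
    and S_ex: "\<And>x. x \<in> \<psi> ` B \<Longrightarrow> \<exists>!c. c \<in> S \<rightarrow>\<^sub>E UNIV \<and> x = finsum M (\<lambda>b. c b \<odot>\<^bsub>M\<^esub> b) S"
    using basis unfolding is_basis_def S_def by blast+
  have "\<forall>s\<in>S. \<exists>f. f \<in> B \<and> s = \<psi> f" using S by blast
  from bchoice[OF this] obtain q where q: "\<And>s. s \<in> S \<Longrightarrow> q s \<in> B" "\<And>s. s \<in> S \<Longrightarrow> s = \<psi> (q s)" by blast
  have fs: "finsum M (\<lambda>b. c b \<odot>\<^bsub>M\<^esub> b) S = \<psi> (\<Sum>s\<in>S. mconst (c s) * q s)" for c
    using q S B by (intro lin_rep_finsum_scaled[OF rep]) auto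
  have comb: "(\<Sum>s\<in>S. mconst (c s) * q s) \<in> A" for c
    using q B by (intro subsetD[OF B(2)] mpol.subspace_sum mpol.subspace_scale)
  have frq: "frame B K S q (\<lambda>f. coords M S (\<psi> f))"
    unfolding frame_def
  proof (intro conjI ballI allI impI)
    fix f assume f: "f \<in> B"
    have "\<psi> f = finsum M (\<lambda>b. coords M S (\<psi> f) b \<odot>\<^bsub>M\<^esub> b) S"
      using theI'[OF S_ex[of "\<psi> f"]] f unfolding coords_def by simp
    then have "\<psi> f = \<psi> (\<Sum>s\<in>S. mconst (coords M S (\<psi> f) s) * q s)"
      by (simp only: fs)
    then show "f - (\<Sum>s\<in>S. mconst (coords M S (\<psi> f) s) * q s) \<in> K"
      using ker[OF subsetD[OF B(2) f] comb] by simp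
  next
    fix c s assume c: "(\<Sum>s\<in>S. mconst (c s) * q s) \<in> K" and s: "s \<in> S"
    have z: "0 \<in> B" using mpol.subspace_0[OF B(1)] .
    have "\<psi> (\<Sum>s\<in>S. mconst (c s) * q s) = \<psi> 0"
      using ker[OF comb subsetD[OF B(2) z]] c by simp
    then have "\<psi> 0 = \<psi> (\<Sum>s\<in>S. mconst (c s) * q s)" by simp
    \<comment> \<open>Coordinate functions are extensional on \<open>S\<close>, so uniqueness
      applies to restricted coefficients only.\<close>
    then have "\<psi> 0 = finsum M (\<lambda>b. restrict c S b \<odot>\<^bsub>M\<^esub> b) S"
      unfolding fs by (simp cong: sum.cong)
    moreover have "\<psi> 0 = finsum M (\<lambda>b. restrict (\<lambda>_. 0) S b \<odot>\<^bsub>M\<^esub> b) S"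
      unfolding fs by (simp cong: sum.cong)
    moreover have "restrict c S \<in> S \<rightarrow>\<^sub>E UNIV" "restrict (\<lambda>_. 0) S \<in> S \<rightarrow>\<^sub>E UNIV" by auto
    ultimately have "restrict c S = restrict (\<lambda>_. 0) S"
      using the1_equality[OF S_ex[OF imageI[OF z]], of "restrict c S"]
        the1_equality[OF S_ex[OF imageI[OF z]], of "restrict (\<lambda>_. 0) S"] by simp
    then show "c s = 0" using s by (metis restrict_apply')
  qed (use S q in auto)
  have "trace_on M (\<psi> ` B) F = (\<Sum>s\<in>S. coords M S (\<psi> (G (q s))) s)"
    unfolding trace_on_def Let_def S_def[symmetric]
  proof (intro sum.cong refl)
    fix s assume "s \<in> S"
    then have "F s = \<psi> (G (q s))" using q F by metis
    then show "coords M S (F s) s = coords M S (\<psi> (G (q s))) s" by simp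
  qed
  also have "\<dots> = (\<Sum>i\<in>I. \<gamma> (G (p i)) i)"
    by (rule frame_trace[OF B(1) K fr frq G])
  finally show ?thesis .
qed

section \<open>The cohomology ring and its filtration\<close>

lemma Ycls_rep:
  shows lin_rep_Yring: "lin_rep (Yring m) (carrier (polyB m)) (Ycls m :: 'k::field gpoly \<Rightarrow> _)"
    and Ycls_eq_iff: "f \<in> carrier (polyB m) \<Longrightarrow> g \<in> carrier (polyB m) \<Longrightarrow>
      Ycls m f = Ycls m g \<longleftrightarrow> f - g \<in> (idealJ m :: 'k gpoly set)"
proof -
  have rep: "lin_rep (polyB m) (carrier (polyB m)) (\<lambda>f :: 'k gpoly. f)"
    by (auto simp: lin_rep_def polyB_subspace)
  have sub: "(idealJ m :: 'k gpoly set) \<subseteq> carrier (polyB m)"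
    using idealJ_subset by blast
  have Y: "Ycls m = (\<lambda>f :: 'k gpoly. (\<lambda>f. f) ` idealJ m +>\<^bsub>polyB m\<^esub> f)"
    by (auto simp: Ycls_def fun_eq_iff)
  show "lin_rep (Yring m) (carrier (polyB m)) (Ycls m :: 'k gpoly \<Rightarrow> _)"
    using lin_rep_quot(1)[OF rep idealJ_subspace sub] by (simp add: Yring_def Y)
  show "Ycls m f = Ycls m g \<longleftrightarrow> f - g \<in> (idealJ m :: 'k gpoly set)"
    if "f \<in> carrier (polyB m)" "g \<in> carrier (polyB m)"
    using lin_rep_quot(2)[OF rep idealJ_subspace sub _ that] unfolding Y by simp
qed

lemmas Yring_repD = lin_repD[OF lin_rep_Yring]

lemma Yring_mult:
  "f \<in> carrier (polyB m) \<Longrightarrow> g \<in> carrier (polyB m) \<Longrightarrow> Ycls m f \<otimes>\<^bsub>Yring m\<^esub> Ycls m g = Ycls m (f * g)"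
  using ideal.rcoset_mult_add[OF idealJ_ideal, of f m g]
  by (simp add: Yring_def quot_module_simps Ycls_def)

lemma Yring_one: "\<one>\<^bsub>Yring m\<^esub> = Ycls m 1"
  by (simp add: Yring_def quot_module_simps Ycls_def)

lemma ring_Yring: "ring (Yring m :: ('k::field, 'k gpoly set) module)"
proof (rule ringI)
  show "abelian_group (Yring m :: ('k, 'k gpoly set) module)"
    by (rule lin_rep_abelian_group[OF lin_rep_Yring])
  show "Group.monoid (Yring m :: ('k, 'k gpoly set) module)"
    by (rule monoidI) (auto simp: Yring_repD(2) Yring_mult Yring_one mult.assoc polyB_mult intro!: imageI)
  fix x y z :: "'k gpoly set"
  assume "x \<in> carrier (Yring m)" "y \<in> carrier (Yring m)" "z \<in> carrier (Yring m)"
  then obtain f g h where h: "f \<in> carrier (polyB m)" "g \<in> carrier (polyB m)" "h \<in> carrier (polyB m)"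
    "x = Ycls m f" "y = Ycls m g" "z = Ycls m h"
    unfolding Yring_repD(2) by blast
  then show "(x \<oplus>\<^bsub>Yring m\<^esub> y) \<otimes>\<^bsub>Yring m\<^esub> z = x \<otimes>\<^bsub>Yring m\<^esub> z \<oplus>\<^bsub>Yring m\<^esub> y \<otimes>\<^bsub>Yring m\<^esub> z"
    and "z \<otimes>\<^bsub>Yring m\<^esub> (x \<oplus>\<^bsub>Yring m\<^esub> y) = z \<otimes>\<^bsub>Yring m\<^esub> x \<oplus>\<^bsub>Yring m\<^esub> z \<otimes>\<^bsub>Yring m\<^esub> y"
    by (simp_all add: Yring_repD(4) Yring_mult polyB_mult polyB_add distrib_left distrib_right)
qed

text \<open>Together with the minimality of generated ideals, this bounds the ideal of the u's from
  above by classes of polynomials.\<close>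

lemma Ycls_image_ideal:
  fixes T :: "'k::field gpoly set"
  assumes T: "T \<subseteq> carrier (polyB m)" "mpol.subspace T"
    and mult: "\<And>p f. p \<in> carrier (polyB m) \<Longrightarrow> f \<in> T \<Longrightarrow> p * f \<in> T"
  shows "ideal (Ycls m ` T) (Yring m)"
proof (rule idealI[OF ring_Yring])
  note s = subspaceD[OF T(2)]
  have TP: "f \<in> carrier (polyB m)" if "f \<in> T" for f using T that by blast
  show "subgroup (Ycls m ` T) (add_monoid (Yring m))"
  proof (rule group.subgroupI)
    show grp: "Group.group (add_monoid (Yring m :: ('k, 'k gpoly set) module))"
      using abelian_group.a_group ring.is_abelian_group[OF ring_Yring] by blast
    show "Ycls m ` T \<subseteq> carrier (add_monoid (Yring m))"
      using T by (auto simp: Yring_repD(2))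
    show "Ycls m ` T \<noteq> {}" using s(1) by auto
    fix x y assume "x \<in> Ycls m ` T"
    then obtain f where f: "f \<in> T" "x = Ycls m f" by blast
    have "inv\<^bsub>add_monoid (Yring m)\<^esub> x = Ycls m (- f)"
      by (rule group.inv_equality[OF grp])
        (use f s(4) T in \<open>auto simp: Yring_repD(2,3,4) subset_iff polyB_minus intro!: imageI\<close>)
    then show "inv\<^bsub>add_monoid (Yring m)\<^esub> x \<in> Ycls m ` T"
      using f s(4) by auto
    assume "y \<in> Ycls m ` T"
    then obtain g where "g \<in> T" "y = Ycls m g" by blast
    then show "x \<otimes>\<^bsub>add_monoid (Yring m)\<^esub> y \<in> Ycls m ` T"
      using f s(2)[of f g] by (simp add: Yring_repD(4) TP)
  qed
  fix x y :: "'k gpoly set" assume "x \<in> Ycls m ` T" "y \<in> carrier (Yring m)"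
  then obtain f p where f: "f \<in> T" "x = Ycls m f" "p \<in> carrier (polyB m)" "y = Ycls m p"
    unfolding Yring_repD(2) by blast
  then show "y \<otimes>\<^bsub>Yring m\<^esub> x \<in> Ycls m ` T" "x \<otimes>\<^bsub>Yring m\<^esub> y \<in> Ycls m ` T"
    using mult[of p f] by (simp_all add: Yring_mult TP mult.commute[of f p])
qed

text \<open>Ideals of the quotient ring are handled through their preimages, which contain
  \<open>idealJ\<close>.\<close>

definition preim :: "nat \<Rightarrow> 'k::field gpoly set set \<Rightarrow> 'k gpoly set" where
  "preim m I = {f \<in> carrier (polyB m). Ycls m f \<in> I}"

lemma preim_ideal:
  assumes "ideal I (Yring m :: ('k::field, 'k gpoly set) module)"
  shows "mpol.subspace (preim m I)"
    and "p \<in> carrier (polyB m) \<Longrightarrow> f \<in> preim m I \<Longrightarrow> p * f \<in> preim m I"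
    and "Ycls m ` preim m I = I" and "idealJ m \<subseteq> preim m I"
proof -
  interpret ideal I "Yring m :: ('k, 'k gpoly set) module" by fact
  note sub_closed = additive_subgroup.a_closed[OF ideal.axioms(1)[OF assms]]
    and sub_zero = additive_subgroup.zero_closed[OF ideal.axioms(1)[OF assms]]
  show mult: "p * f \<in> preim m I" if "p \<in> carrier (polyB m)" "f \<in> preim m I" for p f
    using that I_l_closed[of "Ycls m f" "Ycls m p"]
    by (auto simp: preim_def Yring_mult Yring_repD(2))
  show "mpol.subspace (preim m I)"
    unfolding mpol.subspace_def
  proof (intro conjI ballI allI)
    show "0 \<in> preim m I" using sub_zero by (simp add: preim_def Yring_repD(3)[symmetric])
    show "f + g \<in> preim m I" if "f \<in> preim m I" "g \<in> preim m I" for f g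
      using that sub_closed[of "Ycls m f" "Ycls m g"] by (auto simp: preim_def Yring_repD(4))
  qed (auto intro: mult)
  show "Ycls m ` preim m I = I"
    using a_subset by (auto simp: preim_def Yring_repD(2))
  show "idealJ m \<subseteq> preim m I"
  proof
    fix f :: "'k gpoly" assume f: "f \<in> idealJ m"
    then have "Ycls m f = \<zero>\<^bsub>Yring m\<^esub>"
      using Ycls_eq_iff[of f m 0] by (simp add: Yring_repD(3) idealJ_subset)
    then show "f \<in> preim m I"
      using f sub_zero by (simp add: preim_def idealJ_subset)
  qed
qed

section \<open>Powers of the ideal of the u_i\<close>

lemma uideal_gens: "(\<lambda>i. Ycls m (u i)) ` {1..m} \<subseteq> carrier (Yring m)"
  by (auto simp: Yring_repD(2))

lemma uideal_ideal: "ideal (uideal m) (Yring m)"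
  unfolding uideal_def by (rule ring.genideal_ideal[OF ring_Yring uideal_gens])

lemma upow_ideal: "ideal (upow m c) (Yring m)"
proof (induction c)
  case 0
  show ?case using ring.oneideal[OF ring_Yring] by simp
next
  case (Suc c)
  then show ?case using ring.ideal_prod_is_ideal[OF ring_Yring uideal_ideal Suc] by simp
qed

text \<open>In the polynomial ring this is the sum of \<open>idealJ m\<close> and the
  \<open>c\<close>-th power of the ideal generated by the u_i.\<close>

definition Uset :: "nat \<Rightarrow> nat \<Rightarrow> 'k::field gpoly set" where
  "Uset m c = preim m (upow m c)"

lemmas Uset_ideal = preim_ideal[OF upow_ideal, folded Uset_def]

lemma Uset_polyB: "f \<in> Uset m c \<Longrightarrow> f \<in> carrier (polyB m)"
  by (simp add: Uset_def preim_def)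

lemma Uset_Suc: "Uset m (Suc c) \<subseteq> Uset m c"
  using ring.ideal_prod_inter[OF ring_Yring uideal_ideal upow_ideal, of m c]
  by (auto simp: Uset_def preim_def)

lemma Uset_mult_u:
  assumes i: "i \<in> {1..m}" and f: "f \<in> Uset m c"
  shows "u i * f \<in> Uset m (Suc c)"
proof -
  have "Ycls m (u i) \<in> uideal m"
    unfolding uideal_def using ring.genideal_self[OF ring_Yring uideal_gens] i by blast
  moreover have "Ycls m f \<in> upow m c" using f by (simp add: Uset_def preim_def)
  ultimately have "Ycls m (u i) \<otimes>\<^bsub>Yring m\<^esub> Ycls m f \<in> upow m (Suc c)"
    by (auto intro: ideal_prod.prod)
  then show ?thesis
    using i Uset_polyB[OF f] by (auto simp: Uset_def preim_def Yring_mult polyB_mult)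
qed

lemma zlist_Uset:
  assumes "xs \<in> lists (pairs {1..m})" "c \<le> ucount xs"
  shows "(zlist xs :: 'k::field gpoly) \<in> Uset m c"
  using assms
proof (induction xs arbitrary: c)
  case Nil
  then show ?case by (auto simp: Uset_def preim_def Yring_repD(2))
next
  case (Cons p xs)
  obtain i j where p: "p = (i, j)" by (cases p)
  have ij: "i \<in> {1..m}" "j \<in> {0..m}" "i \<noteq> j" using Cons.hyps by (auto simp: p pairs_def)
  show ?case
  proof (cases "j = 0 \<and> c \<noteq> 0")
    case True
    then obtain c' where c: "c = Suc c'" by (cases c) auto
    have "zlist xs \<in> (Uset m c' :: 'k gpoly set)"
      using Cons.prems True by (intro Cons.IH) (auto simp: c p)
    from Uset_mult_u[OF ij(1) this] show ?thesis
      using True ij by (simp add: p c zeta_def)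
  next
    case False
    have "zlist xs \<in> (Uset m c :: 'k gpoly set)"
      using Cons.prems False by (intro Cons.IH) (auto simp: p)
    from Uset_ideal(2)[OF zeta_polyB[OF ij] this] show ?thesis by (simp add: p)
  qed
qed

text \<open>The classes of \<open>filt m 1\<close> contain the generators of the ideal of the u's,
  and \<open>filt\<close> is multiplicative. Hence what is independent modulo \<open>filt\<close>
  remains so modulo the smaller \<open>Uset\<close>.\<close>

lemma Uset_filt:
  fixes f :: "'k::field_char_0 gpoly"
  assumes "f \<in> Uset m c" shows "f \<in> filt m c"
proof -
  have id: "ideal (Ycls m ` filt m c) (Yring m :: ('k, 'k gpoly set) module)" for c
    by (rule Ycls_image_ideal) (auto intro: filt_mult_polyB filt_subspace filt_polyB)
  have "(\<lambda>i. Ycls m (u i)) ` {1..m} \<subseteq> Ycls m ` (filt m 1 :: 'k gpoly set)"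
  proof (rule image_subsetI)
    fix i assume i: "i \<in> {1..m}"
    then have "(zlist [(i, 0)] :: 'k gpoly) \<in> filt m 1"
      by (intro zlist_filt) (auto simp: pairs_def)
    then show "Ycls m (u i) \<in> Ycls m ` (filt m 1 :: 'k gpoly set)"
      using i by (simp add: zeta_def)
  qed
  then have U: "uideal m \<subseteq> Ycls m ` (filt m 1 :: 'k gpoly set)"
    unfolding uideal_def by (rule ring.genideal_minimal[OF ring_Yring id])
  have "upow m c \<subseteq> Ycls m ` (filt m c :: 'k gpoly set)"
  proof (induction c)
    case 0
    show ?case by (auto simp: Yring_repD(2) intro: polyB_filt)
  next
    case (Suc c)
    show ?case
    proof
      fix y :: "'k gpoly set" assume "y \<in> upow m (Suc c)"
      then have "y \<in> ideal_prod (Yring m) (uideal m) (upow m c)" by simp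
      then show "y \<in> Ycls m ` filt m (Suc c)"
      proof (induction rule: ideal_prod.induct)
        case (prod x y)
        then obtain f g where fg: "f \<in> filt m 1" "x = Ycls m f" "g \<in> filt m c" "y = Ycls m g"
          using U Suc by blast
        then show ?case
          using filt_mult[OF fg(1,3)] by (auto simp: Yring_mult filt_polyB)
      next
        case (sum x y)
        then show ?case
          using additive_subgroup.a_closed[OF ideal.axioms(1)[OF id]] by blast
      qed
    qed
  qed
  then obtain g where g: "g \<in> filt m c" "Ycls m f = Ycls m g"
    using assms by (auto simp: Uset_def preim_def)
  then have "f - g \<in> filt m c"
    using Ycls_eq_iff[of f m g] Uset_polyB[OF assms] filt_polyB idealJ_filt by blast
  from mpol.subspace_add[OF filt_subspace this g(1)] show ?thesis by simp
qed

section \<open>Classes in the associated graded ring\<close>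

definition gcls :: "nat \<Rightarrow> nat \<Rightarrow> 'k::field gpoly \<Rightarrow> 'k gpoly set set" where
  "gcls m c f = upow m (Suc c) +>\<^bsub>Yring m\<^esub> Ycls m f"

text \<open>The presentation of the quotient ring is restricted to a power of the ideal and divided
  by the next one; both layers of cosets are thereby replaced by congruence modulo
  \<open>Uset m (Suc c)\<close>.\<close>

lemma gcls_rep:
  shows lin_rep_grY: "lin_rep (grY m c) (Uset m c) (gcls m c :: 'k::field gpoly \<Rightarrow> _)"
    and gcls_eq_iff: "f \<in> Uset m c \<Longrightarrow> g \<in> Uset m c \<Longrightarrow>
      gcls m c f = gcls m c g \<longleftrightarrow> f - g \<in> (Uset m (Suc c) :: 'k gpoly set)"
    and gcls_image: "f \<in> Uset m c \<Longrightarrow> gcls m c f = (\<lambda>h :: 'k gpoly. Ycls m (h + f)) ` Uset m (Suc c)"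
proof -
  let ?M = "(Yring m :: ('k, 'k gpoly set) module)\<lparr>carrier := upow m c\<rparr>"
  have "Uset m c \<subseteq> (carrier (polyB m) :: 'k gpoly set)" using Uset_polyB by blast
  from lin_rep_restrict[OF lin_rep_Yring Uset_ideal(1) this]
  have rep: "lin_rep ?M (Uset m c) (Ycls m)" by (simp only: Uset_ideal(3))
  have ker: "f \<in> Uset m (Suc c)" if "f \<in> Uset m c" "Ycls m f = \<zero>\<^bsub>?M\<^esub>" for f :: "'k gpoly"
  proof -
    have "f - 0 \<in> idealJ m"
      using Ycls_eq_iff[of f m 0] that Uset_polyB by (auto simp: Yring_repD(3))
    then show ?thesis using Uset_ideal(4) by auto
  qed
  have g: "gcls m c = (\<lambda>f :: 'k gpoly. Ycls m ` Uset m (Suc c) +>\<^bsub>?M\<^esub> Ycls m f)"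
    by (simp add: gcls_def Uset_ideal(3) a_r_coset_def' fun_eq_iff)
  show "lin_rep (grY m c) (Uset m c) (gcls m c :: 'k gpoly \<Rightarrow> _)"
    using lin_rep_quot(1)[OF rep Uset_ideal(1) Uset_Suc ker] unfolding g by (simp only: grY_def Uset_ideal(3))
  show "gcls m c f = gcls m c g \<longleftrightarrow> f - g \<in> (Uset m (Suc c) :: 'k gpoly set)"
    if "f \<in> Uset m c" "g \<in> Uset m c"
    using lin_rep_quot(2)[OF rep Uset_ideal(1) Uset_Suc ker that] unfolding g by simp
  show "gcls m c f = (\<lambda>h :: 'k gpoly. Ycls m (h + f)) ` Uset m (Suc c)" if "f \<in> Uset m c"
    using lin_rep_coset[OF rep Uset_Suc that] unfolding g .
qed

text \<open>\<open>vspan\<close> combines distinct vectors, while elements of \<open>X\<close> may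
  have equal images; hence one representative \<open>q\<close> is chosen for each image, which does
  not change the image of the span.\<close>

lemma lin_rep_vspan:
  assumes rep: "lin_rep M A \<psi>" and X: "X \<subseteq> A"
  shows "vspan M (\<psi> ` X) = \<psi> ` mpol.span X"
proof -
  note d = lin_repD[OF rep] and s = subspaceD[OF lin_repD(1)[OF rep]]
  have "\<forall>y\<in>\<psi> ` X. \<exists>x. x \<in> X \<and> y = \<psi> x" by blast
  from bchoice[OF this] obtain q where q: "\<And>y. y \<in> \<psi> ` X \<Longrightarrow> q y \<in> X" "\<And>y. y \<in> \<psi> ` X \<Longrightarrow> y = \<psi> (q y)"
    by blast
  have fs: "finsum M (\<lambda>b. c b \<odot>\<^bsub>M\<^esub> b) F = \<psi> (\<Sum>b\<in>F. mconst (c b) * q b)"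
    if "finite F" "F \<subseteq> \<psi> ` X" for c F
    using that q X by (intro lin_rep_finsum_scaled[OF rep]) blast+
  have span_A: "mpol.span Z \<subseteq> A" if "Z \<subseteq> A" for Z
    using mpol.span_minimal[OF that d(1)] .
  let ?V = "{f \<in> A. \<psi> f \<in> \<psi> ` mpol.span (q ` \<psi> ` X)}"
  have qX: "q ` \<psi> ` X \<subseteq> X" by (rule image_subsetI) (rule q(1))
  have qA: "mpol.span (q ` \<psi> ` X) \<subseteq> A" by (rule span_A) (rule order_trans[OF qX X])
  have "mpol.subspace ?V"
    unfolding mpol.subspace_def
  proof (intro conjI ballI allI)
    show "0 \<in> ?V" using s(1) mpol.span_zero by blast
  next
    fix f g assume "f \<in> ?V" "g \<in> ?V"
    then obtain f' g' where h: "f \<in> A" "g \<in> A" "f' \<in> mpol.span (q ` \<psi> ` X)" "\<psi> f = \<psi> f'"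
      "g' \<in> mpol.span (q ` \<psi> ` X)" "\<psi> g = \<psi> g'" by auto
    then have "\<psi> (f + g) = \<psi> (f' + g')"
      using d(4)[of f g] d(4)[of f' g'] qA by auto
    then show "f + g \<in> ?V"
      using h s(2) mpol.span_add by blast
  next
    fix c f assume "f \<in> ?V"
    then obtain f' where h: "f \<in> A" "f' \<in> mpol.span (q ` \<psi> ` X)" "\<psi> f = \<psi> f'" by auto
    then have "\<psi> (mconst c * f) = \<psi> (mconst c * f')"
      using d(5)[of f c] d(5)[of f' c] qA by auto
    then show "mconst c * f \<in> ?V"
      using h s(3) mpol.span_scale[OF h(2), of c] by blast
  qed
  moreover have "X \<subseteq> ?V"
  proof
    fix x assume x: "x \<in> X"
    have "\<psi> x = \<psi> (q (\<psi> x))" "q (\<psi> x) \<in> q ` \<psi> ` X"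
      using q(2)[OF imageI[OF x]] x by simp_all
    then have "\<psi> x \<in> \<psi> ` mpol.span (q ` \<psi> ` X)"
      by (rule image_eqI[OF _ mpol.span_base])
    then show "x \<in> ?V" using x X by auto
  qed
  ultimately have le: "\<psi> ` mpol.span X \<subseteq> \<psi> ` mpol.span (q ` \<psi> ` X)"
    using mpol.span_minimal by blast
  show ?thesis
  proof
    show "vspan M (\<psi> ` X) \<subseteq> \<psi> ` mpol.span X"
    proof
      fix y assume "y \<in> vspan M (\<psi> ` X)"
      then obtain c F where F: "finite F" "F \<subseteq> \<psi> ` X" "y = finsum M (\<lambda>b. c b \<odot>\<^bsub>M\<^esub> b) F"
        unfolding vspan_def by blast
      have "(\<Sum>b\<in>F. mconst (c b) * q b) \<in> mpol.span X"
        using F q by (intro mpol.span_sum mpol.span_scale mpol.span_base) blast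
      then show "y \<in> \<psi> ` mpol.span X" unfolding F(3) fs[OF F(1,2)] by blast
    qed
    have inj: "inj_on q (\<psi> ` X)" using q(2) by (metis inj_onI)
    show "\<psi> ` mpol.span X \<subseteq> vspan M (\<psi> ` X)"
    proof
      fix y assume "y \<in> \<psi> ` mpol.span X"
      then obtain f where f: "f \<in> mpol.span (q ` \<psi> ` X)" "y = \<psi> f" using le by blast
      then obtain T c where T: "finite T" "T \<subseteq> q ` \<psi> ` X" "f = (\<Sum>a\<in>T. mconst (c a) * a)"
        unfolding mpol.span_explicit by blast
      obtain F where F: "F \<subseteq> \<psi> ` X" "T = q ` F" using T(2) by (meson subset_imageE)
      have injF: "inj_on q F" using inj F(1) by (rule inj_on_subset)
      have finF: "finite F" using T(1) F(2) injF finite_imageD by blast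
      have "f = (\<Sum>b\<in>F. mconst (c (q b)) * q b)"
        unfolding T(3) F(2) by (simp add: sum.reindex[OF injF])
      then have "y = finsum M (\<lambda>b. c (q b) \<odot>\<^bsub>M\<^esub> b) F"
        unfolding f(2) using fs[OF finF F(1)] by simp
      then show "y \<in> vspan M (\<psi> ` X)"
        unfolding vspan_def using finF F(1) by (intro CollectI exI[of _ "\<lambda>b. c (q b)"] exI[of _ F]) simp
    qed
  qed
qed

text \<open>v_ij and w_ij are 2 * zeta j i and - 2 * zeta i j, so both sorts of monomials agree up
  to nonzero scalars. The condition on \<open>ucount\<close> avoids subtraction and leaves no word
  if k < l.\<close>

lemma span_bimonoms:
  "mpol.span (bimonoms m k l) = (zspan m (\<lambda>xs. length xs = k \<and> ucount xs + l = k) :: 'k::field_char_0 gpoly set)"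
    (is "_ = zspan m ?Q")
proof
  have us: "prod_list xs \<in> (zspan m (\<lambda>ys. length ys = length xs \<and> ucount ys = length xs) :: 'k gpoly set)"
    if "set xs \<subseteq> u ` {1..m}" for xs
    using that
  proof (induction xs)
    case Nil
    show ?case using zspan_base[of "[]" m "\<lambda>ys. length ys = 0 \<and> ucount ys = 0"] by simp
  next
    case (Cons x xs)
    then obtain i where i: "i \<in> {1..m}" "x = u i" by auto
    have "x \<in> zspan m (\<lambda>ys. length ys = 1 \<and> ucount ys = 1)"
      using zspan_base[of "[(i, 0)]" m "\<lambda>ys. length ys = 1 \<and> ucount ys = 1"] i
      by (simp add: pairs_def zeta_def)
    from zspan_mult[OF this Cons.IH] Cons.prems show ?case
      by (auto simp: ucount_append)
  qed
  have vs: "prod_list xs \<in> (zspan m (\<lambda>ys. length ys = length xs \<and> ucount ys = 0) :: 'k gpoly set)"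
    if "set xs \<subseteq> vwset m" for xs
    using that
  proof (induction xs)
    case Nil
    show ?case using zspan_base[of "[]" m "\<lambda>ys. length ys = 0 \<and> ucount ys = 0"] by simp
  next
    case (Cons x xs)
    have z: "zeta i j \<in> (zspan m (\<lambda>ys. length ys = 1 \<and> ucount ys = 0) :: 'k gpoly set)"
      if "(i, j) \<in> pairs {1..m}" "j \<noteq> 0" for i j
      using zspan_base[of "[(i, j)]" m "\<lambda>ys. length ys = 1 \<and> ucount ys = 0"] that by simp
    have "x \<in> vwset m" using Cons.prems by simp
    then obtain i j where ij: "1 \<le> i" "i < j" "j \<le> m" "x = up i j + um i j \<or> x = up i j - um i j"
      unfolding vwset_def by blast
    then have "x = zeta j i + zeta j i \<or> x = - (zeta i j + zeta i j)"
      by (auto simp: up_zeta um_zeta)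
    moreover have "(i, j) \<in> pairs {1..m}" "(j, i) \<in> pairs {1..m}" "i \<noteq> 0" "j \<noteq> 0"
      using ij by (auto simp: pairs_def)
    note zz = z[OF this(1,4)] z[OF this(2,3)]
    have "zeta j i + zeta j i \<in> (zspan m (\<lambda>ys. length ys = 1 \<and> ucount ys = 0) :: 'k gpoly set)"
      "- (zeta i j + zeta i j) \<in> (zspan m (\<lambda>ys. length ys = 1 \<and> ucount ys = 0) :: 'k gpoly set)"
      by (intro mpol.subspace_neg[OF zspan_subspace] mpol.subspace_add[OF zspan_subspace] zz)+
    ultimately have "x \<in> zspan m (\<lambda>ys. length ys = 1 \<and> ucount ys = 0)"
      by metis
    from zspan_mult[OF this Cons.IH] Cons.prems show ?case
      by (auto simp: ucount_append)
  qed
  show "mpol.span (bimonoms m k l) \<subseteq> (zspan m ?Q :: 'k gpoly set)"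
  proof (rule mpol.span_minimal[OF _ zspan_subspace], rule subsetI)
    fix f :: "'k gpoly" assume "f \<in> bimonoms m k l"
    then obtain xs ys where f: "f = prod_list xs * prod_list ys" "set xs \<subseteq> u ` {1..m}" "set ys \<subseteq> vwset m"
      "length ys = l" "length xs + length ys = k"
      unfolding bimonoms_def by blast
    show "f \<in> zspan m ?Q"
      unfolding f(1) by (rule zspan_mult[OF us[OF f(2)] vs[OF f(3)]]) (use f in \<open>auto simp: ucount_append\<close>)
  qed
  show "(zspan m ?Q :: 'k gpoly set) \<subseteq> mpol.span (bimonoms m k l)"
  proof (rule zspan_minimal[OF mpol.subspace_span])
    fix xs assume xs: "xs \<in> lists (pairs {1..m})" "?Q xs"
    have "\<exists>us vs c. (zlist xs :: 'k gpoly) = mconst c * (prod_list us * prod_list vs) \<and> set us \<subseteq> u ` {1..m}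
        \<and> set vs \<subseteq> vwset m \<and> length us = ucount xs \<and> length us + length vs = length xs"
      using xs(1)
    proof (induction xs)
      case Nil
      show ?case by (intro exI[of _ "[]"] exI[of _ 1]) simp
    next
      case (Cons p xs)
      then obtain us vs c where IH: "(zlist xs :: 'k gpoly) = mconst c * (prod_list us * prod_list vs)"
        "set us \<subseteq> u ` {1..m}" "set vs \<subseteq> vwset m" "length us = ucount xs" "length us + length vs = length xs"
        by auto
      obtain i j where p: "p = (i, j)" by (cases p)
      have ij: "i \<in> {1..m}" "j \<in> {0..m}" "i \<noteq> j" using Cons.hyps by (auto simp: p pairs_def)
      show ?case
      proof (cases "j = 0")
        case True
        then show ?thesis
          using IH ij by (intro exI[of _ "u i # us"] exI[of _ vs] exI[of _ c]) (auto simp: p zeta_def mult_ac)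
      next
        case False
        have "\<exists>v\<in>vwset m. \<exists>d. (zeta i j :: 'k gpoly) = mconst d * v"
        proof (cases "i < j")
          case True
          have "up i j - um i j \<in> (vwset m :: 'k gpoly set)"
            unfolding vwset_def
            by (rule UnI2, rule CollectI, rule exI[of _ i], rule exI[of _ j]) (use True ij in simp)
          moreover have "(zeta i j :: 'k gpoly) = mconst (- (1/2)) * (up i j - um i j)"
            using True ij by (simp add: zeta_def Mgen_def Pgen_def mconst_minus algebra_simps)
          ultimately show ?thesis by blast
        next
          case F: False
          have "up j i + um j i \<in> (vwset m :: 'k gpoly set)"
            unfolding vwset_def
            by (rule UnI1, rule CollectI, rule exI[of _ j], rule exI[of _ i]) (use F ij False in simp)
          moreover have "(zeta i j :: 'k gpoly) = mconst (1/2) * (up j i + um j i)"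
            using F False ij by (simp add: zeta_def Mgen_def Pgen_def add.commute)
          ultimately show ?thesis by blast
        qed
        then obtain v d where v: "v \<in> vwset m" "(zeta i j :: 'k gpoly) = mconst d * v" by blast
        have "(zlist (p # xs) :: 'k gpoly) = mconst (d * c) * (prod_list us * prod_list (v # vs))"
          by (simp only: zlist_simps p fst_conv snd_conv IH(1) v(2) mconst_mult prod_list.Cons mult_ac)
        moreover have "set (v # vs) \<subseteq> vwset m" "length us = ucount (p # xs)"
          "length us + length (v # vs) = length (p # xs)"
          using IH(3-5) v(1) False by (simp_all add: p)
        ultimately show ?thesis using IH(2) by blast
      qed
    qed
    then obtain us vs c where h: "(zlist xs :: 'k gpoly) = mconst c * (prod_list us * prod_list vs)"
      "set us \<subseteq> u ` {1..m}" "set vs \<subseteq> vwset m" "length us = ucount xs" "length us + length vs = length xs"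
      by blast
    then have "prod_list us * prod_list vs \<in> (bimonoms m k l :: 'k gpoly set)"
      unfolding bimonoms_def using xs(2) by (intro CollectI exI[of _ us] exI[of _ vs]) auto
    then show "(zlist xs :: 'k gpoly) \<in> mpol.span (bimonoms m k l)"
      unfolding h(1) by (rule mpol.span_scale[OF mpol.span_base])
  qed
qed

lemma grYcomp_eq:
  "grYcomp m k l = gcls m (k - l) ` (zspan m (\<lambda>xs. length xs = k \<and> ucount xs + l = k) :: 'k::field_char_0 gpoly set)"
proof -
  have "(zspan m (\<lambda>xs. length xs = k \<and> ucount xs + l = k) :: 'k gpoly set) \<subseteq> Uset m (k - l)"
    by (rule zspan_minimal[OF Uset_ideal(1)]) (auto intro: zlist_Uset)
  then have "bimonoms m k l \<subseteq> (Uset m (k - l) :: 'k gpoly set)"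
    using mpol.span_superset[of "bimonoms m k l :: 'k gpoly set"] by (auto simp: span_bimonoms)
  from lin_rep_vspan[OF lin_rep_grY this] show ?thesis
    unfolding grYcomp_def span_bimonoms gcls_def[abs_def] .
qed

section \<open>The signed permutation action\<close>

definition signed_perm :: "nat \<Rightarrow> (nat \<Rightarrow> int) \<Rightarrow> (nat \<Rightarrow> nat) \<Rightarrow> bool" where
  "signed_perm m s \<pi> \<longleftrightarrow> \<pi> permutes {1..m} \<and> (\<forall>i\<in>{1..m}. s i = 1 \<or> s i = - 1)"

text \<open>The places of the coefficients 1 and -1 tell apart all generators and their negatives,
  which makes the description in \<open>gen_act\<close> definite.\<close>

lemma lform_level_sets:
  assumes "b \<in> gens m"
  shows "{r. lform b r = 1} = (case b of U i \<Rightarrow> {i} | Up i j \<Rightarrow> {j} | Um i j \<Rightarrow> {i, j})"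
    and "{r. lform b r = - 1} = (case b of U i \<Rightarrow> {} | Up i j \<Rightarrow> {i} | Um i j \<Rightarrow> {})"
  using assms by (cases b; auto simp: of_bool_def split: if_splits)+

lemma lform_inj:
  assumes "b \<in> gens m" "b' \<in> gens m" "lform b = lform b'"
  shows "b = b'"
proof -
  have "{r. lform b r = 1} = {r. lform b' r = 1}" "{r. lform b r = - 1} = {r. lform b' r = - 1}"
    using assms(3) by simp_all
  then show ?thesis
    unfolding lform_level_sets[OF assms(1)] lform_level_sets[OF assms(2)]
    using assms(1,2) by (cases b; cases b') (auto simp: doubleton_eq_iff)
qed

lemma lform_neq_neg:
  assumes "b \<in> gens m" "b' \<in> gens m"
  shows "lform b \<noteq> (\<lambda>r. - lform b' r)"
proof
  assume "lform b = (\<lambda>r. - lform b' r)"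
  then have "{r. lform b r = 1} = {r. lform b' r = - 1}" "{r. lform b r = - 1} = {r. lform b' r = 1}"
    by (auto simp: minus_equation_iff)
  then show False
    unfolding lform_level_sets[OF assms(1)] lform_level_sets[OF assms(2)]
    using assms by (cases b; cases b') auto
qed

lemma gen_act_pos:
  assumes b: "b \<in> gens m" and "lform_act s \<pi> (lform a) = lform b"
  shows "gen_act m s \<pi> a = mvar b"
  unfolding gen_act_def
proof (rule the_equality)
  fix f assume "\<exists>b\<in>gens m. lform_act s \<pi> (lform a) = lform b \<and> f = mvar b
    \<or> lform_act s \<pi> (lform a) = (\<lambda>r. - lform b r) \<and> f = - mvar b"
  then show "f = mvar b"
    unfolding assms(2) using lform_inj[OF b] lform_neq_neg[OF b] by metis
qed (use assms in blast)

lemma gen_act_neg: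
  assumes b: "b \<in> gens m" and "lform_act s \<pi> (lform a) = (\<lambda>r. - lform b r)"
  shows "gen_act m s \<pi> a = - mvar b"
  unfolding gen_act_def
proof (rule the_equality)
  fix f assume f: "\<exists>b\<in>gens m. lform_act s \<pi> (lform a) = lform b \<and> f = mvar b
    \<or> lform_act s \<pi> (lform a) = (\<lambda>r. - lform b r) \<and> f = - mvar b"
  then obtain b' where b': "b' \<in> gens m" and d: "(\<lambda>r. - lform b r) = lform b' \<and> f = mvar b'
    \<or> (\<lambda>r. - lform b r) = (\<lambda>r. - lform b' r) \<and> f = - mvar b'"
    unfolding assms(2) by blast
  have "(\<lambda>r. - lform b r) \<noteq> lform b'" using lform_neq_neg[OF b' b] by metis
  then have "(\<lambda>r. - lform b r) = (\<lambda>r. - lform b' r)" and f': "f = - mvar b'" using d by blast+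
  then have "lform b = lform b'" by (simp add: fun_eq_iff)
  then show "f = - mvar b" using lform_inj[OF b b'] f' by simp
qed (use assms in blast)

abbreviation pinv :: "('a \<Rightarrow> 'b) \<Rightarrow> 'b \<Rightarrow> 'a" where
  "pinv \<equiv> inv_into UNIV"

lemma bij_inv_eq: "bij \<pi> \<Longrightarrow> pinv \<pi> r = i \<longleftrightarrow> r = \<pi> i"
  by (metis bij_inv_eq_iff)

lemma lform_act_U:
  "bij \<pi> \<Longrightarrow> lform_act s \<pi> (lform (U i)) = (\<lambda>r. s i * of_bool (r = \<pi> i))"
  by (auto simp: lform_act_def fun_eq_iff bij_inv_eq[of \<pi>, symmetric])

lemma lform_act_Up:
  "bij \<pi> \<Longrightarrow> lform_act s \<pi> (lform (Up i j)) = (\<lambda>r. s j * of_bool (r = \<pi> j) - s i * of_bool (r = \<pi> i))"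
  by (auto simp: lform_act_def fun_eq_iff bij_inv_eq[of \<pi>, symmetric])

lemma lform_act_Um:
  "bij \<pi> \<Longrightarrow> lform_act s \<pi> (lform (Um i j)) = (\<lambda>r. s j * of_bool (r = \<pi> j) + s i * of_bool (r = \<pi> i))"
  by (auto simp: lform_act_def fun_eq_iff bij_inv_eq[of \<pi>, symmetric])

lemma signed_permD:
  assumes "signed_perm m s \<pi>"
  shows "bij \<pi>" "i \<in> {1..m} \<Longrightarrow> \<pi> i \<in> {1..m}" "\<pi> i = \<pi> j \<longleftrightarrow> i = j" "\<pi> 0 = 0"
    "i \<in> {1..m} \<Longrightarrow> s i = 1 \<or> s i = - 1" "\<pi> i = 0 \<longleftrightarrow> i = 0" "i \<le> m \<Longrightarrow> \<pi> i \<le> m"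
proof -
  have p: "\<pi> permutes {1..m}" using assms by (simp add: signed_perm_def)
  show "bij \<pi>" by (rule permutes_bij[OF p])
  show r: "\<pi> i \<in> {1..m}" if "i \<in> {1..m}" for i
    using permutes_in_image[OF p] that by blast
  show inj: "\<pi> i = \<pi> j \<longleftrightarrow> i = j" for i j
    using permutes_inj[OF p] by (simp add: inj_eq)
  show z: "\<pi> 0 = 0" by (rule permutes_not_in[OF p]) simp
  show "\<pi> i = 0 \<longleftrightarrow> i = 0" for i using inj[of i 0] z by simp
  show "i \<in> {1..m} \<Longrightarrow> s i = 1 \<or> s i = - 1" using assms by (auto simp: signed_perm_def)
  show "i \<le> m \<Longrightarrow> \<pi> i \<le> m" using r[of i] z by (cases "i = 0") auto
qed

lemma gen_act_U:
  assumes sp: "signed_perm m s \<pi>" and i: "i \<in> {1..m}"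
  shows "gen_act m s \<pi> (U i) = mconst (of_int (s i)) * u (\<pi> i)"
proof -
  note d = signed_permD[OF sp]
  have g: "U (\<pi> i) \<in> gens m" using d(2)[OF i] by simp
  from d(5)[OF i] show ?thesis
  proof
    assume s: "s i = 1"
    have "lform_act s \<pi> (lform (U i)) = lform (U (\<pi> i))"
      unfolding lform_act_U[OF d(1)] by (simp add: s)
    from gen_act_pos[OF g this] show ?thesis by (simp add: s)
  next
    assume s: "s i = - 1"
    have "lform_act s \<pi> (lform (U i)) = (\<lambda>r. - lform (U (\<pi> i)) r)"
      unfolding lform_act_U[OF d(1)] by (simp add: s)
    from gen_act_neg[OF g this] show ?thesis by (simp add: s mconst_minus)
  qed
qed

text \<open>Up to the sign \<open>d\<close> the form is x_b + x_a or x_b - x_a; \<open>min\<close>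
  and \<open>max\<close> put the indices into the order used for the generators.\<close>

lemma gen_act_form:
  fixes c d :: int
  assumes ab: "a \<in> {1..m}" "b \<in> {1..m}" "a \<noteq> b" and cd: "c = 1 \<or> c = - 1" "d = 1 \<or> d = - 1"
    and act: "lform_act s \<pi> (lform g) = (\<lambda>r. d * of_bool (r = b) + c * of_bool (r = a))"
  shows "gen_act m s \<pi> g = mconst (of_int d) * (if c = d then Mgen a b else Pgen a b)"
proof -
  have Um: "Um (min a b) (max a b) \<in> gens m" and Up: "Up (min a b) (max a b) \<in> gens m"
    using ab by auto
  have M: "lform (Um (min a b) (max a b)) = (\<lambda>r. of_bool (r = b) + of_bool (r = a))"
    and P: "lform (Up (min a b) (max a b)) = (\<lambda>r. (if a < b then 1 else - 1) * (of_bool (r = b) - of_bool (r = a)))"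
    using ab(3) by (auto simp: fun_eq_iff min_def max_def)
  have Mg: "Mgen a b = mvar (Um (min a b) (max a b))"
    using ab(3) by (auto simp: Mgen_def min_def max_def)
  have Pg: "Pgen a b = (if a < b then mvar (Up (min a b) (max a b)) else - mvar (Up (min a b) (max a b)))"
    using ab(3) by (auto simp: Pgen_def min_def max_def)
  show ?thesis
  proof (cases "c = d")
    case True
    from cd(2) show ?thesis
    proof
      assume d: "d = 1"
      have "lform_act s \<pi> (lform g) = lform (Um (min a b) (max a b))"
        unfolding act M using True d by simp
      from gen_act_pos[OF Um this] show ?thesis using True d by (simp add: Mg)
    next
      assume d: "d = - 1"
      have "lform_act s \<pi> (lform g) = (\<lambda>r. - lform (Um (min a b) (max a b)) r)"
        unfolding act M using True d by simp
      from gen_act_neg[OF Um this] show ?thesis using True d by (simp add: Mg mconst_minus)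
    qed
  next
    case False
    then have c: "c = - d" using cd by auto
    show ?thesis
    proof (cases "(d = 1) = (a < b)")
      case True
      have "lform_act s \<pi> (lform g) = lform (Up (min a b) (max a b))"
        unfolding act P using True c cd by (auto simp: fun_eq_iff)
      from gen_act_pos[OF Up this] show ?thesis using False True cd by (auto simp: Pg mconst_minus)
    next
      case F: False
      have "lform_act s \<pi> (lform g) = (\<lambda>r. - lform (Up (min a b) (max a b)) r)"
        unfolding act P using F c cd by (auto simp: fun_eq_iff)
      from gen_act_neg[OF Up this] show ?thesis using False F cd by (auto simp: Pg mconst_minus)
    qed
  qed
qed

lemma gen_act_Um:
  assumes sp: "signed_perm m s \<pi>" and ij: "i \<in> {1..m}" "j \<in> {1..m}" "i \<noteq> j"
  shows "gen_act m s \<pi> (Um i j) = mconst (of_int (s j)) * (if s i = s j then Mgen (\<pi> i) (\<pi> j) else Pgen (\<pi> i) (\<pi> j))"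
  using ij signed_permD[OF sp] by (intro gen_act_form lform_act_Um) auto

lemma gen_act_Up:
  assumes sp: "signed_perm m s \<pi>" and ij: "i \<in> {1..m}" "j \<in> {1..m}" "i \<noteq> j"
  shows "gen_act m s \<pi> (Up i j)
    = mconst (of_int (s j)) * (if s i = s j then Pgen (\<pi> i) (\<pi> j) else (Mgen (\<pi> i) (\<pi> j) :: 'k::field gpoly))"
proof -
  note d = signed_permD[OF sp]
  have "lform_act s \<pi> (lform (Up i j)) = (\<lambda>r. s j * of_bool (r = \<pi> j) + (- s i) * of_bool (r = \<pi> i))"
    unfolding lform_act_Up[OF d(1)] by simp
  from gen_act_form[OF _ _ _ _ _ this, of m]
  have "gen_act m s \<pi> (Up i j)
      = mconst (of_int (s j)) * (if - s i = s j then Mgen (\<pi> i) (\<pi> j) else (Pgen (\<pi> i) (\<pi> j) :: 'k gpoly))"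
    using d(2)[OF ij(1)] d(2)[OF ij(2)] d(3)[of i j] d(5)[OF ij(1)] d(5)[OF ij(2)] ij(3) by fastforce
  moreover have "(- s i = s j) = (s i \<noteq> s j)"
    using d(5)[OF ij(1)] d(5)[OF ij(2)] by auto
  ultimately show ?thesis by simp
qed

section \<open>Action on the \<open>zeta\<close>\<close>

lemma poly_act_simps [simp]:
  "poly_act m s \<pi> (mvar x) = gen_act m s \<pi> x"
  "poly_act m s \<pi> (mconst c) = mconst c"
  "poly_act m s \<pi> (f + g) = poly_act m s \<pi> f + poly_act m s \<pi> g"
  "poly_act m s \<pi> (f - g) = poly_act m s \<pi> f - poly_act m s \<pi> g"
  "poly_act m s \<pi> (- f) = - poly_act m s \<pi> f"
  "poly_act m s \<pi> (f * g) = poly_act m s \<pi> f * poly_act m s \<pi> g"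
  "poly_act m s \<pi> 0 = 0"
  "poly_act m s \<pi> 1 = 1"
  by (simp_all add: poly_act_def msubst_eq_peval mconst.peval_add mconst.peval_diff
      mconst.peval_minus mconst.peval_mult)

text \<open>\<open>signed_perm\<close> does not constrain \<open>s 0\<close>; with the value 1
  there, the formulas for the action include index 0.\<close>

definition sgn_const :: "(nat \<Rightarrow> int) \<Rightarrow> nat \<Rightarrow> 'k::field gpoly" where
  "sgn_const s i = (if i = 0 then 1 else mconst (of_int (s i)))"

lemma sgn_const_sq: "signed_perm m s \<pi> \<Longrightarrow> i \<le> m \<Longrightarrow> sgn_const s i * sgn_const s i = 1"
  using signed_permD(5)[of m s \<pi> i] by (cases "i = 0") (auto simp: sgn_const_def mconst_minus)

lemma Pgen_swap: "i \<noteq> j \<Longrightarrow> Pgen j i = - Pgen i j" and Mgen_swap: "i \<noteq> j \<Longrightarrow> Mgen j i = Mgen i j"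
  by (auto simp: Pgen_def Mgen_def)

lemma zeta_act:
  assumes sp: "signed_perm m s \<pi>" and ij: "i \<le> m" "j \<le> m" "i \<noteq> j"
  shows "poly_act m s \<pi> (zeta i j) = sgn_const s i * (zeta (\<pi> i) (\<pi> j) :: 'k::field_char_0 gpoly)"
proof -
  note d = signed_permD[OF sp]
  consider "i = 0" | "i \<noteq> 0" "j = 0" | "i \<noteq> 0" "j \<noteq> 0" by blast
  then show ?thesis
  proof cases
    case 1
    then show ?thesis by (simp add: d)
  next
    case 2
    then show ?thesis using ij gen_act_U[OF sp, of i] by (simp add: zeta_def d sgn_const_def)
  next
    case 3
    then have r: "i \<in> {1..m}" "j \<in> {1..m}" "\<pi> i \<noteq> \<pi> j" using ij d(3) by auto
    have z: "zeta (\<pi> i) (\<pi> j) = mconst (1/2) * (Mgen (\<pi> i) (\<pi> j) - Pgen (\<pi> i) (\<pi> j))"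
      using 3 by (simp add: zeta_def d)
    show ?thesis
    proof (cases "i < j")
      case True
      then have "poly_act m s \<pi> (zeta i j) = mconst (1/2) * (gen_act m s \<pi> (Um i j) - gen_act m s \<pi> (Up i j))"
        using 3 by (simp add: zeta_def Mgen_def Pgen_def)
      then show ?thesis
        unfolding z gen_act_Um[OF sp r(1,2) ij(3)] gen_act_Up[OF sp r(1,2) ij(3)]
        using d(5)[OF r(1)] d(5)[OF r(2)] 3 by (auto simp: sgn_const_def mconst_minus algebra_simps)
    next
      case False
      then have "poly_act m s \<pi> (zeta i j) = mconst (1/2) * (gen_act m s \<pi> (Um j i) + gen_act m s \<pi> (Up j i))"
        using 3 by (simp add: zeta_def Mgen_def Pgen_def)
      then show ?thesis
        unfolding z gen_act_Um[OF sp r(2,1) ij(3)[symmetric]] gen_act_Up[OF sp r(2,1) ij(3)[symmetric]]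
          Pgen_swap[OF r(3)] Mgen_swap[OF r(3)]
        using d(5)[OF r(1)] d(5)[OF r(2)] 3 by (auto simp: sgn_const_def mconst_minus algebra_simps)
    qed
  qed
qed

lemma zlist_act:
  assumes sp: "signed_perm m s \<pi>" and xs: "xs \<in> lists (pairs {1..m})"
  shows "poly_act m s \<pi> (zlist xs)
    = mconst (of_int (sign_val s xs)) * (zlist (map (map_prod \<pi> \<pi>) xs) :: 'k::field_char_0 gpoly)"
  using xs
proof (induction xs)
  case (Cons p xs)
  then have p: "fst p \<le> m" "snd p \<le> m" "fst p \<noteq> snd p" "fst p \<noteq> 0"
    by (auto simp: pairs_def)
  have "poly_act m s \<pi> (zlist (p # xs) :: 'k gpoly)
      = mconst (of_int (s (fst p))) * zeta (\<pi> (fst p)) (\<pi> (snd p))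
        * (mconst (of_int (sign_val s xs)) * zlist (map (map_prod \<pi> \<pi>) xs))"
    unfolding zlist_simps poly_act_simps zeta_act[OF sp p(1-3)] Cons.IH using p(4) by (simp add: sgn_const_def)
  then show ?case
    by (simp only: zlist_simps val_simps list.map fst_map_prod snd_map_prod of_int_mult mconst_mult mult_ac)
qed simp

lemma map_perm_pairs:
  assumes sp: "signed_perm m s \<pi>" and xs: "xs \<in> lists (pairs {1..m})"
  shows "map (map_prod \<pi> \<pi>) xs \<in> lists (pairs {1..m})"
    and "ucount (map (map_prod \<pi> \<pi>) xs) = ucount xs"
    and "wt (map (map_prod \<pi> \<pi>) xs) (\<pi> i) = wt xs i"
    and "wt0 xs \<Longrightarrow> wt0 (map (map_prod \<pi> \<pi>) xs)"
proof -
  note d = signed_permD[OF sp]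
  show "map (map_prod \<pi> \<pi>) xs \<in> lists (pairs {1..m})"
    using xs
  proof (induction xs)
    case (Cons p xs)
    then show ?case using d(2)[of "fst p"] d(2)[of "snd p"] d(3)[of "fst p" "snd p"] d(4)
      by (cases p) (auto simp: pairs_def)
  qed simp
  show "ucount (map (map_prod \<pi> \<pi>) xs) = ucount xs"
    by (induction xs) (auto simp: d(6))
  show wt: "wt (map (map_prod \<pi> \<pi>) xs) (\<pi> i) = wt xs i" for i
    by (induction xs) (auto simp: d(3))
  show "wt0 (map (map_prod \<pi> \<pi>) xs)" if "wt0 xs"
  proof
    fix i
    obtain j where "i = \<pi> j" using d(1) by (metis bij_pointE)
    then show "\<not> wt (map (map_prod \<pi> \<pi>) xs) i" using wt that by simp
  qed
qed

lemma poly_act_subspace: "mpol.subspace V \<Longrightarrow> mpol.subspace {f. poly_act m s \<pi> f \<in> V}"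
  by (auto simp: mpol.subspace_def)

lemma poly_act_zspan:
  fixes f :: "'k::field_char_0 gpoly"
  assumes sp: "signed_perm m s \<pi>" and f: "f \<in> zspan m Q"
    and Q: "\<And>xs. xs \<in> lists (pairs {1..m}) \<Longrightarrow> Q xs \<Longrightarrow> Q' (map (map_prod \<pi> \<pi>) xs)"
  shows "poly_act m s \<pi> f \<in> zspan m Q'"
proof -
  have "zspan m Q \<subseteq> {f :: 'k gpoly. poly_act m s \<pi> f \<in> zspan m Q'}"
  proof (rule zspan_minimal[OF poly_act_subspace[OF zspan_subspace]], rule CollectI)
    fix xs assume xs: "xs \<in> lists (pairs {1..m})" "Q xs"
    show "poly_act m s \<pi> (zlist xs :: 'k gpoly) \<in> zspan m Q'"
      unfolding zlist_act[OF sp xs(1)] using map_perm_pairs(1)[OF sp xs(1)] Q[OF xs]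
      by (intro mpol.subspace_scale[OF zspan_subspace] zspan_base)
  qed
  then show ?thesis using f by blast
qed

lemma poly_act_polyB:
  fixes f :: "'k::field_char_0 gpoly"
  shows "signed_perm m s \<pi> \<Longrightarrow> f \<in> carrier (polyB m) \<Longrightarrow> poly_act m s \<pi> f \<in> carrier (polyB m)"
  unfolding polyB_eq_zspan by (rule poly_act_zspan) auto

lemma zspan_eqI:
  assumes "\<And>f g. G (f + g) = G f + G g" "\<And>c f. G (mconst c * f) = mconst c * G f"
    and "\<And>f g. H (f + g) = H f + H g" "\<And>c f. H (mconst c * f) = mconst c * H f"
    and "\<And>xs. xs \<in> lists (pairs {1..m}) \<Longrightarrow> Q xs \<Longrightarrow> G (zlist xs) = (H (zlist xs) :: 'k::field gpoly)"
    and "(f :: 'k gpoly) \<in> zspan m Q"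
  shows "G f = H f"
proof -
  have "G 0 = 0" "H 0 = 0" using assms(1)[of 0 0] assms(3)[of 0 0] by simp_all
  then have "mpol.subspace {f. G f = H f}" by (auto simp: mpol.subspace_def assms(1-4))
  from zspan_minimal[OF this, of m Q] show ?thesis using assms(5,6) by blast
qed

text \<open>In the inverse of (s, \<pi>) the signs move along with the points, and each sign is its
  own inverse. The inverse shows that \<open>idealJ\<close> and the \<open>Uset\<close> are mapped
  onto themselves, so that images of cosets are full cosets.\<close>

lemma poly_act_inverse:
  fixes f :: "'k::field_char_0 gpoly"
  assumes sp: "signed_perm m s \<pi>" and f: "f \<in> carrier (polyB m)"
  defines "s' \<equiv> \<lambda>i. s (pinv \<pi> i)"
  shows "signed_perm m s' (pinv \<pi>)" and "poly_act m s \<pi> (poly_act m s' (pinv \<pi>) f) = f"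
proof -
  note d = signed_permD[OF sp]
  have p: "\<pi> permutes {1..m}" using sp by (simp add: signed_perm_def)
  have p': "pinv \<pi> permutes {1..m}" by (rule permutes_inv[OF p])
  show sp': "signed_perm m s' (pinv \<pi>)"
    unfolding signed_perm_def s'_def using p' d(5) permutes_in_image[OF p'] by blast
  show "poly_act m s \<pi> (poly_act m s' (pinv \<pi>) f) = f"
  proof (rule zspan_eqI[where H = "\<lambda>f. f" and m = m and Q = "\<lambda>_. True"])
    fix xs assume xs: "xs \<in> lists (pairs {1..m})"
    have mm: "map (map_prod \<pi> \<pi>) (map (map_prod (pinv \<pi>) (pinv \<pi>)) xs) = xs"
      using permutes_inverses(1)[OF p] by (simp add: map_prod_def case_prod_beta' map_idI)
    have "sign_val s' xs * sign_val s (map (map_prod (pinv \<pi>) (pinv \<pi>)) xs) = 1"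
      using xs
    proof (induction xs)
      case (Cons p xs)
      then have "pinv \<pi> (fst p) \<in> {1..m}" using permutes_in_image[OF p'] by (auto simp: pairs_def)
      then have "s' (fst p) * s (pinv \<pi> (fst p)) = 1" using d(5) unfolding s'_def by fastforce
      moreover have "sign_val s' (p # xs) * sign_val s (map (map_prod (pinv \<pi>) (pinv \<pi>)) (p # xs))
          = (s' (fst p) * s (pinv \<pi> (fst p))) * (sign_val s' xs * sign_val s (map (map_prod (pinv \<pi>) (pinv \<pi>)) xs))"
        by (simp add: mult_ac)
      ultimately show ?case using Cons.IH by (simp only: mult_1)
    qed simp
    then have "of_int (sign_val s' xs) * of_int (sign_val s (map (map_prod (pinv \<pi>) (pinv \<pi>)) xs)) = (1::'k)"
      by (metis of_int_1 of_int_mult)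
    then show "poly_act m s \<pi> (poly_act m s' (pinv \<pi>) (zlist xs :: 'k gpoly)) = zlist xs"
      by (simp add: zlist_act[OF sp' xs] zlist_act[OF sp map_perm_pairs(1)[OF sp' xs]] mm
          mult.assoc[symmetric] mconst_mult[symmetric] del: map_map)
  qed (use f in \<open>auto simp: polyB_eq_zspan\<close>)
qed

text \<open>Converse of \<open>pair_products\<close>: the given relations in terms of those for the
  \<open>zeta\<close>, on which the action is visible.\<close>

lemma pair_expansions:
  fixes a a' x y :: "'r::comm_ring_1"
  shows "x * (a' - a) - x * (a + a') - (a' - a) * (a + a')
      = (a * a - x * a) - (a' * a' - y * a') - (x * a + y * a')"
    and "x * (a' - a) - x * y - (a' - a) * y = - (x * y - a * y - a' * x) - (x * a + y * a')"
    and "x * y - x * (a + a') - y * (a + a') = (x * y - a * y - a' * x) - (x * a + y * a')"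
    and "(a' - a) * (a' - a)
      = (a * a - x * a) + (a' * a' - y * a') + (x * a + y * a') - (a * a' + a * a')"
    and "(a + a') * (a + a')
      = (a * a - x * a) + (a' * a' - y * a') + (x * a + y * a') + (a * a' + a * a')"
  by (simp_all add: algebra_simps)

text \<open>A sign change mixes the given relations, but takes a relation between the
  \<open>zeta\<close> to one of the same kind up to sign. So these are shown to lie in the ideal
  \<open>V\<close> of polynomials that the action sends to \<open>idealJ\<close>, and then the given
  ones as their combinations.\<close>

lemma poly_act_idealJ:
  fixes f :: "'k::field_char_0 gpoly"
  assumes sp: "signed_perm m s \<pi>" and f: "f \<in> idealJ m"
  shows "poly_act m s \<pi> f \<in> idealJ m"
proof -
  note d = signed_permD[OF sp]
  define V where "V = {f :: 'k gpoly. f \<in> carrier (polyB m) \<and> poly_act m s \<pi> f \<in> idealJ m}"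
  have V: "mpol.subspace V"
    unfolding V_def using mpol.subspace_inter[OF polyB_subspace poly_act_subspace[OF idealJ_subspace]]
    by (simp add: Int_def)
  note sV = subspaceD[OF V]
  let ?z = "zeta :: nat \<Rightarrow> nat \<Rightarrow> 'k gpoly" and ?s = "sgn_const s :: nat \<Rightarrow> 'k gpoly"
  have pol: "?z i j \<in> carrier (polyB m)" if "i \<le> m" "j \<le> m" "i \<noteq> j" for i j
    using that zeta_polyB[of i m j] by (cases "i = 0") auto
  note act = zeta_act[OF sp, where 'k = 'k]
  have ss: "?s i * ?s i = 1" if "i \<le> m" for i using sgn_const_sq[OF sp that] .
  \<comment> \<open>In the squares and the outgoing relations each sign occurs twice and cancels; in
    the incoming ones the same two signs occur in every term and factor out.\<close>
  have sq2: "(?s i * x) * (?s i * y) = x * y" if "i \<le> m" for i x y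
    using ss[OF that] by (simp add: algebra_simps)
  have sJ: "?s i * f \<in> idealJ m" if "f \<in> idealJ m" for i f
    using that unfolding sgn_const_def by auto
  have zero_sq: "?z i 0 * ?z i 0 \<in> V" if "1 \<le> i" "i \<le> m" for i
  proof -
    have "poly_act m s \<pi> (?z i 0 * ?z i 0) = ?z (\<pi> i) 0 * ?z (\<pi> i) 0"
      using that by (simp add: act sq2 d)
    then show ?thesis
      using that pol[of i 0] zeta_zero_sq[of "\<pi> i" m] d(2)[of i] by (auto simp: V_def)
  qed
  have opp: "?z i j * ?z j i \<in> V" if "1 \<le> i" "1 \<le> j" "i \<noteq> j" "i \<le> m" "j \<le> m" for i j
  proof -
    have "poly_act m s \<pi> (?z i j * ?z j i) = ?s i * (?s j * (?z (\<pi> i) (\<pi> j) * ?z (\<pi> j) (\<pi> i)))"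
      using that by (simp add: act mult_ac)
    then show ?thesis
      using that pol[of i j] pol[of j i] d(2)[of i] d(2)[of j] d(3)[of i j]
      by (auto simp: V_def intro!: sJ zeta_opposite)
  qed
  have sq: "?z i j * ?z i j - ?z i 0 * ?z i j \<in> V" if "1 \<le> i" "1 \<le> j" "i \<noteq> j" "i \<le> m" "j \<le> m" for i j
  proof -
    have "poly_act m s \<pi> (?z i j * ?z i j - ?z i 0 * ?z i j)
        = ?z (\<pi> i) (\<pi> j) * ?z (\<pi> i) (\<pi> j) - ?z (\<pi> i) 0 * ?z (\<pi> i) (\<pi> j)"
      using that by (simp add: act sq2 d(4))
    then show ?thesis
      using that pol[of i j] pol[of i 0] d(2)[of i] d(2)[of j] d(3)[of i j]
      by (auto simp: V_def intro!: zeta_sq polyB_diff polyB_mult)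
  qed
  have out: "?z i j * ?z i k + ?z j i * ?z j k + ?z k i * ?z k j \<in> V"
    if "i \<noteq> j" "j \<noteq> k" "i \<noteq> k" "i \<le> m" "j \<le> m" "k \<le> m" for i j k
  proof -
    have "poly_act m s \<pi> (?z i j * ?z i k + ?z j i * ?z j k + ?z k i * ?z k j)
      = ?z (\<pi> i) (\<pi> j) * ?z (\<pi> i) (\<pi> k) + ?z (\<pi> j) (\<pi> i) * ?z (\<pi> j) (\<pi> k) + ?z (\<pi> k) (\<pi> i) * ?z (\<pi> k) (\<pi> j)"
      using that by (simp add: act sq2)
    moreover have "\<dots> \<in> idealJ m"
      using that d(3,7) by (intro zeta_outgoing) auto
    moreover have "?z i j * ?z i k + ?z j i * ?z j k + ?z k i * ?z k j \<in> carrier (polyB m)"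
      using that by (intro polyB_add polyB_mult pol) auto
    ultimately show ?thesis unfolding V_def by simp
  qed
  have inc: "?z i k * ?z j k - ?z i j * ?z j k - ?z j i * ?z i k \<in> V"
    if "i \<noteq> j" "j \<noteq> k" "i \<noteq> k" "i \<le> m" "j \<le> m" "k \<le> m" for i j k
  proof -
    have "poly_act m s \<pi> (?z i k * ?z j k - ?z i j * ?z j k - ?z j i * ?z i k)
      = ?s i * (?s j * (?z (\<pi> i) (\<pi> k) * ?z (\<pi> j) (\<pi> k) - ?z (\<pi> i) (\<pi> j) * ?z (\<pi> j) (\<pi> k)
        - ?z (\<pi> j) (\<pi> i) * ?z (\<pi> i) (\<pi> k)))"
      using that by (simp only: poly_act_simps act right_diff_distrib mult_ac not_sym simp_thms)
    moreover have "\<dots> \<in> idealJ m"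
      using that d(3,7) by (intro sJ zeta_incoming) auto
    moreover have "?z i k * ?z j k - ?z i j * ?z j k - ?z j i * ?z i k \<in> carrier (polyB m)"
      using that by (intro polyB_diff polyB_mult pol) auto
    ultimately show ?thesis unfolding V_def by simp
  qed
  have pair: "u i * up i j - u i * um i j - up i j * um i j \<in> V" "u i * up i j - u i * u j - up i j * u j \<in> V"
    "u i * u j - u i * um i j - u j * um i j \<in> V" "up i j * up i j \<in> V" "um i j * um i j \<in> V"
    if ij: "1 \<le> i" "i < j" "j \<le> m" for i j
  proof -
    have e: "up i j = ?z j i - ?z i j" "um i j = ?z i j + ?z j i" "u i = ?z i 0" "u j = ?z j 0"
      using ij by (auto intro!: up_zeta um_zeta u_zeta)
    have o: "?z i 0 * ?z i j + ?z j 0 * ?z j i \<in> V" and n: "?z i 0 * ?z j 0 - ?z i j * ?z j 0 - ?z j i * ?z i 0 \<in> V"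
      and p: "?z i j * ?z j i \<in> V" and s1: "?z i j * ?z i j - ?z i 0 * ?z i j \<in> V"
      and s2: "?z j i * ?z j i - ?z j 0 * ?z j i \<in> V"
      using out[of i j 0] inc[of i j 0] opp[of i j] sq[of i j] sq[of j i] ij by (simp_all add: mult.commute)
    show "u i * up i j - u i * um i j - up i j * um i j \<in> V"
      unfolding e pair_expansions(1)[of _ _ _ "?z j 0"] by (intro sV(5) s1 s2 o)
    show "u i * up i j - u i * u j - up i j * u j \<in> V"
      unfolding e pair_expansions(2) by (intro sV(4) sV(5) n o)
    show "u i * u j - u i * um i j - u j * um i j \<in> V"
      unfolding e pair_expansions(3) by (intro sV(5) n o)
    show "up i j * up i j \<in> V"
      unfolding e pair_expansions(4)[of _ _ "?z i 0" "?z j 0"] by (intro sV(2) sV(5) s1 s2 o p)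
    show "um i j * um i j \<in> V"
      unfolding e pair_expansions(5)[of _ _ "?z i 0" "?z j 0"] by (intro sV(2) s1 s2 o p)
  qed
  have triple: "up i j * up j k - up i j * up i k - up i k * up j k \<in> V"
    "um i j * up j k - um i j * um i k - um i k * up j k \<in> V"
    "- (um i j * um j k) + um i j * up i k - up i k * um j k \<in> V"
    "- (up i j * um j k) + up i j * um i k - um i k * um j k \<in> V"
    if ijk: "1 \<le> i" "i < j" "j < k" "k \<le> m" for i j k
  proof -
    have e: "up i j = ?z j i - ?z i j" "up i k = ?z k i - ?z i k" "up j k = ?z k j - ?z j k"
      "um i j = ?z i j + ?z j i" "um i k = ?z i k + ?z k i" "um j k = ?z j k + ?z k j"
      using ijk by (auto intro!: up_zeta um_zeta)
    have A: "?z i j * ?z i k + ?z j i * ?z j k + ?z k i * ?z k j \<in> V"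
      and Bk: "?z i k * ?z j k - ?z i j * ?z j k - ?z j i * ?z i k \<in> V"
      and Bj: "?z i j * ?z k j - ?z i k * ?z k j - ?z k i * ?z i j \<in> V"
      and Bi: "?z j i * ?z k i - ?z j k * ?z k i - ?z k j * ?z j i \<in> V"
      using out[of i j k] inc[of i j k] inc[of i k j] inc[of j k i] ijk by simp_all
    show "up i j * up j k - up i j * up i k - up i k * up j k \<in> V"
      "um i j * up j k - um i j * um i k - um i k * up j k \<in> V"
      "- (um i j * um j k) + um i j * up i k - up i k * um j k \<in> V"
      "- (up i j * um j k) + up i j * um i k - um i k * um j k \<in> V"
      unfolding e arnold_products by (intro sV(2) sV(4) sV(5) A Bi Bj Bk)+
  qed
  have sing: "mvar a ^ 2 \<in> V" if "a \<in> gens m" for a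
    using that zero_sq pair(4,5) by (cases a) (auto simp: power2_eq_square u_zeta)
  have "relsB m \<subseteq> V"
    unfolding relsB_def by (safe; rule sing pair triple; assumption)
  moreover have "ideal V (polyB m)"
    using V by (rule polyB_idealI[rotated]) (auto simp: V_def intro: poly_act_polyB[OF sp])
  ultimately have "idealJ m \<subseteq> V"
    unfolding idealJ_def by (intro ring.genideal_minimal[OF cring.axioms(1)[OF cring_polyB]])
  then show ?thesis using f unfolding V_def by blast
qed

section \<open>Traces on the associated graded ring\<close>

lemma uideal_minimal:
  "ideal I (Yring m) \<Longrightarrow> (\<lambda>i. Ycls m (u i)) ` {1..m} \<subseteq> I \<Longrightarrow> uideal m \<subseteq> I"
  unfolding uideal_def by (rule ring.genideal_minimal[OF ring_Yring])

lemma Yact_Ycls: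
  fixes f :: "'k::field_char_0 gpoly"
  assumes sp: "signed_perm m s \<pi>" and f: "f \<in> carrier (polyB m)"
  shows "Yact m s \<pi> (Ycls m f) = Ycls m (poly_act m s \<pi> f)"
proof -
  have coset: "Ycls m g = (\<lambda>h. h + g) ` idealJ m" for g :: "'k gpoly"
    by (auto simp: Ycls_def a_r_coset_def')
  have "poly_act m s \<pi> ` idealJ m = (idealJ m :: 'k gpoly set)"
  proof
    show "poly_act m s \<pi> ` idealJ m \<subseteq> (idealJ m :: 'k gpoly set)"
      using poly_act_idealJ[OF sp] by blast
    show "(idealJ m :: 'k gpoly set) \<subseteq> poly_act m s \<pi> ` idealJ m"
    proof
      fix h :: "'k gpoly" assume h: "h \<in> idealJ m"
      note inv = poly_act_inverse[OF sp idealJ_subset[OF h]]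
      show "h \<in> poly_act m s \<pi> ` idealJ m"
        using poly_act_idealJ[OF inv(1) h] inv(2) by (metis image_eqI)
    qed
  qed
  then have "(\<lambda>h. h + poly_act m s \<pi> f) ` poly_act m s \<pi> ` idealJ m = Ycls m (poly_act m s \<pi> f)"
    unfolding coset by simp
  then show ?thesis unfolding Yact_def coset by (simp add: image_image)
qed

text \<open>Each u_i goes to a multiple of another generator u_j, so the ideal of the u's is
  preserved, and then its powers.\<close>

lemma poly_act_Uset:
  fixes f :: "'k::field_char_0 gpoly"
  assumes sp: "signed_perm m s \<pi>" and f: "f \<in> Uset m c"
  shows "poly_act m s \<pi> f \<in> Uset m c"
proof -
  note pact = poly_act_polyB[OF sp, where 'k = 'k]
  have zact: "poly_act m s \<pi> p \<in> preim m (uideal m)" if "p \<in> preim m (uideal m)" for p :: "'k gpoly"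
  proof -
    let ?T = "{f \<in> carrier (polyB m). poly_act m s \<pi> f \<in> preim m (uideal m)} :: 'k gpoly set"
    have id: "ideal (Ycls m ` ?T) (Yring m)"
    proof (rule Ycls_image_ideal)
      show "mpol.subspace ?T"
        using mpol.subspace_inter[OF polyB_subspace poly_act_subspace[OF preim_ideal(1)[OF uideal_ideal]]]
        by (simp add: Int_def)
    qed (auto intro: preim_ideal(2)[OF uideal_ideal] pact)
    have "(\<lambda>i. Ycls m (u i)) ` {1..m} \<subseteq> Ycls m ` ?T"
    proof (intro image_subsetI imageI CollectI conjI)
      fix i assume i: "i \<in> {1..m}"
      then show "u i \<in> carrier (polyB m)" by simp
      have "\<pi> i \<in> {1..m}" using signed_permD(2)[OF sp i] .
      then have "(u (\<pi> i) :: 'k gpoly) \<in> preim m (uideal m)"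
        unfolding preim_def uideal_def using ring.genideal_self[OF ring_Yring uideal_gens, of m] by auto
      from preim_ideal(2)[OF uideal_ideal polyB_mconst this]
      show "(poly_act m s \<pi> (u i) :: 'k gpoly) \<in> preim m (uideal m)"
        by (simp add: gen_act_U[OF sp i])
    qed
    then have le: "uideal m \<subseteq> Ycls m ` ?T"
      by (rule uideal_minimal[OF id])
    have "Ycls m p \<in> uideal m" using that by (simp add: preim_def)
    from subsetD[OF le this] obtain q where q: "q \<in> ?T" "Ycls m p = Ycls m q"
      by (rule imageE)
    then have "p - q \<in> idealJ m"
      using Ycls_eq_iff[of p m q] that by (auto simp: preim_def)
    then have "poly_act m s \<pi> p - poly_act m s \<pi> q \<in> preim m (uideal m)"
      using poly_act_idealJ[OF sp, of "p - q"] preim_ideal(4)[OF uideal_ideal] by auto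
    from mpol.subspace_add[OF preim_ideal(1)[OF uideal_ideal] this, of "poly_act m s \<pi> q"] q(1)
    show ?thesis by simp
  qed
  show ?thesis
    using f
  proof (induction c arbitrary: f)
    case 0
    then show ?case using pact by (auto simp: Uset_def preim_def Yring_repD(2))
  next
    case (Suc c)
    \<comment> \<open>The induction runs through classes, whereas the action is defined on
      polynomials: some representative is controlled, and any other differs from it by an element of
      \<open>idealJ\<close>.\<close>
    have key: "\<exists>q. q \<in> carrier (polyB m) \<and> y = Ycls m q \<and> poly_act m s \<pi> q \<in> Uset m (Suc c)"
      if "y \<in> ideal_prod (Yring m) (uideal m) (upow m c)" for y :: "'k gpoly set"
      using that
    proof (induction rule: ideal_prod.induct)
      case (prod x y)
      have "x \<in> Ycls m ` preim m (uideal m)" "y \<in> Ycls m ` Uset m c"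
        using prod by (simp_all only: preim_ideal(3)[OF uideal_ideal] Uset_ideal(3))
      then obtain p q where p: "p \<in> preim m (uideal m)" "x = Ycls m p" and q: "q \<in> Uset m c" "y = Ycls m q"
        by blast
      have pq: "p \<in> carrier (polyB m)" "q \<in> carrier (polyB m)"
        using p(1) Uset_polyB[OF q(1)] by (auto simp: preim_def)
      have "Ycls m (poly_act m s \<pi> p) \<otimes>\<^bsub>Yring m\<^esub> Ycls m (poly_act m s \<pi> q) \<in> upow m (Suc c)"
        using zact[OF p(1)] Suc.IH[OF q(1)] by (auto simp: Uset_def preim_def intro: ideal_prod.prod)
      then have "poly_act m s \<pi> (p * q) \<in> Uset m (Suc c)"
        using pact[OF pq(1)] pact[OF pq(2)] by (auto simp: Uset_def preim_def Yring_mult)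
      then show ?case
        using p(2) q(2) pq by (intro exI[of _ "p * q"]) (auto simp: Yring_mult)
    next
      case (sum x y)
      then obtain p q where h: "p \<in> carrier (polyB m)" "x = Ycls m p" "poly_act m s \<pi> p \<in> Uset m (Suc c)"
        "q \<in> carrier (polyB m)" "y = Ycls m q" "poly_act m s \<pi> q \<in> Uset m (Suc c)" by blast
      then show ?case
        using mpol.subspace_add[OF Uset_ideal(1) h(3,6)]
        by (intro exI[of _ "p + q"]) (auto simp: Yring_repD(4))
    qed
    have "Ycls m f \<in> ideal_prod (Yring m) (uideal m) (upow m c)"
      using Suc.prems by (simp add: Uset_def preim_def)
    from key[OF this] obtain q where q: "q \<in> carrier (polyB m)" "Ycls m f = Ycls m q"
      "poly_act m s \<pi> q \<in> Uset m (Suc c)" by blast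
    then have "f - q \<in> idealJ m"
      using Ycls_eq_iff[of f m q] Uset_polyB[OF Suc.prems] by auto
    then have "poly_act m s \<pi> f - poly_act m s \<pi> q \<in> Uset m (Suc c)"
      using poly_act_idealJ[OF sp, of "f - q"] Uset_ideal(4) by auto
    from mpol.subspace_add[OF Uset_ideal(1) this q(3)] show ?case by simp
  qed
qed

lemma gract_gcls:
  fixes f :: "'k::field_char_0 gpoly"
  assumes sp: "signed_perm m s \<pi>" and f: "f \<in> Uset m c"
  shows "gract m s \<pi> (gcls m c f) = gcls m c (poly_act m s \<pi> f)"
proof -
  have "poly_act m s \<pi> ` Uset m (Suc c) = (Uset m (Suc c) :: 'k gpoly set)"
  proof
    show "poly_act m s \<pi> ` Uset m (Suc c) \<subseteq> (Uset m (Suc c) :: 'k gpoly set)"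
      using poly_act_Uset[OF sp] by blast
    show "(Uset m (Suc c) :: 'k gpoly set) \<subseteq> poly_act m s \<pi> ` Uset m (Suc c)"
    proof
      fix h :: "'k gpoly" assume h: "h \<in> Uset m (Suc c)"
      note inv = poly_act_inverse[OF sp Uset_polyB[OF h]]
      show "h \<in> poly_act m s \<pi> ` Uset m (Suc c)"
        using poly_act_Uset[OF inv(1) h] inv(2) by (metis image_eqI)
    qed
  qed
  then have "gcls m c (poly_act m s \<pi> f)
      = (\<lambda>h. Ycls m (h + poly_act m s \<pi> f)) ` poly_act m s \<pi> ` Uset m (Suc c)"
    using gcls_image[OF poly_act_Uset[OF sp f]] by simp
  also have "\<dots> = Yact m s \<pi> ` (\<lambda>h. Ycls m (h + f)) ` Uset m (Suc c)"
    unfolding image_image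
    by (intro image_cong refl) (simp add: Yact_Ycls[OF sp] polyB_add Uset_polyB[OF f] Uset_polyB)
  finally show ?thesis
    unfolding gract_def gcls_image[OF f] by simp
qed

definition comp_span :: "nat \<Rightarrow> nat \<Rightarrow> nat \<Rightarrow> 'k::field gpoly set" where
  "comp_span m k l = zspan m (\<lambda>xs. length xs = k \<and> ucount xs + l = k)"

definition fix_span :: "nat \<Rightarrow> nat \<Rightarrow> nat \<Rightarrow> 'k::field gpoly set" where
  "fix_span m k l = zspan m (\<lambda>xs. (length xs = k \<and> ucount xs + l = k) \<and> wt0 xs)"

lemma comp_span_Uset: "(comp_span m k l :: 'k::field_char_0 gpoly set) \<subseteq> Uset m (k - l)"
  unfolding comp_span_def by (rule zspan_minimal[OF Uset_ideal(1)]) (auto intro: zlist_Uset)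

lemma fix_span_comp_span: "fix_span m k l \<subseteq> comp_span m k l"
  unfolding fix_span_def comp_span_def by (rule zspan_mono) blast

lemma sign_vectors_signed_perm: "s \<in> sign_vectors m \<Longrightarrow> signed_perm m s id"
  unfolding signed_perm_def sign_vectors_def using permutes_id by (auto dest: PiE_mem)

lemma card_sign_vectors: "card (sign_vectors m :: (nat \<Rightarrow> int) set) = 2 ^ m"
  using sum_sign_val[of "[]" m, where 'k = int] by (simp del: of_nat_power add: of_nat_power[symmetric])

text \<open>An invariant class is its own average over the sign changes, and the average of a
  representative is spanned by words of weight zero. Division by 2 ^ m uses characteristic
  zero.\<close>

lemma grYfix_eq:
  "grYfix m k l = gcls m (k - l) ` (fix_span m k l :: 'k::field_char_0 gpoly set)"
proof -
  let ?c = "k - l"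
  note spid = sign_vectors_signed_perm
  have B: "(fix_span m k l :: 'k gpoly set) \<subseteq> Uset m ?c"
    using fix_span_comp_span comp_span_Uset by blast
  have fixed: "poly_act m s id f = f"
    if s: "s \<in> sign_vectors m" and f: "f \<in> fix_span m k l" for s and f :: "'k gpoly"
  proof (rule zspan_eqI[OF _ _ _ _ _ f[unfolded fix_span_def], where H = "\<lambda>f. f"])
    fix xs assume xs: "xs \<in> lists (pairs {1..m})" "(length xs = k \<and> ucount xs + l = k) \<and> wt0 xs"
    have "sign_val s xs = 1"
      using sign_val_eq_prod[OF xs(1) sign_vectors_sq[OF s]] xs(2) by simp
    then show "poly_act m s id (zlist xs :: 'k gpoly) = zlist xs"
      by (simp add: zlist_act[OF spid[OF s] xs(1)] map_prod.id)
  qed auto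
  have avg: "\<exists>f0\<in>fix_span m k l. (\<Sum>s\<in>sign_vectors m. poly_act m s id f) = mconst (2 ^ m) * f0"
    if "f \<in> comp_span m k l" for f :: "'k gpoly"
  proof -
    let ?V = "{f :: 'k gpoly. \<exists>f0\<in>fix_span m k l. (\<Sum>s\<in>sign_vectors m. poly_act m s id f) = mconst (2 ^ m) * f0}"
    note sub = subspaceD[OF zspan_subspace, where Q1 = "\<lambda>xs. (length xs = k \<and> ucount xs + l = k) \<and> wt0 xs", folded fix_span_def]
    have "mpol.subspace ?V"
      unfolding mpol.subspace_def
    proof (intro conjI ballI allI)
      show "0 \<in> ?V" using sub(1) by (auto intro!: bexI[of _ 0])
    next
      fix f g assume "f \<in> ?V" "g \<in> ?V"
      then obtain f0 g0 where h: "f0 \<in> fix_span m k l" "g0 \<in> fix_span m k l"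
        "(\<Sum>s\<in>sign_vectors m. poly_act m s id f) = mconst (2 ^ m) * f0"
        "(\<Sum>s\<in>sign_vectors m. poly_act m s id g) = mconst (2 ^ m) * g0" by blast
      show "f + g \<in> ?V"
        by (rule CollectI, rule bexI[OF _ sub(2)[OF h(1,2)]]) (simp add: sum.distrib h(3,4) distrib_left)
    next
      fix c f assume "f \<in> ?V"
      then obtain f0 where h: "f0 \<in> fix_span m k l"
        "(\<Sum>s\<in>sign_vectors m. poly_act m s id f) = mconst (2 ^ m) * f0" by blast
      show "mconst c * f \<in> ?V"
        by (rule CollectI, rule bexI[OF _ sub(3)[OF h(1), of c]])
          (simp add: sum_distrib_left[symmetric] h(2) mult.left_commute)
    qed
    moreover have "zlist xs \<in> ?V" if xs: "xs \<in> lists (pairs {1..m})" "length xs = k \<and> ucount xs + l = k" for xs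
    proof -
      have "(\<Sum>s\<in>sign_vectors m. poly_act m s id (zlist xs :: 'k gpoly))
          = (\<Sum>s\<in>sign_vectors m. mconst (of_int (sign_val s xs)) * zlist xs)"
        by (intro sum.cong refl) (simp add: zlist_act[OF spid xs(1)] map_prod.id)
      also have "\<dots> = mconst (of_int (\<Sum>s\<in>sign_vectors m. sign_val s xs)) * zlist xs"
        by (simp add: sum_distrib_right mconst_sum)
      also have "\<dots> = mconst (2 ^ m) * (if wt0 xs then zlist xs else 0)"
        unfolding sum_sign_val[OF xs(1)] by (cases "wt0 xs") auto
      finally have "(\<Sum>s\<in>sign_vectors m. poly_act m s id (zlist xs :: 'k gpoly))
        = mconst (2 ^ m) * (if wt0 xs then zlist xs else 0)" .
      moreover have "(if wt0 xs then zlist xs else 0 :: 'k gpoly) \<in> fix_span m k l"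
        using xs sub(1) by (auto simp: fix_span_def intro: zspan_base)
      ultimately show ?thesis by blast
    qed
    ultimately have "comp_span m k l \<subseteq> ?V" unfolding comp_span_def by (rule zspan_minimal)
    then show ?thesis using that by blast
  qed
  show ?thesis
  proof
    show "gcls m ?c ` (fix_span m k l :: 'k gpoly set) \<subseteq> grYfix m k l"
    proof (rule image_subsetI)
      fix f :: "'k gpoly" assume f: "f \<in> fix_span m k l"
      have "gract m s id (gcls m ?c f) = gcls m ?c f" if "s \<in> sign_vectors m" for s
        using gract_gcls[OF spid[OF that] subsetD[OF B f]] fixed[OF that f] by simp
      then show "gcls m ?c f \<in> grYfix m k l"
        using f fix_span_comp_span unfolding grYfix_def grYcomp_eq sign_vectors_def comp_span_def by blast
    qed
    show "grYfix m k l \<subseteq> gcls m ?c ` (fix_span m k l :: 'k gpoly set)"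
    proof
      fix X :: "'k gpoly set set" assume "X \<in> grYfix m k l"
      then obtain f where f: "f \<in> comp_span m k l" "X = gcls m ?c f"
        and fx: "\<And>s. s \<in> sign_vectors m \<Longrightarrow> gract m s id X = X"
        unfolding grYfix_def grYcomp_eq sign_vectors_def comp_span_def by blast
      have fU: "f \<in> Uset m ?c" using f(1) comp_span_Uset by blast
      obtain f0 where f0: "f0 \<in> fix_span m k l" "(\<Sum>s\<in>sign_vectors m. poly_act m s id f) = mconst (2 ^ m) * f0"
        using avg[OF f(1)] by blast
      \<comment> \<open>Invariance of the class only says that a representative changes by an
        element of the next power of the ideal.\<close>
      have "poly_act m s id f - f \<in> Uset m (Suc ?c)" if "s \<in> sign_vectors m" for s
        using fx[OF that] gract_gcls[OF spid[OF that] fU] gcls_eq_iff[OF poly_act_Uset[OF spid[OF that] fU] fU]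
        unfolding f(2) by simp
      then have "(\<Sum>s\<in>sign_vectors m. poly_act m s id f - f) \<in> Uset m (Suc ?c)"
        by (intro mpol.subspace_sum[OF Uset_ideal(1)])
      also have "(\<Sum>s\<in>sign_vectors m. poly_act m s id f - f) = mconst (2 ^ m) * (f0 - f)"
      proof -
        have "of_nat (2 ^ m) = (mconst (of_nat (2 ^ m)) :: 'k gpoly)"
          by (simp only: mconst_of_nat)
        then show ?thesis
          by (simp add: sum_subtractf f0(2) card_sign_vectors right_diff_distrib)
      qed
      finally have "mconst (1 / 2 ^ m) * (mconst (2 ^ m) * (f0 - f)) \<in> Uset m (Suc ?c)"
        by (rule mpol.subspace_scale[OF Uset_ideal(1)])
      then have "f0 - f \<in> Uset m (Suc ?c)"
        by (simp add: mult.assoc[symmetric] mconst_mult[symmetric])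
      then have "gcls m ?c f0 = gcls m ?c f"
        using gcls_eq_iff[OF _ fU] f0(1) B by blast
      then show "X \<in> gcls m ?c ` fix_span m k l" using f0(1) f(2) by (metis image_eqI)
    qed
  qed
qed

section \<open>A basis of the invariants, and traces in it\<close>

definition words_of :: "nat list \<Rightarrow> nat \<Rightarrow> nat \<Rightarrow> (nat \<times> nat \<times> nat) list set" where
  "words_of L k l = {w \<in> basis_words L. length (flat w) = 2 * k \<and> ucount (flat w) + l = 2 * k}"

text \<open>Spanning comes from straightening, where words with more u's vanish in the graded piece;
  independence comes from the functions, as \<open>Uset\<close> lies in \<open>filt\<close>. The
  coordinates of a word are coefficients of its function.\<close>

lemma fix_span_frame:
  assumes L: "distinct L" "set L = {1..m}"
  obtains \<gamma> where "frame (fix_span m (2 * k) l) (Uset m (Suc (2 * k - l))) (words_of L k l)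
      (\<lambda>w. zlist (flat w) :: 'k::field_char_0 gpoly) \<gamma>"
    and "\<And>xs w. xs \<in> lists (pairs {1..m}) \<Longrightarrow> wt0 xs \<Longrightarrow> length xs = 2 * k \<Longrightarrow> ucount xs + l = 2 * k
      \<Longrightarrow> w \<in> words_of L k l \<Longrightarrow> \<gamma> (zlist xs) w = coef L (\<lambda>r. theta_val r xs) w"
proof -
  let ?B = "fix_span m (2 * k) l :: 'k gpoly set" and ?K = "Uset m (Suc (2 * k - l)) :: 'k gpoly set"
  let ?I = "words_of L k l" and ?p = "\<lambda>w. zlist (flat w) :: 'k gpoly"
  have L0: "0 \<notin> set L" using L by simp
  have I: "?I = {w \<in> basis_words L. length (flat w) = 2 * k \<and> ucount (flat w) = 2 * k - l}"
    if "l \<le> 2 * k" using that unfolding words_of_def by auto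
  have pB: "?p w \<in> ?B" if "w \<in> ?I" for w
    using that basis_words_flat[OF _ L(1) L0, of w] unfolding fix_span_def words_of_def L(2)
    by (intro zspan_base) auto
  have lead: "zlist xs - (\<Sum>w\<in>?I. mconst (coef L (\<lambda>r. theta_val r xs) w) * ?p w) \<in> ?K"
    if xs: "xs \<in> lists (pairs {1..m})" "wt0 xs" "length xs = 2 * k" "ucount xs + l = 2 * k" for xs
  proof -
    have l: "l \<le> 2 * k" "ucount xs = 2 * k - l" using xs(4) by auto
    obtain e where e: "e \<in> wspan L (\<lambda>ys. length ys = 2 * k \<and> Suc (2 * k - l) \<le> ucount ys)"
      and J: "(zlist xs - (\<Sum>w\<in>?I. mconst (coef L (\<lambda>r. theta_val r xs) w) * ?p w) - e) \<in> idealJ m"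
      using leading_coefficients(1)[OF L xs(1,2), where 'k = 'k] unfolding xs(3) l(2) I[OF l(1)] by blast
    have "zspan m (\<lambda>xs. (length xs = 2 * k \<and> Suc (2 * k - l) \<le> ucount xs) \<and> wt0 xs) \<subseteq> ?K"
      by (rule zspan_minimal[OF Uset_ideal(1)]) (auto intro: zlist_Uset)
    then have "e \<in> ?K" using e wspan_zspan[OF L] by blast
    from mpol.subspace_add[OF Uset_ideal(1) subsetD[OF Uset_ideal(4) J] this]
    show ?thesis by simp
  qed
  have ex: "\<forall>f\<in>?B. \<exists>c. f - (\<Sum>w\<in>?I. mconst (c w) * ?p w) \<in> ?K"
  proof -
    let ?V = "{f. \<exists>c. f - (\<Sum>w\<in>?I. mconst (c w) * ?p w) \<in> ?K}"
    note sK = subspaceD[OF Uset_ideal(1)[where m = m and c = "Suc (2 * k - l)"]]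
    have "mpol.subspace ?V"
      unfolding mpol.subspace_def
    proof (intro conjI ballI allI)
      show "0 \<in> ?V" using sK(1) by (auto intro!: exI[of _ "\<lambda>_. 0"])
    next
      fix f g assume "f \<in> ?V" "g \<in> ?V"
      then obtain c d where h: "f - (\<Sum>w\<in>?I. mconst (c w) * ?p w) \<in> ?K" "g - (\<Sum>w\<in>?I. mconst (d w) * ?p w) \<in> ?K"
        by blast
      have "(\<Sum>w\<in>?I. mconst (c w + d w) * ?p w) = (\<Sum>w\<in>?I. mconst (c w) * ?p w) + (\<Sum>w\<in>?I. mconst (d w) * ?p w)"
        by (simp only: mconst_add distrib_right sum.distrib)
      then have "f + g - (\<Sum>w\<in>?I. mconst (c w + d w) * ?p w)
          = (f - (\<Sum>w\<in>?I. mconst (c w) * ?p w)) + (g - (\<Sum>w\<in>?I. mconst (d w) * ?p w))"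
        by (simp only: add_diff_add)
      then have "f + g - (\<Sum>w\<in>?I. mconst (c w + d w) * ?p w) \<in> ?K"
        using sK(2)[OF h] by (simp only:)
      then show "f + g \<in> ?V" by (intro CollectI exI[of _ "\<lambda>w. c w + d w"])
    next
      fix a f assume "f \<in> ?V"
      then obtain c where h: "f - (\<Sum>w\<in>?I. mconst (c w) * ?p w) \<in> ?K" by blast
      have "mconst a * f - (\<Sum>w\<in>?I. mconst (a * c w) * ?p w) = mconst a * (f - (\<Sum>w\<in>?I. mconst (c w) * ?p w))"
        by (simp only: mconst_mult right_diff_distrib sum_distrib_left mult.assoc)
      then have "mconst a * f - (\<Sum>w\<in>?I. mconst (a * c w) * ?p w) \<in> ?K"
        using sK(3)[OF h, of a] by (simp only:)
      then show "mconst a * f \<in> ?V" by (intro CollectI exI[of _ "\<lambda>w. a * c w"])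
    qed
    moreover have "zlist xs \<in> ?V"
      if "xs \<in> lists (pairs {1..m})" "(length xs = 2 * k \<and> ucount xs + l = 2 * k) \<and> wt0 xs" for xs
      by (rule CollectI, rule exI, rule lead) (use that in auto)
    ultimately have "?B \<subseteq> ?V" unfolding fix_span_def by (rule zspan_minimal)
    then show ?thesis by blast
  qed
  from bchoice[OF ex] obtain \<gamma> where \<gamma>: "\<And>f. f \<in> ?B \<Longrightarrow> f - (\<Sum>w\<in>?I. mconst (\<gamma> f w) * ?p w) \<in> ?K"
    by blast
  have fr: "frame ?B ?K ?I ?p \<gamma>"
    unfolding frame_def
  proof (intro conjI ballI allI impI)
    show "finite ?I" by (simp add: words_of_def)
    fix c w assume c: "(\<Sum>w\<in>?I. mconst (c w) * ?p w) \<in> ?K" and w: "w \<in> ?I"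
    have l: "l \<le> 2 * k" using w by (auto simp: words_of_def)
    show "c w = 0"
      using graded_independent[OF L Uset_filt[OF c[unfolded I[OF l]]], of w] w unfolding I[OF l] by auto
  qed (use pB \<gamma> in blast)+
  show ?thesis
  proof (rule that[OF fr])
    fix xs w assume xs: "xs \<in> lists (pairs {1..m})" "wt0 xs" "length xs = 2 * k" "ucount xs + l = 2 * k" and w: "w \<in> ?I"
    have "zlist xs \<in> ?B" unfolding fix_span_def using xs by (intro zspan_base) auto
    from frame_unique[OF Uset_ideal(1) fr this lead[OF xs] w]
    show "\<gamma> (zlist xs) w = coef L (\<lambda>r. theta_val r xs) w" .
  qed
qed

text \<open>The trace of \<pi> on a graded piece, read off from the function model: diagonal
  coefficients of composition with \<pi>, at words of the given degree.\<close>

definition word_trace :: "nat list \<Rightarrow> (nat \<Rightarrow> nat) \<Rightarrow> nat \<Rightarrow> nat \<Rightarrow> 'k::field" where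
  "word_trace L \<pi> k l = (\<Sum>w\<in>words_of L k l. coef L (\<lambda>r. word_val (r \<circ> \<pi>) w) w)"

lemma theta_val_map:
  assumes "\<And>i. \<pi> i = 0 \<longleftrightarrow> i = 0"
  shows "theta_val r (map (map_prod \<pi> \<pi>) xs) = theta_val (r \<circ> \<pi>) xs"
  by (induction xs) (auto simp: theta_def assms)

lemma permutes_signed_perm: "\<pi> permutes {1..m} \<Longrightarrow> signed_perm m (\<lambda>_. 1) \<pi>"
  by (simp add: signed_perm_def)

lemma poly_act_lin_op:
  assumes sp: "signed_perm m s \<pi>"
  shows "lin_op (fix_span m k l) (Uset m c :: 'k::field_char_0 gpoly set) (poly_act m s \<pi>)"
  unfolding lin_op_def
proof (intro conjI allI ballI)
  fix f :: "'k gpoly"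
  show "poly_act m s \<pi> f \<in> fix_span m k l" if "f \<in> fix_span m k l"
    using that unfolding fix_span_def
    by (rule poly_act_zspan[OF sp]) (use map_perm_pairs[OF sp] in auto)
  show "poly_act m s \<pi> f \<in> Uset m c" if "f \<in> fix_span m k l \<inter> Uset m c"
    using that poly_act_Uset[OF sp] by blast
qed simp_all

lemma fix_trace_frame:
  assumes fr: "frame (fix_span m k l) (Uset m (Suc (k - l))) I p (\<gamma> :: 'k::field_char_0 gpoly \<Rightarrow> _)"
    and \<pi>: "\<pi> permutes {1..m}"
  shows "trace_on (grY m (k - l)) (grYfix m k l) (gract m (\<lambda>_. 1) \<pi>)
    = (\<Sum>i\<in>I. \<gamma> (poly_act m (\<lambda>_. 1) \<pi> (p i)) i)"
  unfolding grYfix_eq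
proof (rule trace_on_frame[OF lin_rep_grY _ _ Uset_ideal(1) gcls_eq_iff fr poly_act_lin_op])
  show sp: "signed_perm m (\<lambda>_. 1) \<pi>" by (rule permutes_signed_perm[OF \<pi>])
  show "fix_span m k l \<subseteq> (Uset m (k - l) :: 'k gpoly set)"
    using fix_span_comp_span comp_span_Uset by blast
  then show "gract m (\<lambda>_. 1) \<pi> (gcls m (k - l) f) = gcls m (k - l) (poly_act m (\<lambda>_. 1) \<pi> f)"
    if "f \<in> fix_span m k l" for f :: "'k gpoly"
    using gract_gcls[OF sp] that by blast
qed (simp_all add: fix_span_def zspan_subspace)

text \<open>With all signs 1 the action only renames indices, and a renamed word has the function of
  the old one at r \<circ> \<pi>. As the left side does not mention \<open>L\<close>, the order of
  the points can be chosen at will.\<close>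

lemma trace_eq_word_trace:
  assumes L: "distinct L" "set L = {1..m}" and \<pi>: "\<pi> permutes {1..m}"
  shows "trace_on (grY m (2 * k - l)) (grYfix m (2 * k) l) (gract m (\<lambda>_. 1) \<pi>)
    = (word_trace L \<pi> k l :: 'k::field_char_0)"
proof -
  note sp = permutes_signed_perm[OF \<pi>]
  have L0: "0 \<notin> set L" using L by simp
  obtain \<gamma> where fr: "frame (fix_span m (2 * k) l) (Uset m (Suc (2 * k - l))) (words_of L k l)
      (\<lambda>w. zlist (flat w) :: 'k gpoly) \<gamma>"
    and \<gamma>: "\<And>xs w. xs \<in> lists (pairs {1..m}) \<Longrightarrow> wt0 xs \<Longrightarrow> length xs = 2 * k \<Longrightarrow> ucount xs + l = 2 * k
      \<Longrightarrow> w \<in> words_of L k l \<Longrightarrow> \<gamma> (zlist xs) w = coef L (\<lambda>r. theta_val r xs) w"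
    by (rule fix_span_frame[OF L, of k l, where 'k = 'k]) blast
  have one: "sign_val (\<lambda>_. 1 :: int) xs = 1" for xs by (induction xs) auto
  have "\<gamma> (poly_act m (\<lambda>_. 1) \<pi> (zlist (flat w))) w = coef L (\<lambda>r. word_val (r \<circ> \<pi>) w) w"
    if w: "w \<in> words_of L k l" for w
  proof -
    have f: "flat w \<in> lists (pairs {1..m})" "wt0 (flat w)" "length (flat w) = 2 * k" "ucount (flat w) + l = 2 * k"
      using w basis_words_flat[OF _ L(1) L0, of w] unfolding words_of_def L(2) by auto
    note mp = map_perm_pairs[OF sp f(1)]
    have "\<gamma> (zlist (map (map_prod \<pi> \<pi>) (flat w))) w = coef L (\<lambda>r. theta_val r (map (map_prod \<pi> \<pi>) (flat w))) w"
      by (rule \<gamma>[OF mp(1) mp(4)[OF f(2)] _ _ w]) (use f mp(2) in auto)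
    then show ?thesis
      by (simp add: zlist_act[OF sp f(1)] one theta_val_map signed_permD(6)[OF sp] word_val_def)
  qed
  then show ?thesis
    unfolding fix_trace_frame[OF fr \<pi>] word_trace_def by (intro sum.cong) auto
qed

lemma poly_act_comp:
  fixes f :: "'k::field_char_0 gpoly"
  assumes \<pi>: "\<pi> permutes {1..m}" and \<tau>: "\<tau> permutes {1..m}" and f: "f \<in> carrier (polyB m)"
  shows "poly_act m (\<lambda>_. 1) \<tau> (poly_act m (\<lambda>_. 1) \<pi> f) = poly_act m (\<lambda>_. 1) (\<tau> \<circ> \<pi>) f"
proof (rule zspan_eqI[where m = m and Q = "\<lambda>_. True"
      and G = "\<lambda>f. poly_act m (\<lambda>_. 1) \<tau> (poly_act m (\<lambda>_. 1) \<pi> f)" and H = "poly_act m (\<lambda>_. 1) (\<tau> \<circ> \<pi>)"])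
  note sp = permutes_signed_perm[OF \<pi>] permutes_signed_perm[OF \<tau>]
    permutes_signed_perm[OF permutes_compose[OF \<pi> \<tau>]]
  have one: "sign_val (\<lambda>_. 1 :: int) xs = 1" for xs by (induction xs) auto
  fix xs assume xs: "xs \<in> lists (pairs {1..m})"
  show "poly_act m (\<lambda>_. 1) \<tau> (poly_act m (\<lambda>_. 1) \<pi> (zlist xs :: 'k gpoly))
    = poly_act m (\<lambda>_. 1) (\<tau> \<circ> \<pi>) (zlist xs)"
  proof -
    have "map (map_prod \<tau> \<tau>) (map (map_prod \<pi> \<pi>) xs) = map (map_prod (\<tau> \<circ> \<pi>) (\<tau> \<circ> \<pi>)) xs"
      by (induction xs) auto
    then show ?thesis
      by (simp only: zlist_act[OF sp(1) xs] zlist_act[OF sp(3) xs] one of_int_1 mconst_1 mult_1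
          zlist_act[OF sp(2) map_perm_pairs(1)[OF sp(1) xs]])
  qed
qed (use f in \<open>auto simp: polyB_eq_zspan\<close>)

text \<open>The words depend on the order of the points, so conjugation does not simply rename the
  basis. The reason is that tr (G H) = tr (H G), with \<tau> acting by one factor and \<pi> after
  the inverse of \<tau> by the other.\<close>

lemma word_trace_conjugate:
  assumes L: "distinct L" "set L = {1..m}" and \<pi>: "\<pi> permutes {1..m}" and \<tau>: "\<tau> permutes {1..m}"
  shows "(word_trace L (\<tau> \<circ> \<pi> \<circ> inv_into UNIV \<tau>) k l :: 'k::field_char_0) = word_trace L \<pi> k l"
proof -
  have \<tau>': "pinv \<tau> permutes {1..m}" by (rule permutes_inv[OF \<tau>])
  note \<rho> = permutes_compose[OF \<tau>' \<pi>]
  let ?B = "fix_span m (2 * k) l :: 'k gpoly set" and ?K = "Uset m (Suc (2 * k - l)) :: 'k gpoly set"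
  obtain \<gamma> where fr: "frame ?B ?K (words_of L k l) (\<lambda>w. zlist (flat w)) \<gamma>"
    by (rule fix_span_frame[OF L, of k l, where 'k = 'k]) blast
  have p: "(zlist (flat w) :: 'k gpoly) \<in> carrier (polyB m)" if "w \<in> words_of L k l" for w
    using that fr fix_span_comp_span comp_span_Uset Uset_polyB unfolding frame_def by blast
  have B: "mpol.subspace ?B" by (simp add: fix_span_def zspan_subspace)
  let ?act = "\<lambda>\<pi>. poly_act m (\<lambda>_. 1) \<pi> :: 'k gpoly \<Rightarrow> _"
  have "(\<Sum>w\<in>words_of L k l. \<gamma> (?act \<tau> (?act (\<pi> \<circ> pinv \<tau>) (zlist (flat w)))) w)
      = (\<Sum>w\<in>words_of L k l. \<gamma> (?act (\<pi> \<circ> pinv \<tau>) (?act \<tau> (zlist (flat w)))) w)"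
    by (rule frame_trace_commute[OF B Uset_ideal(1) fr poly_act_lin_op poly_act_lin_op])
      (rule permutes_signed_perm[OF \<tau>] permutes_signed_perm[OF \<rho>])+
  moreover have "?act \<tau> (?act (\<pi> \<circ> pinv \<tau>) (zlist (flat w))) = ?act (\<tau> \<circ> \<pi> \<circ> pinv \<tau>) (zlist (flat w))"
    if "w \<in> words_of L k l" for w
    using poly_act_comp[OF \<rho> \<tau> p[OF that]] by (simp add: comp_assoc)
  moreover have "?act (\<pi> \<circ> pinv \<tau>) (?act \<tau> (zlist (flat w))) = ?act \<pi> (zlist (flat w))"
    if "w \<in> words_of L k l" for w
    using poly_act_comp[OF \<tau> \<rho> p[OF that]] permutes_inv_o(2)[OF \<tau>] by (simp add: comp_assoc)
  ultimately show ?thesis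
    unfolding trace_eq_word_trace[OF L \<pi>, symmetric]
      trace_eq_word_trace[OF L permutes_compose[OF \<tau>' permutes_compose[OF \<pi> \<tau>]], symmetric]
      fix_trace_frame[OF fr \<pi>] fix_trace_frame[OF fr permutes_compose[OF \<tau>' permutes_compose[OF \<pi> \<tau>]]]
    by simp
qed

section \<open>Recursion for the word traces\<close>

text \<open>If the value at \<open>n\<close> exceeds all others, every word beginning with a letter
  for \<open>n\<close> vanishes, while the function, which ignores \<open>n\<close>, is
  unchanged.\<close>

lemma is_coef_tail:
  fixes F :: "(nat \<Rightarrow> real) \<Rightarrow> 'k::field"
  assumes nT: "distinct (n # T)" "0 \<notin> set (n # T)" and c: "is_coef (n # T) F c"
    and F: "\<And>r r'. (\<And>i. i \<in> set T \<Longrightarrow> r i = r' i) \<Longrightarrow> F r = F r'"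
  shows "is_coef T F c"
  unfolding is_coef_def
proof (intro allI impI)
  fix r :: "nat \<Rightarrow> real" assume r: "inj_on r (set T)"
  define t where "t = Max (insert 0 (r ` set T)) + 1"
  have t: "r a < t" if "a \<in> set T" for a
  proof -
    have "r a \<le> Max (insert 0 (r ` set T))" using that by (intro Max_ge) auto
    then show ?thesis by (simp add: t_def)
  qed
  define r' where "r' = r(n := t)"
  have ag: "r' i = r i" if "i \<in> set T" for i using that nT by (auto simp: r'_def)
  have "inj_on r' (set (n # T))"
    using r t nT by (auto simp: inj_on_def r'_def dest: less_imp_neq)
  then have "F r' = (\<Sum>w\<in>basis_words (n # T). c w * word_val r' w)"
    using c unfolding is_coef_def by blast
  also have "\<dots> = (\<Sum>w\<in>basis_words T. c w * word_val r' w)"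
  proof -
    have "theta r' a n = (0 :: 'k)" if "a \<in> set T" for a
      using t[OF that] that nT by (auto simp: theta_def r'_def)
    then show ?thesis unfolding sum_basis_words[OF nT(1)] by simp
  qed
  also have "\<dots> = (\<Sum>w\<in>basis_words T. c w * word_val r w)"
    using nT ag by (intro sum.cong refl arg_cong2[where f = "(*)"] word_val_agree[where L = T]) auto
  finally show "F r = (\<Sum>w\<in>basis_words T. c w * word_val r w)"
    using F[of r' r] ag by simp
qed

text \<open>Expansions are available for index sets {1..m}. The missing points are listed in front
  of \<open>L\<close>, where \<open>is_coef_tail\<close> strips them one by one.\<close>

lemma is_coef_exists:
  assumes L: "distinct L" "0 \<notin> set L" and xs: "xs \<in> lists (pairs (set L))" "wt0 xs"
  shows "\<exists>c. is_coef L (\<lambda>r. theta_val r xs :: 'k::field_char_0) c"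
proof -
  define m where "m = Max (insert 0 (set L))"
  have Lm: "set L \<subseteq> {1..m}"
    using L(2) unfolding m_def by (auto simp: Suc_le_eq intro!: Max_ge gr0I)
  have "\<exists>R. distinct R \<and> set R = {1..m} - set L"
    using finite_distinct_list[of "{1..m} - set L"] by auto
  then obtain R where R: "distinct R" "set R = {1..m} - set L" by blast
  have RL: "distinct (R @ L)" "set (R @ L) = {1..m}" using R L Lm by auto
  have "xs \<in> lists (pairs {1..m})" using xs(1) lists_mono[OF pairs_mono[OF Lm]] by blast
  from leading_coefficients(2)[OF RL this xs(2)]
  have "\<exists>c. is_coef (R @ L) (\<lambda>r. theta_val r xs :: 'k) c" by blast
  moreover have "0 \<notin> set (R @ L)" using RL by simp
  ultimately show ?thesis
    using RL(1)
  proof (induction R)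
    case (Cons n R)
    obtain c where c: "is_coef (n # (R @ L)) (\<lambda>r. theta_val r xs :: 'k) c" using Cons.prems by auto
    have sub: "xs \<in> lists (pairs (set (R @ L)))"
      using xs(1) lists_mono[OF pairs_mono[of "set L" "set (R @ L)"]] by auto
    have "is_coef (R @ L) (\<lambda>r. theta_val r xs :: 'k) c"
    proof (rule is_coef_tail[OF _ _ c])
      show "theta_val r xs = (theta_val r' xs :: 'k)" if "\<And>i. i \<in> set (R @ L) \<Longrightarrow> r i = r' i" for r r'
        by (rule theta_val_agree[OF sub that])
    qed (use Cons.prems in auto)
    with Cons.prems show ?case by (intro Cons.IH) auto
  qed simp
qed

lemma is_coef_extend:
  assumes nT: "distinct (n # T)" and c: "is_coef T F c"
  shows "is_coef (n # T) F (\<lambda>w. if w \<in> basis_words T then c w else 0)"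
  unfolding is_coef_def
proof (intro allI impI)
  fix r :: "nat \<Rightarrow> real" assume "inj_on r (set (n # T))"
  then have "F r = (\<Sum>w\<in>basis_words T. c w * word_val r w)"
    using c unfolding is_coef_def by (auto intro: inj_on_subset)
  also have "\<dots> = (\<Sum>w\<in>basis_words (n # T). (if w \<in> basis_words T then c w else 0) * word_val r w)"
    by (rule sum.mono_neutral_cong_left) auto
  finally show "F r = (\<Sum>w\<in>basis_words (n # T). (if w \<in> basis_words T then c w else 0) * word_val r w)" .
qed

text \<open>Multiplication by the function of a letter carries an expansion into a single block,
  without any relation; this is what makes the traces computable.\<close>

lemma is_coef_Cons:
  assumes nT: "distinct (n # T)" and a: "a \<in> set T" and b: "b \<in> insert 0 (set T) - {a}"
    and c: "is_coef (remove1 a T) F c"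
  shows "is_coef (n # T) (\<lambda>r. theta r a n * theta r a b * F r)
    (\<lambda>w. if w \<in> (#) (a, n, b) ` basis_words (remove1 a T) then c (tl w) else 0)"
  unfolding is_coef_def
proof (intro allI impI)
  fix r :: "nat \<Rightarrow> real" assume r: "inj_on r (set (n # T))"
  let ?I = "(#) (a, n, b) ` basis_words (remove1 a T)"
  have "set (remove1 a T) \<subseteq> set (n # T)" using set_remove1_subset by fastforce
  then have "F r = (\<Sum>w\<in>basis_words (remove1 a T). c w * word_val r w)"
    using c r inj_on_subset unfolding is_coef_def by blast
  then have "theta r a n * theta r a b * F r
      = (\<Sum>w\<in>basis_words (remove1 a T). c w * word_val r ((a, n, b) # w))"
    by (simp add: sum_distrib_left mult_ac)
  also have "\<dots> = (\<Sum>w\<in>?I. c (tl w) * word_val r w)"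
    by (subst sum.reindex) auto
  also have "\<dots> = (\<Sum>w\<in>basis_words (n # T). (if w \<in> ?I then c (tl w) else 0) * word_val r w)"
    by (rule sum.mono_neutral_cong_left) (use a b in auto)
  finally show "theta r a n * theta r a b * F r
      = (\<Sum>w\<in>basis_words (n # T). (if w \<in> ?I then c (tl w) else 0) * word_val r w)" .
qed

lemma word_coef_exists:
  assumes L: "distinct L" "0 \<notin> set L" "distinct L'" "0 \<notin> set L'"
    and \<pi>: "inj \<pi>" "\<pi> 0 = 0" "\<pi> ` set L = set L'" and w: "w \<in> basis_words L"
  shows "\<exists>c. is_coef L' (\<lambda>r. word_val (r \<circ> \<pi>) w :: 'k::field_char_0) c"
proof -
  have z: "\<pi> i = 0 \<longleftrightarrow> i = 0" for i using \<pi>(1,2) by (metis injD)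
  note f = basis_words_flat[OF w L(1,2)]
  have sub: "map (map_prod \<pi> \<pi>) xs \<in> lists (pairs (set L'))" if "xs \<in> lists (pairs (set L))" for xs
    using that
  proof (induction xs)
    case (Cons p xs)
    then show ?case using \<pi>(3) injD[OF \<pi>(1), of "fst p" "snd p"] \<pi>(2)
      by (cases p) (auto simp: pairs_def)
  qed simp
  have wt: "wt (map (map_prod \<pi> \<pi>) xs) (\<pi> i) = wt xs i" for xs i
    by (induction xs) (auto simp: inj_eq[OF \<pi>(1)])
  have "wt0 (map (map_prod \<pi> \<pi>) (flat w))"
  proof
    fix i
    show "\<not> wt (map (map_prod \<pi> \<pi>) (flat w)) i"
    proof (cases "i \<in> set L'")
      case True
      then obtain j where "i = \<pi> j" using \<pi>(3) by blast
      then show ?thesis using wt f(2) by simp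
    qed (rule wt_outside[OF sub[OF f(1)]])
  qed
  from is_coef_exists[OF L(3,4) sub[OF f(1)] this, where 'k = 'k]
  show ?thesis by (simp add: theta_val_map[OF z] word_val_def)
qed

definition in_degree :: "nat \<Rightarrow> nat \<Rightarrow> (nat \<times> nat \<times> nat) list \<Rightarrow> bool" where
  "in_degree k l w \<longleftrightarrow> length (flat w) = 2 * k \<and> ucount (flat w) + l = 2 * k"

lemma word_trace_alt:
  "word_trace L \<pi> k l = (\<Sum>w\<in>basis_words L. if in_degree k l w then coef L (\<lambda>r. word_val (r \<circ> \<pi>) w) w else 0)"
  unfolding word_trace_def words_of_def in_degree_def by (rule sum.inter_filter) simp

text \<open>A letter adds two generators, one of them a u if b = 0; so it contributes t q in that
  case and t q^2 otherwise. As the u's of \<open>w\<close> are at most its length,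
  \<open>l - d\<close> is a true difference.\<close>

lemma in_degree_Cons:
  assumes "n \<noteq> 0"
  shows "in_degree k l ((a, n, b) # w) \<longleftrightarrow>
    (let d = if b = 0 then 1 else 2 in k \<noteq> 0 \<and> d \<le> l \<and> in_degree (k - 1) (l - d) w)"
  using assms ucount_le_length[of "flat w"] by (cases k) (auto simp: in_degree_def Let_def)

text \<open>Since \<pi> fixes \<open>n\<close>, it carries the block of (a, n, b) to that of (\<pi>
  a, n, \<pi> b), so only blocks with \<open>a\<close> and \<open>b\<close> fixed meet the diagonal.
  The index b = 0 is always fixed; the others produce the number of fixed points besides
  \<open>a\<close>.\<close>

lemma word_trace_Cons:
  assumes nT: "distinct (n # T)" "0 \<notin> set (n # T)" and \<pi>: "\<pi> permutes set T"
  shows "(word_trace (n # T) \<pi> k l :: 'k::field_char_0) = word_trace T \<pi> k l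
    + (if k = 0 \<or> l < 1 then 0 else
        \<Sum>a\<in>{a \<in> set T. \<pi> a = a}. word_trace (remove1 a T) \<pi> (k - 1) (l - 1))
    + (if k = 0 \<or> l < 2 then 0 else
        \<Sum>a\<in>{a \<in> set T. \<pi> a = a}. of_nat (card {b \<in> set T - {a}. \<pi> b = b}) * word_trace (remove1 a T) \<pi> (k - 1) (l - 2))"
proof -
  have inj: "inj \<pi>" by (rule permutes_inj[OF \<pi>])
  have \<pi>n: "\<pi> n = n" using permutes_not_in[OF \<pi>] nT by simp
  have \<pi>0: "\<pi> 0 = 0" using permutes_not_in[OF \<pi>] nT by simp
  have \<pi>eq: "\<pi> i = \<pi> j \<longleftrightarrow> i = j" for i j using inj by (simp add: inj_eq)
  have \<pi>z: "\<pi> i = 0 \<longleftrightarrow> i = 0" for i using \<pi>eq[of i 0] \<pi>0 by simp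
  have \<pi>T: "\<pi> ` set T = set T" by (rule permutes_image[OF \<pi>])
  have dT: "distinct T" "0 \<notin> set T" using nT by auto
  let ?F = "\<lambda>w r. word_val (r \<circ> \<pi>) w :: 'k"
  have tail: "coef (n # T) (?F w) w = coef T (?F w) w" if w: "w \<in> basis_words T" for w
  proof -
    obtain c where c: "is_coef T (?F w) c"
      using word_coef_exists[OF dT dT inj \<pi>0 \<pi>T w, where 'k = 'k] by blast
    show ?thesis
      using coef_eq[OF nT is_coef_extend[OF nT(1) c], of w] coef_eq[OF dT c w] w by simp
  qed
  have head: "coef (n # T) (?F ((a, n, b) # v)) ((a, n, b) # v)
      = (if \<pi> a = a \<and> \<pi> b = b then coef (remove1 a T) (?F v) v else 0)"
    if a: "a \<in> set T" and b: "b \<in> insert 0 (set T) - {a}" and v: "v \<in> basis_words (remove1 a T)" for a b v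
  proof -
    have sets: "set (remove1 x T) = set T - {x}" "distinct (remove1 x T)" "0 \<notin> set (remove1 x T)" for x
      using dT by auto
    have \<pi>a: "\<pi> a \<in> set T" and \<pi>b: "\<pi> b \<in> insert 0 (set T) - {\<pi> a}"
      using a b \<pi>T \<pi>0 \<pi>eq by auto
    have "\<pi> ` set (remove1 a T) = set (remove1 (\<pi> a) T)"
      unfolding sets using \<pi>T by (simp add: image_set_diff[OF inj])
    from word_coef_exists[OF sets(2,3) sets(2,3) inj \<pi>0 this v, where 'k = 'k]
    obtain c where c: "is_coef (remove1 (\<pi> a) T) (?F v) c" by blast
    have F: "?F ((a, n, b) # v) = (\<lambda>r. theta r (\<pi> a) n * theta r (\<pi> a) (\<pi> b) * ?F v r)"
      by (simp add: fun_eq_iff theta_def \<pi>n \<pi>z)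
    have w: "(a, n, b) # v \<in> basis_words (n # T)" using a b v by auto
    have "coef (n # T) (?F ((a, n, b) # v)) ((a, n, b) # v)
        = (if (a, n, b) # v \<in> (#) (\<pi> a, n, \<pi> b) ` basis_words (remove1 (\<pi> a) T) then c v else 0)"
      unfolding F using coef_eq[OF nT is_coef_Cons[OF nT(1) \<pi>a \<pi>b c] w] by simp
    also have "\<dots> = (if \<pi> a = a \<and> \<pi> b = b then c v else 0)"
      using v by (auto simp: image_iff)
    also have "\<dots> = (if \<pi> a = a \<and> \<pi> b = b then coef (remove1 a T) (?F v) v else 0)"
      using coef_eq[OF sets(2,3) c] v by auto
    finally show ?thesis .
  qed
  \<comment> \<open>Outside the range in \<open>in_degree_Cons\<close> no word contributes, so the
    value is 0 instead of a trace at a truncated index.\<close>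
  define S where "S d a = (if k = 0 \<or> l < d then 0 else word_trace (remove1 a T) \<pi> (k - 1) (l - d) :: 'k)" for d a
  have n0: "n \<noteq> 0" using nT by auto
  have inner: "(\<Sum>v\<in>basis_words (remove1 a T). if in_degree k l ((a, n, b) # v)
        then coef (n # T) (?F ((a, n, b) # v)) ((a, n, b) # v) else 0)
      = (if \<pi> a = a \<and> \<pi> b = b then S (if b = 0 then 1 else 2) a else 0)"
    if a: "a \<in> set T" and b: "b \<in> insert 0 (set T) - {a}" for a b
  proof -
    have "(\<Sum>v\<in>basis_words (remove1 a T). if in_degree k l ((a, n, b) # v)
        then coef (n # T) (?F ((a, n, b) # v)) ((a, n, b) # v) else 0)
      = (\<Sum>v\<in>basis_words (remove1 a T). if in_degree k l ((a, n, b) # v)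
        then (if \<pi> a = a \<and> \<pi> b = b then coef (remove1 a T) (?F v) v else 0) else 0)"
      by (intro sum.cong refl) (simp only: head[OF a b])
    also have "\<dots> = (if \<pi> a = a \<and> \<pi> b = b then S (if b = 0 then 1 else 2) a else 0)"
      by (auto simp: in_degree_Cons[OF n0] S_def word_trace_alt Let_def intro!: sum.neutral sum.cong)
    finally show ?thesis .
  qed
  have outer: "(\<Sum>b\<in>insert 0 (set T) - {a}. if \<pi> a = a \<and> \<pi> b = b then S (if b = 0 then 1 else 2) a else 0)
      = (if \<pi> a = a then S 1 a + of_nat (card {b \<in> set T - {a}. \<pi> b = b}) * S 2 a else 0)"
    if a: "a \<in> set T" for a
  proof -
    have "a \<noteq> 0" using a dT by metis
    then have i: "insert 0 (set T) - {a} = insert 0 (set T - {a})" by auto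
    have "(\<Sum>b\<in>set T - {a}. if \<pi> b = b then S (if b = 0 then 1 else 2) a else 0)
        = (\<Sum>b\<in>set T - {a}. if \<pi> b = b then S 2 a else 0)"
    proof (rule sum.cong[OF refl])
      fix b assume "b \<in> set T - {a}"
      then have "b \<noteq> 0" using dT(2) by (metis DiffD1)
      then show "(if \<pi> b = b then S (if b = 0 then 1 else 2) a else 0) = (if \<pi> b = b then S 2 a else 0)"
        by simp
    qed
    also have "\<dots> = (\<Sum>b\<in>{b \<in> set T - {a}. \<pi> b = b}. S 2 a)"
      by (rule sum.inter_filter[symmetric]) simp
    finally have "(\<Sum>b\<in>set T - {a}. if \<pi> b = b then S (if b = 0 then 1 else 2) a else 0)
        = (\<Sum>b\<in>{b \<in> set T - {a}. \<pi> b = b}. S 2 a)" .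
    then show ?thesis
      unfolding i using dT by (subst sum.insert) (auto simp: \<pi>0)
  qed
  have "word_trace (n # T) \<pi> k l = (\<Sum>w\<in>basis_words T. if in_degree k l w then coef (n # T) (?F w) w else 0)
      + (\<Sum>a\<in>set T. \<Sum>b\<in>insert 0 (set T) - {a}. \<Sum>v\<in>basis_words (remove1 a T). if in_degree k l ((a, n, b) # v)
        then coef (n # T) (?F ((a, n, b) # v)) ((a, n, b) # v) else 0)"
    unfolding word_trace_alt sum_basis_words[OF nT(1)] ..
  also have "(\<Sum>w\<in>basis_words T. if in_degree k l w then coef (n # T) (?F w) w else 0) = word_trace T \<pi> k l"
    unfolding word_trace_alt by (intro sum.cong refl) (simp add: tail)
  also have "(\<Sum>a\<in>set T. \<Sum>b\<in>insert 0 (set T) - {a}. \<Sum>v\<in>basis_words (remove1 a T). if in_degree k l ((a, n, b) # v)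
        then coef (n # T) (?F ((a, n, b) # v)) ((a, n, b) # v) else 0)
      = (\<Sum>a\<in>set T. if \<pi> a = a then S 1 a + of_nat (card {b \<in> set T - {a}. \<pi> b = b}) * S 2 a else 0)"
    by (intro sum.cong refl) (simp only: inner outer cong: sum.cong)
  also have "\<dots> = (\<Sum>a\<in>{a \<in> set T. \<pi> a = a}. S 1 a)
      + (\<Sum>a\<in>{a \<in> set T. \<pi> a = a}. of_nat (card {b \<in> set T - {a}. \<pi> b = b}) * S 2 a)"
    by (simp add: sum.inter_filter[symmetric] sum.distrib)
  finally show ?thesis unfolding S_def by (simp add: add.assoc)
qed

section \<open>Relabelling the points\<close>

definition relabel :: "(nat \<Rightarrow> nat) \<Rightarrow> (nat \<times> nat \<times> nat) list \<Rightarrow> (nat \<times> nat \<times> nat) list" where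
  "relabel f = map (map_prod f (map_prod f f))"

lemma map_remove1_inj: "inj f \<Longrightarrow> remove1 (f a) (map f xs) = map f (remove1 a xs)"
  by (induction xs) (auto simp: inj_eq)

lemma basis_words_relabel:
  assumes "inj f" "f 0 = 0"
  shows "basis_words (map f L) = relabel f ` basis_words L"
proof (induction L rule: basis_words.induct)
  case (2 n xs)
  have "(\<lambda>w. (f a, f n, f b) # w) ` basis_words (remove1 (f a) (map f xs))
      = relabel f ` (\<lambda>w. (a, n, b) # w) ` basis_words (remove1 a xs)"
    if "a \<in> set xs" "b \<in> insert 0 (set xs) - {a}" for a b
    using 2(2)[OF that] by (simp add: map_remove1_inj[OF assms(1)] image_image relabel_def)
  moreover have "insert 0 (f ` set xs) - {f a} = f ` (insert 0 (set xs) - {a})" for a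
    using assms by (simp add: image_set_diff)
  ultimately have "(\<Union>a\<in>set (map f xs). \<Union>b\<in>insert 0 (set (map f xs)) - {a}.
        (\<lambda>w. (a, f n, b) # w) ` basis_words (remove1 a (map f xs)))
      = relabel f ` (\<Union>a\<in>set xs. \<Union>b\<in>insert 0 (set xs) - {a}. (\<lambda>w. (a, n, b) # w) ` basis_words (remove1 a xs))"
    by (simp add: image_UN)
  then show ?case using 2(1) by (simp add: image_Un)
qed (simp add: relabel_def)

text \<open>Removing a point leaves a list that is not of the form \<open>down m\<close> in general;
  renaming its points makes it so.\<close>

lemma word_trace_relabel:
  assumes f: "inj f" "f 0 = 0" and L: "distinct L" "0 \<notin> set L"
    and \<pi>: "\<pi> permutes set L" and \<sigma>: "\<And>i. i \<in> set L \<Longrightarrow> \<sigma> (f i) = f (\<pi> i)"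
  shows "(word_trace (map f L) \<sigma> k l :: 'k::field_char_0) = word_trace L \<pi> k l"
proof -
  have z: "f i = 0 \<longleftrightarrow> i = 0" for i using f by (metis injD)
  have flat: "flat (relabel f w) = map (map_prod f f) (flat w)" for w
    by (induction w rule: flat.induct) (auto simp: relabel_def)
  have val: "word_val r (relabel f w) = word_val (r \<circ> f) w" for r w
    unfolding word_val_def flat by (rule theta_val_map[OF z])
  have uc: "ucount (map (map_prod f f) xs) = ucount xs" for xs
    by (induction xs) (auto simp: z)
  have deg: "in_degree k l (relabel f w) = in_degree k l w" for w
    by (simp add: in_degree_def flat uc)
  have injr: "inj (relabel f)"
    unfolding relabel_def by (intro inj_mapI prod.inj_map f)
  have fL: "distinct (map f L)" "0 \<notin> set (map f L)"
    using L inj_on_subset[OF f(1) subset_UNIV] by (auto simp: distinct_map z)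
  have ce: "coef (map f L) (\<lambda>r. word_val (r \<circ> \<sigma>) (relabel f w) :: 'k) (relabel f w)
      = coef L (\<lambda>r. word_val (r \<circ> \<pi>) w) w" if w: "w \<in> basis_words L" for w
  proof -
    have \<pi>0: "\<pi> 0 = 0" using permutes_not_in[OF \<pi>] L by simp
    obtain c where c: "is_coef L (\<lambda>r. word_val (r \<circ> \<pi>) w :: 'k) c"
      using word_coef_exists[OF L L permutes_inj[OF \<pi>] \<pi>0 permutes_image[OF \<pi>] w, where 'k = 'k] by blast
    have "is_coef (map f L) (\<lambda>r. word_val (r \<circ> \<sigma>) (relabel f w) :: 'k) (c \<circ> inv_into UNIV (relabel f))"
      unfolding is_coef_def
    proof (intro allI impI)
      fix r :: "nat \<Rightarrow> real" assume "inj_on r (set (map f L))"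
      then have "inj_on (r \<circ> f) (set L)"
        using f by (intro comp_inj_on) (auto intro: inj_on_subset)
      then have "word_val ((r \<circ> f) \<circ> \<pi>) w = (\<Sum>v\<in>basis_words L. c v * word_val (r \<circ> f) v)"
        using c unfolding is_coef_def by blast
      moreover have "word_val (r \<circ> \<sigma>) (relabel f w) = (word_val ((r \<circ> f) \<circ> \<pi>) w :: 'k)"
        unfolding val using \<sigma> by (intro word_val_agree[OF w L]) simp
      ultimately show "word_val (r \<circ> \<sigma>) (relabel f w)
          = (\<Sum>v\<in>basis_words (map f L). (c \<circ> inv_into UNIV (relabel f)) v * word_val r v)"
        unfolding basis_words_relabel[OF f]
        by (simp add: sum.reindex[OF inj_on_subset[OF injr subset_UNIV]] inv_f_f[OF injr] val)
    qed
    from coef_eq[OF fL this, of "relabel f w"] coef_eq[OF L c w] show ?thesis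
      using w by (simp add: basis_words_relabel[OF f] inv_f_f[OF injr])
  qed
  show ?thesis
    unfolding word_trace_alt basis_words_relabel[OF f] sum.reindex[OF inj_on_subset[OF injr subset_UNIV]]
    by (intro sum.cong refl) (simp add: deg ce)
qed

section \<open>The Frobenius characteristic\<close>

lemma mderiv_single:
  "mderiv x (Poly_Mapping.single e c)
    = Poly_Mapping.single (e - Poly_Mapping.single x 1) (of_nat (Poly_Mapping.lookup e x) * c)"
  by (simp add: mderiv_def)

lemma mderiv_superset:
  assumes "finite A" "Poly_Mapping.keys f \<subseteq> A"
  shows "mderiv x f = (\<Sum>e\<in>A. Poly_Mapping.single (e - Poly_Mapping.single x 1)
       (of_nat (Poly_Mapping.lookup e x) * Poly_Mapping.lookup f e))"
  unfolding mderiv_def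
  by (rule sum.mono_neutral_left) (use assms in \<open>auto simp: in_keys_iff\<close>)

lemma mderiv_add: "mderiv x (f + g) = mderiv x f + mderiv x g"
proof -
  let ?A = "Poly_Mapping.keys f \<union> Poly_Mapping.keys g"
  have "Poly_Mapping.keys (f + g) \<subseteq> ?A" by (rule keys_add)
  then show ?thesis
    by (simp add: mderiv_superset[where A = ?A] lookup_add distrib_left single_add sum.distrib)
qed

lemma mderiv_zero [simp]: "mderiv x 0 = 0"
  by (simp add: mderiv_def)

lemma mderiv_sum: "mderiv x (sum f A) = (\<Sum>i\<in>A. mderiv x (f i))"
  by (induction A rule: infinite_finite_induct) (auto simp: mderiv_add)

lemma mderiv_mconst_mult: "mderiv x (mconst c * f) = mconst c * mderiv x f"
proof -
  have "mconst c * f = (\<Sum>e\<in>Poly_Mapping.keys f. Poly_Mapping.single e (c * Poly_Mapping.lookup f e))"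
    by (subst mpol_expand[of f]) (simp add: sum_distrib_left mconst_def mult_single)
  then have "mderiv x (mconst c * f) = (\<Sum>e\<in>Poly_Mapping.keys f. Poly_Mapping.single (e - Poly_Mapping.single x 1)
      (of_nat (Poly_Mapping.lookup e x) * (c * Poly_Mapping.lookup f e)))"
    by (simp add: mderiv_sum mderiv_single)
  also have "\<dots> = mconst c * mderiv x f"
    unfolding mderiv_def sum_distrib_left by (simp add: mconst_def mult_single mult.left_commute)
  finally show ?thesis .
qed

section \<open>Cycle types and the derivative by p_1\<close>

definition cycle_type :: "nat set \<Rightarrow> (nat \<Rightarrow> nat) \<Rightarrow> nat \<Rightarrow>\<^sub>0 nat" where
  "cycle_type S \<pi> = (\<Sum>C\<in>orbit \<pi> ` S. Poly_Mapping.single (card C - 1) 1)"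

text \<open>The set is arbitrary because removing a fixed point leads away from {1..m}.\<close>

definition cycle_monom :: "nat set \<Rightarrow> (nat \<Rightarrow> nat) \<Rightarrow> 'k::field symfun" where
  "cycle_monom S \<pi> = (\<Prod>C\<in>orbit \<pi> ` S. psum (card C))"

lemma cycle_monom_single: "cycle_monom S \<pi> = Poly_Mapping.single (cycle_type S \<pi>) 1"
proof -
  have "(\<Prod>C\<in>A. psum (card C) :: 'k::field symfun) = Poly_Mapping.single (\<Sum>C\<in>A. Poly_Mapping.single (card C - 1) 1) 1"
    for A :: "nat set set"
    by (induction A rule: infinite_finite_induct) (auto simp: psum_def mvar_def mult_single)
  then show ?thesis by (simp add: cycle_monom_def cycle_type_def)
qed

lemma orbit_props:
  assumes \<pi>: "\<pi> permutes S" and S: "finite S"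
  shows "x \<in> orbit \<pi> x" and "x \<in> S \<Longrightarrow> orbit \<pi> x \<subseteq> S"
    and "x \<in> S \<Longrightarrow> card (orbit \<pi> x) \<ge> 1" and "x \<in> S \<Longrightarrow> card (orbit \<pi> x) \<le> card S"
    and "card (orbit \<pi> x) = 1 \<longleftrightarrow> \<pi> x = x"
proof -
  have p: "permutation \<pi>" using \<pi> S permutation_permutes by blast
  show self: "x \<in> orbit \<pi> x" for x by (rule permutation_self_in_orbit[OF p])
  show sub: "x \<in> S \<Longrightarrow> orbit \<pi> x \<subseteq> S" for x by (rule permutes_orbit_subset[OF \<pi>])
  show "x \<in> S \<Longrightarrow> card (orbit \<pi> x) \<ge> 1"
    using self[of x] finite_subset[OF sub S] by (metis One_nat_def Suc_leI card_gt_0_iff empty_iff)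
  show "x \<in> S \<Longrightarrow> card (orbit \<pi> x) \<le> card S" using sub S by (simp add: card_mono)
  show "card (orbit \<pi> x) = 1 \<longleftrightarrow> \<pi> x = x"
    using self[of x] orbit_eq_singleton_iff[of \<pi> x] by (metis One_nat_def card_1_singletonE is_singletonI is_singleton_altdef singletonD)
qed

lemma pcycle_eq: 
  assumes \<pi>: "\<pi> permutes {1..m}" shows "pcycle m \<pi> = cycle_monom {1..m} \<pi>"
proof -
  have "card ` orbit \<pi> ` {1..m} \<subseteq> {1..m}"
    using orbit_props(3,4)[OF \<pi>] by auto
  then have "cycle_monom {1..m} \<pi> = (\<Prod>i\<in>{1..m}. \<Prod>C\<in>{C \<in> orbit \<pi> ` {1..m}. card C = i}. psum (card C) :: 'a symfun)"
    unfolding cycle_monom_def by (intro prod.group[symmetric]) auto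
  also have "\<dots> = (\<Prod>i\<in>{1..m}. \<Prod>C\<in>{C \<in> orbit \<pi> ` {1..m}. card C = i}. psum i)"
    by (intro prod.cong refl) auto
  finally show ?thesis by (simp add: pcycle_def num_cycles_def)
qed

lemma cycle_type_fixed:
  assumes \<pi>: "\<pi> permutes S" and S: "finite S" and x: "x \<in> S" "\<pi> x = x"
  shows "cycle_type S \<pi> = Poly_Mapping.single 0 1 + cycle_type (S - {x}) \<pi>"
proof -
  have ox: "orbit \<pi> x = {x}" using x(2) by (simp add: orbit_eq_singleton_iff)
  have "{x} \<notin> orbit \<pi> ` (S - {x})"
  proof
    assume "{x} \<in> orbit \<pi> ` (S - {x})"
    then obtain y where y: "y \<noteq> x" "orbit \<pi> y = {x}" by auto
    then show False using orbit_props(1)[OF \<pi> S, of y] by simp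
  qed
  moreover have "orbit \<pi> ` S = insert {x} (orbit \<pi> ` (S - {x}))"
    using ox insert_Diff[OF x(1)] by (metis image_insert)
  ultimately show ?thesis using S by (simp add: cycle_type_def)
qed

lemma cycle_monom_fixed:
  assumes "\<pi> permutes S" "finite S" "x \<in> S" "\<pi> x = x"
  shows "cycle_monom S \<pi> = psum 1 * (cycle_monom (S - {x}) \<pi> :: 'k::field symfun)"
  unfolding cycle_monom_single cycle_type_fixed[OF assms] by (simp add: psum_def mvar_def mult_single)

text \<open>Variable 0 is p_1, and the orbits of size 1 are the fixed points.\<close>

lemma lookup_cycle_type:
  assumes \<pi>: "\<pi> permutes S" and S: "finite S"
  shows "Poly_Mapping.lookup (cycle_type S \<pi>) 0 = card {x \<in> S. \<pi> x = x}"
proof -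
  have "Poly_Mapping.lookup (cycle_type S \<pi>) 0 = (\<Sum>C\<in>orbit \<pi> ` S. if card C = 1 then 1 else 0)"
    unfolding cycle_type_def lookup_sum
  proof (intro sum.cong refl)
    fix C assume "C \<in> orbit \<pi> ` S"
    then have "card C \<ge> 1" using orbit_props(3)[OF \<pi> S] by auto
    then show "Poly_Mapping.lookup (Poly_Mapping.single (card C - 1) 1) 0 = (if card C = 1 then 1 else (0::nat))"
      by (auto simp: lookup_single when_def)
  qed
  also have "\<dots> = card {C \<in> orbit \<pi> ` S. card C = 1}"
    using S by (simp add: sum.If_cases Int_def)
  also have "{C \<in> orbit \<pi> ` S. card C = 1} = (\<lambda>x. {x}) ` {x \<in> S. \<pi> x = x}"
    using orbit_props(5)[OF \<pi> S] orbit_eq_singleton_iff[of \<pi>] by (auto simp: image_iff)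
  also have "card \<dots> = card {x \<in> S. \<pi> x = x}"
    by (intro card_image) auto
  finally show ?thesis .
qed

text \<open>The derivative of p_1^f is f p_1^(f-1): the factor f counts the fixed points, and
  removing any one of them leaves the same monomial.\<close>

lemma mderiv_cycle_monom:
  assumes \<pi>: "\<pi> permutes S" and S: "finite S"
  shows "mderiv 0 (cycle_monom S \<pi> :: 'k::field symfun) = (\<Sum>x\<in>{x \<in> S. \<pi> x = x}. cycle_monom (S - {x}) \<pi>)"
proof (cases "{x \<in> S. \<pi> x = x} = {}")
  case True
  \<comment> \<open>Without fixed points the coefficient is 0, so the truncated exponent does not
    matter.\<close>
  then show ?thesis
    unfolding cycle_monom_single mderiv_single lookup_cycle_type[OF \<pi> S] True by simp
next
  case False
  let ?e = "cycle_type S \<pi> - Poly_Mapping.single 0 1"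
  have "cycle_monom (S - {x}) \<pi> = (Poly_Mapping.single ?e 1 :: 'k symfun)" if "x \<in> {x \<in> S. \<pi> x = x}" for x
    using that cycle_type_fixed[OF \<pi> S, of x] by (simp add: cycle_monom_single)
  then have "(\<Sum>x\<in>{x \<in> S. \<pi> x = x}. cycle_monom (S - {x}) \<pi>)
      = (\<Sum>x\<in>{x \<in> S. \<pi> x = x}. Poly_Mapping.single ?e 1 :: 'k symfun)"
    by (intro sum.cong refl)
  also have "\<dots> = Poly_Mapping.single ?e (of_nat (card {x \<in> S. \<pi> x = x}))"
    by (simp add: mult_single single_of_nat[symmetric] del: single_of_nat)
  finally show ?thesis
    by (simp add: cycle_monom_single mderiv_single lookup_cycle_type[OF \<pi> S])
qed

text \<open>Euler's operator for p_1: through it the number of fixed points in the trace recursion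
  becomes a derivative.\<close>

lemma p1_mderiv_cycle_monom:
  assumes \<pi>: "\<pi> permutes S" and S: "finite S"
  shows "psum 1 * mderiv 0 (cycle_monom S \<pi> :: 'k::field symfun) = of_nat (card {x \<in> S. \<pi> x = x}) * cycle_monom S \<pi>"
proof -
  have "(\<Sum>x\<in>{x \<in> S. \<pi> x = x}. psum 1 * cycle_monom (S - {x}) \<pi> :: 'k symfun)
      = (\<Sum>x\<in>{x \<in> S. \<pi> x = x}. cycle_monom S \<pi>)"
    by (intro sum.cong refl) (rule cycle_monom_fixed[OF \<pi> S, symmetric], auto)
  then show ?thesis by (simp add: mderiv_cycle_monom[OF \<pi> S] sum_distrib_left)
qed

lemma cycle_monom_image:
  assumes \<pi>: "\<pi> permutes S" and S: "finite S" and f: "inj_on f S" and \<sigma>: "\<And>x. x \<in> S \<Longrightarrow> \<sigma> (f x) = f (\<pi> x)"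
  shows "cycle_monom (f ` S) \<sigma> = cycle_monom S \<pi>"
proof -
  have o: "orbit \<sigma> (f x) = f ` orbit \<pi> x" if "x \<in> S" for x
    using orbit_props(2)[OF \<pi> S that] \<sigma>
    by (intro orbit_inverse[OF orbit_props(1)[OF \<pi> S], symmetric]) blast
  have "orbit \<sigma> ` f ` S = (`) f ` orbit \<pi> ` S"
    using o by (auto simp: image_iff)
  moreover have "inj_on ((`) f) (orbit \<pi> ` S)"
    using orbit_props(2)[OF \<pi> S] f by (intro inj_onI) (metis (no_types, lifting) imageE inj_on_image_eq_iff)
  moreover have "card (f ` C) = card C" if "C \<in> orbit \<pi> ` S" for C
    using that orbit_props(2)[OF \<pi> S] f by (intro card_image) (auto intro: inj_on_subset)
  ultimately show ?thesis
    unfolding cycle_monom_def by (simp add: prod.reindex cong: prod.cong)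
qed

section \<open>Sums over permutations with a fixed point\<close>

lemma sum_permutations_reindex:
  assumes f: "bij_betw f A B"
    and h: "\<And>\<pi> \<sigma>. \<pi> permutes A \<Longrightarrow> \<sigma> permutes B \<Longrightarrow> (\<And>x. x \<in> A \<Longrightarrow> \<sigma> (f x) = f (\<pi> x)) \<Longrightarrow> h \<sigma> = h' \<pi>"
  shows "(\<Sum>\<sigma> | \<sigma> permutes B. h \<sigma>) = (\<Sum>\<pi> | \<pi> permutes A. h' \<pi>)"
proof -
  note f' = bij_betw_inv_into[OF f]
  have inj: "inj_on f A" using f by (simp add: bij_betw_def)
  show ?thesis
  proof (rule sum.reindex_bij_witness[of _ "map_permutation A f" "map_permutation B (inv_into A f)"]; (elim CollectE)?)
    fix \<sigma> assume \<sigma>: "\<sigma> permutes B"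
    show "map_permutation A f (map_permutation B (inv_into A f) \<sigma>) = \<sigma>"
      by (rule map_permutation_compose_inv[OF f' \<sigma>]) (rule bij_betw_inv_into_right[OF f])
    show p: "map_permutation B (inv_into A f) \<sigma> \<in> {\<pi>. \<pi> permutes A}"
      using map_permutation_permutes[OF f' \<sigma>] by simp
  next
    fix \<pi> assume \<pi>: "\<pi> permutes A"
    show "map_permutation B (inv_into A f) (map_permutation A f \<pi>) = \<pi>"
      by (rule map_permutation_compose_inv[OF f \<pi>]) (rule bij_betw_inv_into_left[OF f])
    show "map_permutation A f \<pi> \<in> {\<sigma>. \<sigma> permutes B}"
      using map_permutation_permutes[OF f \<pi>] by simp
  next
    fix \<sigma> assume \<sigma>: "\<sigma> permutes B"
    let ?\<pi> = "map_permutation B (inv_into A f) \<sigma>"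
    have "map_permutation A f ?\<pi> = \<sigma>"
      by (rule map_permutation_compose_inv[OF f' \<sigma>]) (rule bij_betw_inv_into_right[OF f])
    then have "\<sigma> (f x) = f (?\<pi> x)" if "x \<in> A" for x
      using map_permutation_apply[OF inj that, of ?\<pi>] by simp
    then show "h' ?\<pi> = h \<sigma>" using h[OF map_permutation_permutes[OF f' \<sigma>] \<sigma>] by simp
  qed
qed

lemma permutes_fixing_point:
  "x \<in> S \<Longrightarrow> {\<pi>. \<pi> permutes S \<and> \<pi> x = x} = {\<pi>. \<pi> permutes (S - {x})}"
  by (auto simp: permutes_def)

text \<open>Descending order, so that the recursion for \<open>basis_words\<close> removes the
  largest point first and its stabilizer consists of the permutations of the smaller ones.\<close>

definition down :: "nat \<Rightarrow> nat list" where
  "down m = rev [1..<Suc m]"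

lemma down_simps [simp]: "distinct (down m)" "set (down m) = {1..m}" "0 \<notin> set (down m)"
  "down (Suc m) = Suc m # down m" "down 0 = []"
  by (auto simp: down_def)

text \<open>The coefficient of t^k q^l in the generating function, in terms of word traces; by
  \<open>coeff_frobS\<close> this includes m = 0.\<close>

definition char_poly :: "nat \<Rightarrow> nat \<Rightarrow> nat \<Rightarrow> 'k::field_char_0 symfun" where
  "char_poly m k l = mconst (1 / fact m) *
     (\<Sum>\<pi> | \<pi> permutes {1..m}. mconst (word_trace (down m) \<pi> k l) * cycle_monom {1..m} \<pi>)"

lemma frob_ch_eq:
  "frob_ch m (grY m (2 * k - l)) (grYfix m (2 * k) l) (gract m (\<lambda>_. 1)) = (char_poly m k l :: 'k::field_char_0 symfun)"
proof -
  have "(\<Sum>\<pi> | \<pi> permutes {1..m}. mconst (trace_on (grY m (2 * k - l)) (grYfix m (2 * k) l) (gract m (\<lambda>_. 1) \<pi>)) * pcycle m \<pi>)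
    = (\<Sum>\<pi> | \<pi> permutes {1..m}. mconst (word_trace (down m) \<pi> k l) * cycle_monom {1..m} \<pi> :: 'k symfun)"
    by (intro sum.cong refl) (simp add: trace_eq_word_trace[of "down m"] pcycle_eq)
  then show ?thesis by (simp add: frob_ch_def char_poly_def)
qed

text \<open>Restriction to the stabilizer of a point: conjugation makes all points contribute equally.\<close>

lemma mderiv_char_poly:
  "mderiv 0 (char_poly (Suc m) k l :: 'k::field_char_0 symfun) = mconst (1 / fact m) *
     (\<Sum>\<pi> | \<pi> permutes {1..m}. mconst (word_trace (down (Suc m)) \<pi> k l) * cycle_monom {1..m} \<pi>)"
proof -
  let ?S = "{1..Suc m}" and ?T = "\<lambda>\<pi>. word_trace (down (Suc m)) \<pi> k l :: 'k"
  have fin: "finite {\<pi>. \<pi> permutes ?S}" by (rule finite_permutations) simp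
  let ?X = "\<Sum>\<pi> | \<pi> permutes {1..m}. mconst (?T \<pi>) * (cycle_monom {1..m} \<pi> :: 'k symfun)"
  have each: "(\<Sum>\<pi> | \<pi> permutes ?S \<and> \<pi> x = x. mconst (?T \<pi>) * cycle_monom (?S - {x}) \<pi>) = ?X" if x: "x \<in> ?S" for x
  proof -
    \<comment> \<open>The transposition of \<open>x\<close> and \<open>Suc m\<close> conjugates the
      stabilizers of the two points into each other, and \<open>word_trace_conjugate\<close> shows
      that the traces agree.\<close>
    let ?t = "Transposition.transpose x (Suc m)"
    have t: "?t permutes ?S" using x by (intro permutes_swap_id) auto
    have bij: "bij_betw ?t {1..m} (?S - {x})"
    proof -
      have "?t ` (?S - {Suc m}) = ?t ` ?S - ?t ` {Suc m}"
        by (rule image_set_diff[OF permutes_inj[OF t]])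
      moreover have "?S - {Suc m} = {1..m}" by auto
      ultimately have "?t ` {1..m} = ?S - {x}" using permutes_image[OF t] by simp
      then show ?thesis using permutes_inj_on[OF t] by (simp add: bij_betw_def)
    qed
    show ?thesis
      unfolding permutes_fixing_point[OF x]
    proof (rule sum_permutations_reindex[OF bij])
      fix \<pi> \<sigma> assume \<pi>: "\<pi> permutes {1..m}" and \<sigma>: "\<sigma> permutes ?S - {x}"
        and c: "\<And>y. y \<in> {1..m} \<Longrightarrow> \<sigma> (?t y) = ?t (\<pi> y)"
      have \<pi>': "\<pi> permutes ?S" by (rule permutes_subset[OF \<pi>]) auto
      have \<sigma>': "\<sigma> permutes ?S" by (rule permutes_subset[OF \<sigma>]) auto
      have eq: "\<sigma> (?t y) = ?t (\<pi> y)" for y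
      proof -
        consider "y \<in> {1..m}" | "y = Suc m" | "y \<notin> ?S" by fastforce
        then show ?thesis
        proof cases
          case 2
          then have "\<pi> y = Suc m" using permutes_not_in[OF \<pi>] by simp
          then show ?thesis using 2 permutes_not_in[OF \<sigma>, of x] by simp
        next
          case 3
          then have "?t y = y" "\<pi> y = y" "\<sigma> y = y"
            using permutes_not_in[OF t] permutes_not_in[OF \<pi>'] permutes_not_in[OF \<sigma>'] by blast+
          then show ?thesis by simp
        qed (rule c)
      qed
      have "\<sigma> y = (?t \<circ> \<pi> \<circ> inv_into UNIV ?t) y" for y
        using eq[of "inv_into UNIV ?t y"] permutes_inverses(1)[OF t] by simp
      then have "\<sigma> = ?t \<circ> \<pi> \<circ> inv_into UNIV ?t" by blast
      then have "?T \<sigma> = ?T \<pi>"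
        using word_trace_conjugate[OF down_simps(1,2) \<pi>' t] by (simp only:)
      moreover have "cycle_monom (?t ` {1..m}) \<sigma> = (cycle_monom {1..m} \<pi> :: 'k symfun)"
        by (rule cycle_monom_image[OF \<pi>]) (auto intro: permutes_inj_on[OF t] simp: eq)
      moreover have "?t ` {1..m} = ?S - {x}" using bij by (simp add: bij_betw_def)
      ultimately show "mconst (?T \<sigma>) * cycle_monom (?S - {x}) \<sigma> = mconst (?T \<pi>) * (cycle_monom {1..m} \<pi> :: 'k symfun)"
        by simp
    qed
  qed
  have "mderiv 0 (char_poly (Suc m) k l :: 'k symfun) = mconst (1 / fact (Suc m)) *
     (\<Sum>\<pi> | \<pi> permutes ?S. mconst (?T \<pi>) * mderiv 0 (cycle_monom ?S \<pi>))"
    by (simp only: char_poly_def mderiv_mconst_mult mderiv_sum)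
  also have "(\<Sum>\<pi> | \<pi> permutes ?S. mconst (?T \<pi>) * mderiv 0 (cycle_monom ?S \<pi>))
      = (\<Sum>\<pi> | \<pi> permutes ?S. \<Sum>x\<in>{x \<in> ?S. \<pi> x = x}. mconst (?T \<pi>) * cycle_monom (?S - {x}) \<pi>)"
    by (rule sum.cong[OF refl]) (simp only: mem_Collect_eq mderiv_cycle_monom[OF _ finite_atLeastAtMost] sum_distrib_left)
  \<comment> \<open>Pairs of a permutation and a fixed point are sorted by the point; each of the m
    + 1 points gives \<open>?X\<close>, which turns 1/(m+1)! into 1/m!.\<close>
  also have "\<dots> = (\<Sum>x\<in>?S. \<Sum>\<pi>\<in>{\<pi> \<in> {\<pi>. \<pi> permutes ?S}. \<pi> x = x}. mconst (?T \<pi>) * cycle_monom (?S - {x}) \<pi>)"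
    by (rule sum.swap_restrict[OF fin]) simp
  also have "\<dots> = (\<Sum>x\<in>?S. ?X)"
    by (rule sum.cong[OF refl]) (simp only: mem_Collect_eq each)
  also have "\<dots> = mconst (of_nat (Suc m)) * ?X"
    by (simp only: sum_constant card_atLeastAtMost mconst_of_nat) simp
  also have "mconst (1 / fact (Suc m)) * (mconst (of_nat (Suc m)) * ?X) = mconst (1 / fact m) * ?X"
  proof -
    have "1 / fact (Suc m) * of_nat (Suc m) = (1 / fact m :: 'k)"
      using of_nat_neq_0[of m, where 'a = 'k] by (simp add: field_simps del: of_nat_Suc)
    then show ?thesis by (simp only: mult.assoc[symmetric] mconst_mult[symmetric])
  qed
  finally show ?thesis .
qed

lemma remove1_down:
  assumes "a \<in> {1..Suc m}"
  shows "remove1 a (down (Suc m)) = map (\<lambda>i. if i < a then i else Suc i) (down m)"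
  using assms
proof (induction m)
  case (Suc m)
  show ?case
  proof (cases "a = Suc (Suc m)")
    case True
    then have "map (\<lambda>i. if i < a then i else Suc i) (down (Suc m)) = map (\<lambda>i. i) (down (Suc m))"
      by (intro map_cong refl) auto
    then show ?thesis using True by simp
  next
    case False
    then have a: "a \<in> {1..Suc m}" using Suc.prems by auto
    then show ?thesis using Suc.IH[OF a] by auto
  qed
qed auto

lemma skip_image:
  assumes "a \<in> {1..Suc m}"
  shows "(\<lambda>i. if i < a then i else Suc i) ` {1..m} = {1..Suc m} - {a}"
proof -
  have "set (remove1 a (down (Suc m))) = {1..Suc m} - {a}"
    by (simp only: set_remove1_eq[OF down_simps(1)] down_simps(2))
  then show ?thesis by (simp only: remove1_down[OF assms] set_map down_simps(2))
qed

text \<open>Dropping the fixed point \<open>a\<close> and closing the gap gives the permutations of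
  {1..m}; the lost cycle is the factor p_1.\<close>

lemma sum_stabilizer:
  fixes h :: "(nat \<Rightarrow> nat) \<Rightarrow> 'k::field_char_0"
  assumes a: "a \<in> {1..Suc m}"
    and h: "\<And>\<pi> \<sigma>. \<pi> permutes {1..m} \<Longrightarrow> \<sigma> permutes {1..Suc m} - {a} \<Longrightarrow>
      (\<And>x. x \<in> {1..m} \<Longrightarrow> \<sigma> (if x < a then x else Suc x) = (if \<pi> x < a then \<pi> x else Suc (\<pi> x))) \<Longrightarrow> h \<sigma> = h' \<pi>"
  shows "(\<Sum>\<sigma> | \<sigma> permutes {1..Suc m} \<and> \<sigma> a = a. mconst (h \<sigma>) * cycle_monom {1..Suc m} \<sigma>)
    = psum 1 * (\<Sum>\<pi> | \<pi> permutes {1..m}. mconst (h' \<pi>) * cycle_monom {1..m} \<pi>)"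
proof -
  let ?f = "\<lambda>i. if i < a then i else Suc i"
  have inj: "inj ?f" by (auto simp: inj_def)
  have im: "?f ` {1..m} = {1..Suc m} - {a}"
    by (rule skip_image[OF a])
  have bij: "bij_betw ?f {1..m} ({1..Suc m} - {a})"
    using inj_on_subset[OF inj subset_UNIV] im by (simp add: bij_betw_def)
  have "(\<Sum>\<sigma> | \<sigma> permutes {1..Suc m} \<and> \<sigma> a = a. mconst (h \<sigma>) * cycle_monom {1..Suc m} \<sigma>)
      = (\<Sum>\<pi> | \<pi> permutes {1..m}. psum 1 * (mconst (h' \<pi>) * cycle_monom {1..m} \<pi>))"
    unfolding permutes_fixing_point[OF a]
  proof (rule sum_permutations_reindex[OF bij])
    fix \<pi> \<sigma> assume \<pi>: "\<pi> permutes {1..m}" and \<sigma>: "\<sigma> permutes {1..Suc m} - {a}"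
      and c: "\<And>x. x \<in> {1..m} \<Longrightarrow> \<sigma> (?f x) = ?f (\<pi> x)"
    have \<sigma>': "\<sigma> permutes {1..Suc m}" by (rule permutes_subset[OF \<sigma>]) auto
    have "\<sigma> a = a" using permutes_not_in[OF \<sigma>] by simp
    from cycle_monom_fixed[OF \<sigma>' _ a this]
    have "cycle_monom {1..Suc m} \<sigma> = psum 1 * (cycle_monom ({1..Suc m} - {a}) \<sigma> :: 'k symfun)" by simp
    also have "cycle_monom ({1..Suc m} - {a}) \<sigma> = (cycle_monom {1..m} \<pi> :: 'k symfun)"
      unfolding im[symmetric] using inj_on_subset[OF inj subset_UNIV]
      by (intro cycle_monom_image[OF \<pi>]) (auto simp: c simp del: if_split)
    finally show "mconst (h \<sigma>) * cycle_monom {1..Suc m} \<sigma> = psum 1 * (mconst (h' \<pi>) * cycle_monom {1..m} \<pi>)"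
      using h[OF \<pi> \<sigma> c] by (simp add: mult.left_commute)
  qed
  then show ?thesis by (simp add: sum_distrib_left)
qed

text \<open>The kinds of words in \<open>word_trace_Cons\<close> give the three summands. Summation
  over a fixed point \<open>a\<close> yields m + 1 equal terms, each with a factor p_1, and the
  count of further fixed points becomes p_1 times the derivative.\<close>

lemma mderiv_char_poly_recursion:
  "mderiv 0 (char_poly (Suc (Suc m)) k l :: 'k::field_char_0 symfun) = char_poly (Suc m) k l
    + (if k = 0 \<or> l < 1 then 0 else psum 1 * char_poly m (k - 1) (l - 1))
    + (if k = 0 \<or> l < 2 then 0 else psum 1 * (psum 1 * mderiv 0 (char_poly m (k - 1) (l - 2))))"
proof -
  let ?S = "{1..Suc m}" and ?L = "down (Suc m)"
  let ?P = "{\<pi>. \<pi> permutes ?S}" and ?c = "\<lambda>\<pi>. cycle_monom ?S \<pi> :: 'k symfun"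
  have fin: "finite ?P" by (rule finite_permutations) simp
  let ?f = "\<lambda>a i. if i < a then i else Suc i :: nat"
  \<comment> \<open>The increasing map that skips \<open>a\<close> identifies the traces for all
    \<open>a\<close> with one on {1..m}, so that the sum over \<open>a\<close> is a multiple of a
    single term.\<close>
  have wt: "word_trace (remove1 a ?L) \<sigma> k' l' = (word_trace (down m) \<pi> k' l' :: 'k)"
    and fixed: "card {b \<in> ?S - {a}. \<sigma> b = b} = card {b \<in> {1..m}. \<pi> b = b}"
    if a: "a \<in> ?S" and \<pi>: "\<pi> permutes {1..m}" and c: "\<And>x. x \<in> {1..m} \<Longrightarrow> \<sigma> (?f a x) = ?f a (\<pi> x)"
    for a \<pi> \<sigma> k' l'
  proof -
    have inj: "inj (?f a)" by (auto simp: inj_def)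
    have f0: "?f a 0 = 0" using a by simp
    show "word_trace (remove1 a ?L) \<sigma> k' l' = (word_trace (down m) \<pi> k' l' :: 'k)"
      unfolding remove1_down[OF a] using \<pi> c by (intro word_trace_relabel[OF inj f0]) (simp_all del: if_split)
    have im: "?f a ` {1..m} = ?S - {a}"
      by (rule skip_image[OF a])
    have "{b \<in> ?S - {a}. \<sigma> b = b} = ?f a ` {b \<in> {1..m}. \<pi> b = b}"
    proof -
      have "\<sigma> (?f a x) = ?f a x \<longleftrightarrow> \<pi> x = x" if "x \<in> {1..m}" for x
        unfolding c[OF that] using inj_eq[OF inj] by blast
      then show ?thesis unfolding im[symmetric] by blast
    qed
    then show "card {b \<in> ?S - {a}. \<sigma> b = b} = card {b \<in> {1..m}. \<pi> b = b}"
      by (simp only: card_image[OF inj_on_subset[OF inj subset_UNIV]])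
  qed
  define Y where "Y g = (\<Sum>\<pi> | \<pi> permutes {1..m}. mconst (g \<pi>) * cycle_monom {1..m} \<pi> :: 'k symfun)" for g
  have collect: "mconst (1 / fact (Suc m)) * (\<Sum>\<sigma>\<in>?P. mconst (\<Sum>a\<in>{a \<in> ?S. \<sigma> a = a}. h a \<sigma>) * ?c \<sigma>)
      = mconst (1 / fact m) * (psum 1 * Y h')"
    if h: "\<And>a \<pi> \<sigma>. a \<in> ?S \<Longrightarrow> \<pi> permutes {1..m} \<Longrightarrow> \<sigma> permutes ?S - {a} \<Longrightarrow>
      (\<And>x. x \<in> {1..m} \<Longrightarrow> \<sigma> (?f a x) = ?f a (\<pi> x)) \<Longrightarrow> h a \<sigma> = h' \<pi>" for h h'
  proof -
    have "(\<Sum>\<sigma>\<in>?P. mconst (\<Sum>a\<in>{a \<in> ?S. \<sigma> a = a}. h a \<sigma>) * ?c \<sigma>)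
        = (\<Sum>\<sigma>\<in>?P. \<Sum>a\<in>{a \<in> ?S. \<sigma> a = a}. mconst (h a \<sigma>) * ?c \<sigma>)"
      by (simp only: mconst_sum sum_distrib_right)
    also have "\<dots> = (\<Sum>a\<in>?S. \<Sum>\<sigma>\<in>{\<sigma> \<in> ?P. \<sigma> a = a}. mconst (h a \<sigma>) * ?c \<sigma>)"
      by (rule sum.swap_restrict[OF fin]) simp
    also have "\<dots> = (\<Sum>a\<in>?S. psum 1 * Y h')"
      unfolding Y_def mem_Collect_eq by (rule sum.cong[OF refl], rule sum_stabilizer, assumption, rule h)
    also have "\<dots> = mconst (of_nat (Suc m)) * (psum 1 * Y h')"
      by (simp only: sum_constant card_atLeastAtMost mconst_of_nat) simp
    finally have e: "(\<Sum>\<sigma>\<in>?P. mconst (\<Sum>a\<in>{a \<in> ?S. \<sigma> a = a}. h a \<sigma>) * ?c \<sigma>)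
      = mconst (of_nat (Suc m)) * (psum 1 * Y h')" .
    have "1 / fact (Suc m) * of_nat (Suc m) = (1 / fact m :: 'k)"
      using of_nat_neq_0[of m, where 'a = 'k] by (simp add: field_simps del: of_nat_Suc)
    then show ?thesis unfolding e by (simp only: mult.assoc[symmetric] mconst_mult[symmetric])
  qed
  let ?h1 = "\<lambda>a \<sigma>. word_trace (remove1 a ?L) \<sigma> (k - 1) (l - 1) :: 'k"
  let ?h2 = "\<lambda>a \<sigma>. of_nat (card {b \<in> ?S - {a}. \<sigma> b = b}) * word_trace (remove1 a ?L) \<sigma> (k - 1) (l - 2) :: 'k"
  let ?g2 = "\<lambda>\<pi>. of_nat (card {b \<in> {1..m}. \<pi> b = b}) * word_trace (down m) \<pi> (k - 1) (l - 2) :: 'k"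
  have one: "mconst (1 / fact (Suc m)) * (\<Sum>\<sigma>\<in>?P. mconst (\<Sum>a\<in>{a \<in> ?S. \<sigma> a = a}. ?h1 a \<sigma>) * ?c \<sigma>)
      = psum 1 * char_poly m (k - 1) (l - 1)"
  proof (subst collect)
    show "?h1 a \<sigma> = word_trace (down m) \<pi> (k - 1) (l - 1)"
      if "a \<in> ?S" "\<pi> permutes {1..m}" "\<And>x. x \<in> {1..m} \<Longrightarrow> \<sigma> (?f a x) = ?f a (\<pi> x)" for a \<pi> \<sigma>
      by (rule wt[OF that])
  qed (simp only: char_poly_def Y_def mult.left_commute)
  have "mconst (1 / fact (Suc m)) * (\<Sum>\<sigma>\<in>?P. mconst (\<Sum>a\<in>{a \<in> ?S. \<sigma> a = a}. ?h2 a \<sigma>) * ?c \<sigma>)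
      = mconst (1 / fact m) * (psum 1 * Y ?g2)"
  proof (rule collect)
    show "?h2 a \<sigma> = ?g2 \<pi>"
      if "a \<in> ?S" "\<pi> permutes {1..m}" "\<And>x. x \<in> {1..m} \<Longrightarrow> \<sigma> (?f a x) = ?f a (\<pi> x)" for a \<pi> \<sigma>
      by (simp only: wt[OF that] fixed[OF that])
  qed
  also have "Y ?g2 = psum 1 * (\<Sum>\<pi> | \<pi> permutes {1..m}. mconst (word_trace (down m) \<pi> (k - 1) (l - 2)) * mderiv 0 (cycle_monom {1..m} \<pi>))"
    unfolding Y_def sum_distrib_left
  proof (intro sum.cong refl)
    fix \<pi> assume "\<pi> \<in> {\<pi>. \<pi> permutes {1..m}}"
    then have e: "of_nat (card {b \<in> {1..m}. \<pi> b = b}) * cycle_monom {1..m} \<pi> = psum 1 * mderiv 0 (cycle_monom {1..m} \<pi> :: 'k symfun)"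
      using p1_mderiv_cycle_monom[of \<pi> "{1..m}", where 'k = 'k] by simp
    have "mconst (?g2 \<pi>) * cycle_monom {1..m} \<pi>
      = mconst (word_trace (down m) \<pi> (k - 1) (l - 2)) * (of_nat (card {b \<in> {1..m}. \<pi> b = b}) * cycle_monom {1..m} \<pi> :: 'k symfun)"
      by (simp only: mconst_mult mconst_of_nat mult_ac)
    then show "mconst (?g2 \<pi>) * cycle_monom {1..m} \<pi>
      = psum 1 * (mconst (word_trace (down m) \<pi> (k - 1) (l - 2)) * mderiv 0 (cycle_monom {1..m} \<pi>))"
      unfolding e by (simp only: mult.left_commute)
  qed
  also have "mconst (1 / fact m) * (psum 1 * (psum 1 * (\<Sum>\<pi> | \<pi> permutes {1..m}. mconst (word_trace (down m) \<pi> (k - 1) (l - 2)) * mderiv 0 (cycle_monom {1..m} \<pi>))))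
      = psum 1 * (psum 1 * mderiv 0 (char_poly m (k - 1) (l - 2) :: 'k symfun))"
    by (simp only: char_poly_def mderiv_mconst_mult mderiv_sum mult.left_commute)
  finally have two: "mconst (1 / fact (Suc m)) * (\<Sum>\<sigma>\<in>?P. mconst (\<Sum>a\<in>{a \<in> ?S. \<sigma> a = a}. ?h2 a \<sigma>) * ?c \<sigma>)
      = psum 1 * (psum 1 * mderiv 0 (char_poly m (k - 1) (l - 2)))" .
  have rec: "word_trace (down (Suc (Suc m))) \<sigma> k l = word_trace ?L \<sigma> k l
      + (if k = 0 \<or> l < 1 then 0 else \<Sum>a\<in>{a \<in> ?S. \<sigma> a = a}. ?h1 a \<sigma>)
      + (if k = 0 \<or> l < 2 then 0 else \<Sum>a\<in>{a \<in> ?S. \<sigma> a = a}. ?h2 a \<sigma>)" if "\<sigma> \<in> ?P" for \<sigma>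
    using word_trace_Cons[of "Suc (Suc m)" ?L \<sigma> k l, where 'k = 'k] that
    by (simp only: down_simps(4)[of "Suc m"] down_simps(2)[of "Suc m"] mem_Collect_eq) (simp del: down_simps(4))
  have "mderiv 0 (char_poly (Suc (Suc m)) k l :: 'k symfun) = mconst (1 / fact (Suc m)) *
     (\<Sum>\<sigma>\<in>?P. mconst (word_trace ?L \<sigma> k l
      + (if k = 0 \<or> l < 1 then 0 else \<Sum>a\<in>{a \<in> ?S. \<sigma> a = a}. ?h1 a \<sigma>)
      + (if k = 0 \<or> l < 2 then 0 else \<Sum>a\<in>{a \<in> ?S. \<sigma> a = a}. ?h2 a \<sigma>)) * ?c \<sigma>)"
    unfolding mderiv_char_poly by (intro arg_cong2[where f = "(*)"] refl sum.cong) (simp only: rec)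
  also have "\<dots> = char_poly (Suc m) k l
    + (if k = 0 \<or> l < 1 then 0 else mconst (1 / fact (Suc m)) * (\<Sum>\<sigma>\<in>?P. mconst (\<Sum>a\<in>{a \<in> ?S. \<sigma> a = a}. ?h1 a \<sigma>) * ?c \<sigma>))
    + (if k = 0 \<or> l < 2 then 0 else mconst (1 / fact (Suc m)) * (\<Sum>\<sigma>\<in>?P. mconst (\<Sum>a\<in>{a \<in> ?S. \<sigma> a = a}. ?h2 a \<sigma>) * ?c \<sigma>))"
    unfolding char_poly_def mconst_add distrib_right sum.distrib distrib_left
    by (simp only: mconst_0 if_distrib[of mconst] if_distrib[of "\<lambda>x. x * _"] if_distrib[of "\<lambda>x. _ * x"]
        mult_zero_left mult_zero_right cong: if_cong) (auto simp del: down_simps(4))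
  finally show ?thesis unfolding one two .
qed

section \<open>The generating function and the identity\<close>

lemma char_poly_finite: "finite {(k, l). char_poly m k l \<noteq> (0 :: 'k::field_char_0 symfun)}"
proof (rule finite_subset)
  let ?A = "(\<lambda>w. (length (flat w) div 2, length (flat w) - ucount (flat w))) ` basis_words (down m)"
  show "{(k, l). char_poly m k l \<noteq> (0 :: 'k symfun)} \<subseteq> ?A"
  proof (clarify, rule ccontr)
    fix k l assume nz: "char_poly m k l \<noteq> (0 :: 'k symfun)" and "(k, l) \<notin> ?A"
    then have "\<not> in_degree k l w" if "w \<in> basis_words (down m)" for w
      using that by (auto simp: in_degree_def image_iff)
    then have "word_trace (down m) \<pi> k l = (0 :: 'k)" for \<pi>
      unfolding word_trace_alt by (intro sum.neutral) simp
    then show False using nz by (simp add: char_poly_def)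
  qed
qed simp

text \<open>This agrees with the convention that the generating function for 0 is 1, so n = 2 is not
  a special case.\<close>

lemma char_poly_0: "char_poly 0 k l = (if k = 0 \<and> l = 0 then 1 else 0 :: 'k::field_char_0 symfun)"
proof -
  have "coef [] (\<lambda>r. word_val (r \<circ> id) [] :: 'k) [] = 1"
    by (rule coef_eq[where c = "\<lambda>_. 1"]) (auto simp: is_coef_def)
  moreover have "word_trace [] id k l = (if in_degree k l [] then coef [] (\<lambda>r. word_val (r \<circ> id) [] :: 'k) [] else 0)"
    unfolding word_trace_alt basis_words.simps(1) by (simp only: sum.insert finite.emptyI empty_iff sum.empty add_0_right not_False_eq_True)
  moreover have "in_degree k l [] \<longleftrightarrow> k = 0 \<and> l = 0"
    by (auto simp: in_degree_def)
  ultimately have "word_trace (down 0) id k l = (if k = 0 \<and> l = 0 then 1 else 0 :: 'k)"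
    by (simp only: down_simps(5))
  moreover have "{\<pi>. \<pi> permutes {1..0::nat}} = {id}" by auto
  ultimately show ?thesis by (simp add: char_poly_def cycle_monom_def del: down_simps(5))
qed

lemma coeff_frobS: "coeff (coeff (frobS m) k) l = (char_poly m k l :: 'k::field_char_0 symfun)"
proof (cases "m = 0")
  case True
  then show ?thesis by (auto simp: frobS_def char_poly_0)
next
  case False
  let ?g = "\<lambda>(k, l). monom (monom (char_poly m k l :: 'k symfun) l) k"
  \<comment> \<open>The pair \<open>(k, l)\<close> is inserted so that its term is present even if
    it is zero.\<close>
  let ?A = "insert (k, l) {(k, l). char_poly m k l \<noteq> (0 :: 'k symfun)}"
  have fin: "finite ?A" using char_poly_finite by simp
  have "frobS m = Sum_any ?g"
    using False by (simp add: frobS_def frob_ch_eq)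
  also have "\<dots> = sum ?g ?A"
    by (rule Sum_any.expand_superset[OF fin]) auto
  finally have "coeff (coeff (frobS m) k) l = (\<Sum>x\<in>?A. coeff (coeff (?g x) k) l)"
    by (simp add: coeff_sum)
  also have "\<dots> = (\<Sum>x\<in>?A. if x = (k, l) then char_poly m k l else 0)"
    by (rule sum.cong) (auto split: if_splits)
  finally show ?thesis using fin by simp
qed

lemma coeff_d_p1: "coeff (coeff (d_p1 F) k) l = mderiv 0 (coeff (coeff F k) l)"
  by (simp add: d_p1_def coeff_map_poly)

lemma coeff_tvar: "coeff (coeff (tvar * F) k) l = (if k = 0 then 0 else coeff (coeff F (k - 1)) l)"
  by (cases k) (auto simp: tvar_def)

lemma coeff_qvar: "coeff (coeff (qvar * F) k) l = (if l = 0 then 0 else coeff (coeff F k) (l - 1))"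
  by (cases l) (auto simp: qvar_def)

lemma coeff_p1: "coeff (coeff (p1 * F) k) l = psum 1 * coeff (coeff F k) l"
  by (simp add: p1_def)

theorem theorem9p4:
  fixes n :: nat
  assumes "n \<ge> 2"
  shows "d_p1 (frobS n :: 'k::field_char_0 symfun_tq) =
    frobS (n - 1) + tvar * qvar * p1 * (frobS (n - 2) + qvar * p1 * d_p1 (frobS (n - 2)))"
proof (intro poly_eqI)
  fix k l
  obtain m where n: "n = Suc (Suc m)"
    using assms by (metis add_2_eq_Suc le_Suc_ex)
  show "coeff (coeff (d_p1 (frobS n :: 'k symfun_tq)) k) l =
    coeff (coeff (frobS (n - 1) + tvar * qvar * p1 * (frobS (n - 2) + qvar * p1 * d_p1 (frobS (n - 2)))) k) l"
    unfolding n
    \<comment> \<open>Multiplication by t and q shifts indices, with value 0 below the range; this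
      matches the case distinctions in \<open>mderiv_char_poly_recursion\<close>.\<close>
    by (auto simp: mult.assoc coeff_d_p1 coeff_tvar coeff_qvar coeff_p1 coeff_frobS mderiv_char_poly_recursion
        distrib_left numeral_2_eq_2)
qed

end
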